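(* Let $\mathcal G\in\mathbf G_{\mathrm{fin}}$ be a metric graph with at least one half-line and at least one bounded edge, with edge set $\mathcal E$ and vertex set $\mathcal V$; let $p>2$ and let $m^*$ be a positive integer. Let $W\in L^\infty(\mathcal G)$ and $\rho\in L^\infty(\mathcal G)$ satisfy $\inf_{\mathcal K}\rho>0$, where $\mathcal K$ is the compact core of $\mathcal G$ (the metric subgraph consisting of all the bounded edges of $\mathcal G$). Assume that $W\equiv\rho\equiv0$ on the half-lines of $\mathcal G$. Consider the problem $$(E)\quad\begin{cases}-u''+W(x)u+\lambda u=\rho(x)|u|^{p-2}u&\text{on every edge } e\in\mathcal E,\\ u\text{ is continuous on }\mathcal G,\\ \sum_{e\succ v}\frac{du_e}{dx}(v)=0&\text{at every vertex }v\in\mathcal V,\end{cases}$$ and define $$q_{m^*}(\lambda):=\sup\bigl\{\|u\|_{L^2(\mathcal G)}\bigm| u\in H^1(\mathcal G)\setminus\{0\},\ (\lambda,u)\text{ solves }(E),\ \mathrm m(u)\le m^*\bigr\},$$ with the convention $q_{m^*}(\lambda)=0$ if no such $u$ exists. Then, for all $\tilde\Lambda>0$, there exists $C=C(\mathcal G,p,m^*,W,\rho,\tilde\Lambda)>0$ such that, for all $\lambda\in\mathbb R$: 1. if $\lambda<0$, then $q_{m^*}(\lambda)=0$; 2. every solution $(\lambda,u)\in[0,\tilde\Lambda]\times H^1(\mathcal G)$ of $(E)$ with $\mathrm m(u)\le m^*$ satisfies $\|u\|_{L^\infty(\mathcal G)}\le C$; 3. $q_{m^*}(0)\le C$, and all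 solutions $u\in H^1(\mathcal G)$ with $\lambda=0$ and $\mathrm m(u)\le m^*$ vanish on every half-line of $\mathcal G$; 4. if $0<\lambda\le\tilde\Lambda$, then $q_{m^*}(\lambda)\le C\lambda^{-1/4}$; 5. if $\lambda\ge\tilde\Lambda$, then $q_{m^*}(\lambda)\le C\lambda^{\frac{6-p}{4(p-2)}}$.
   Context: Metric graphs: $\mathcal G=(\mathcal E,\mathcal V)$ with edges $\mathcal E$ and vertices $\mathcal V$; each bounded edge $e$ is identified with $[0,\ell_e]$ and each unbounded edge (half-line) with $[0,+\infty)$. $\mathbf G_{\mathrm{fin}}$ is the class of metric graphs that are connected, have finitely many vertices and edges, and whose edges all have positive (possibly infinite) length. $u_e$ is the restriction of $u$ to $e$. $H^1(\mathcal G)$ is the space of continuous $u:\mathcal G\to\mathbb R$ with $u_e\in H^1(e)$ for every edge. $C_c(\mathcal G)$ is the space of continuous functions with compact support. The notation $e\succ v$ means that $e$ is incident to $v$, and $\frac{du_e}{dx}(v)$ is the derivative along $e$ at $v$ directed away from $v$. Solutions are weak solutions: $\int_{\mathcal G}(u'\varphi'+(W+\lambda)u\varphi)\,dx=\int_{\mathcal G}\rho|u|^{p-2}u\varphi\,dx$ for all $\varphi\in H^1(\mathcal G)\cap C_c(\mathcal G)$. Infima of functions defined a.e. are essential infima. The Morse index $\mathrm m(u)$ of a solution $(\lambda,u)$ is the maximal dimension (or $+\infty$ if there is no maximal integer) of a subspace $X\subset H^1(\mathcal G)\cap C_c(\mathcal G)$ such that $\int_{\mathcal G}(|\varphi'|^2+(W+\lambda)\varphi^2-(p-1)\rho|u|^{p-2}\varphi^2)\,dx<0$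 for all $\varphi\in X\setminus\{0\}$. *)

theory Defs
  imports
    "HOL-Analysis.Analysis"
    "HOL-Probability.Essential_Supremum"
    "HOL-Library.Function_Algebras"
begin

section \<open>Metric graphs\<close>

text \<open>Loops and multiple edges are allowed. A bounded edge \<open>e\<close>, identified with
  \<open>[0, edge_length G e]\<close>, has \<open>origin G e\<close> at coordinate \<open>0\<close> and \<open>terminus G e\<close> at the other end.
  A half-line has \<open>edge_length G e = \<infinity>\<close>; it is attached at its origin only, and the value of
  \<open>terminus G e\<close> is never used.\<close>

record ('v, 'e) metric_graph =
  verts :: "'v set"
  edges :: "'e set"
  origin :: "'e \<Rightarrow> 'v"
  terminus :: "'e \<Rightarrow> 'v"
  edge_length :: "'e \<Rightarrow> ereal"

datatype ('v, 'e) gpoint = Vertex 'v | Inner 'e real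

definition interval_of :: "('v, 'e) metric_graph \<Rightarrow> 'e \<Rightarrow> real set" where
  "interval_of G e = {x. 0 \<le> x \<and> ereal x \<le> edge_length G e}"

definition half_lines :: "('v, 'e) metric_graph \<Rightarrow> 'e set" where
  "half_lines G = {e \<in> edges G. edge_length G e = \<infinity>}"

definition bounded_edges :: "('v, 'e) metric_graph \<Rightarrow> 'e set" where
  "bounded_edges G = {e \<in> edges G. edge_length G e < \<infinity>}"

definition points :: "('v, 'e) metric_graph \<Rightarrow> ('v, 'e) gpoint set" where
  "points G = Vertex ` verts G
     \<union> {Inner e x | e x. e \<in> edges G \<and> 0 < x \<and> ereal x < edge_length G e}"

definition edge_pt :: "('v, 'e) metric_graph \<Rightarrow> 'e \<Rightarrow> real \<Rightarrow> ('v, 'e) gpoint" where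
  "edge_pt G e x =
     (if x = 0 then Vertex (origin G e)
      else if ereal x = edge_length G e then Vertex (terminus G e)
      else Inner e x)"

text \<open>The quotient topology of the disjoint union of the closed edges; for finite graphs it is the
  topology of the shortest-path distance.\<close>

definition graph_topology :: "('v, 'e) metric_graph \<Rightarrow> ('v, 'e) gpoint topology" where
  "graph_topology G = topology (\<lambda>U. U \<subseteq> points G \<and>
     (\<forall>e \<in> edges G. openin (top_of_set (interval_of G e))
        {x \<in> interval_of G e. edge_pt G e x \<in> U}))"

lemma openin_graph_topology:
  "openin (graph_topology G) U \<longleftrightarrow> U \<subseteq> points G \<and>
     (\<forall>e \<in> edges G. openin (top_of_set (interval_of G e))
        {x \<in> interval_of G e. edge_pt G e x \<in> U})"
proof -
  have 1: "{x \<in> interval_of G e. edge_pt G e x \<in> S \<inter> T} =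
      {x \<in> interval_of G e. edge_pt G e x \<in> S} \<inter> {x \<in> interval_of G e. edge_pt G e x \<in> T}"
    for e S T by auto
  have 2: "{x \<in> interval_of G e. edge_pt G e x \<in> \<Union>K} =
      (\<Union>S\<in>K. {x \<in> interval_of G e. edge_pt G e x \<in> S})" for e K by auto
  have "istopology (\<lambda>U. U \<subseteq> points G \<and>
     (\<forall>e \<in> edges G. openin (top_of_set (interval_of G e))
        {x \<in> interval_of G e. edge_pt G e x \<in> U}))"
    unfolding istopology_def 1 2 by (auto intro!: openin_Int openin_Union)
  then show ?thesis
    by (simp add: graph_topology_def)
qed

lemma edge_pt_in_points:
  assumes "e \<in> edges G" "origin G e \<in> verts G"
    "edge_length G e < \<infinity> \<Longrightarrow> terminus G e \<in> verts G" "x \<in> interval_of G e"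
  shows "edge_pt G e x \<in> points G"
proof (cases "ereal x = edge_length G e")
  case True
  then have "edge_length G e < \<infinity>"
    by (simp flip: True)
  then have "terminus G e \<in> verts G"
    by (rule assms(3))
  then show ?thesis
    using assms(2) True by (simp add: edge_pt_def points_def)
next
  case False
  then show ?thesis
    using assms by (auto simp: edge_pt_def points_def interval_of_def less_le)
qed

definition fin_metric_graph :: "('v, 'e) metric_graph \<Rightarrow> bool" where
  "fin_metric_graph G \<longleftrightarrow>
     finite (verts G) \<and> finite (edges G) \<and>
     (\<forall>e \<in> edges G. origin G e \<in> verts G) \<and>
     (\<forall>e \<in> bounded_edges G. terminus G e \<in> verts G) \<and>
     (\<forall>e \<in> edges G. 0 < edge_length G e) \<and>
     connected_space (graph_topology G)"

lemma topspace_graph_topology: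
  assumes "fin_metric_graph G"
  shows "topspace (graph_topology G) = points G"
proof -
  have "{x \<in> interval_of G e. edge_pt G e x \<in> points G} = interval_of G e" if "e \<in> edges G" for e
    using assms that edge_pt_in_points[of e G]
    by (auto simp: fin_metric_graph_def bounded_edges_def)
  then have "openin (graph_topology G) (points G)"
    by (simp add: openin_graph_topology)
  then show ?thesis
    by (metis openin_graph_topology openin_subset openin_topspace subset_antisym)
qed


section \<open>Function spaces\<close>

text \<open>A function on the graph is a function on \<open>gpoint\<close>; \<open>on_edge G u e\<close> is \<open>u\<^sub>e\<close> in the coordinate
  of the edge. Elements of \<open>H\<^sup>1\<close> are normalised to vanish off \<open>points G\<close>, so that the zero function
  is the only representative of zero.\<close>

definition on_edge ::
  "('v, 'e) metric_graph \<Rightarrow> (('v, 'e) gpoint \<Rightarrow> real) \<Rightarrow> 'e \<Rightarrow> real \<Rightarrow> real" where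
  "on_edge G u e x = u (edge_pt G e x)"

definition L2_fun :: "real set \<Rightarrow> (real \<Rightarrow> real) set" where
  "L2_fun I = {f. f \<in> borel_measurable (lebesgue_on I) \<and> integrable (lebesgue_on I) (\<lambda>x. (f x)\<^sup>2)}"

definition test_fun :: "real set \<Rightarrow> (real \<Rightarrow> real) set" where
  "test_fun I = {\<phi>. \<phi> C1_differentiable_on UNIV \<and>
     (\<exists>K. compact K \<and> K \<subseteq> interior I \<and> (\<forall>x. x \<notin> K \<longrightarrow> \<phi> x = 0))}"

definition weak_derivative :: "real set \<Rightarrow> (real \<Rightarrow> real) \<Rightarrow> (real \<Rightarrow> real) \<Rightarrow> bool" where
  "weak_derivative I f g \<longleftrightarrow> (\<forall>\<phi> \<in> test_fun I.
     (LINT x|lebesgue_on I. f x * deriv \<phi> x) = - (LINT x|lebesgue_on I. g x * \<phi> x))"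

definition H1_fun :: "real set \<Rightarrow> (real \<Rightarrow> real) set" where
  "H1_fun I = {f \<in> L2_fun I. \<exists>g \<in> L2_fun I. weak_derivative I f g}"

text \<open>The weak derivative is determined only almost everywhere; we pick a representative.\<close>

definition wderiv :: "real set \<Rightarrow> (real \<Rightarrow> real) \<Rightarrow> real \<Rightarrow> real" where
  "wderiv I f = (SOME g. g \<in> L2_fun I \<and> weak_derivative I f g)"

definition gderiv ::
  "('v, 'e) metric_graph \<Rightarrow> (('v, 'e) gpoint \<Rightarrow> real) \<Rightarrow> 'e \<Rightarrow> real \<Rightarrow> real" where
  "gderiv G u e = wderiv (interval_of G e) (on_edge G u e)"

definition H1_graph :: "('v, 'e) metric_graph \<Rightarrow> (('v, 'e) gpoint \<Rightarrow> real) set" where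
  "H1_graph G = {u. continuous_map (graph_topology G) euclideanreal u \<and>
     (\<forall>e \<in> edges G. on_edge G u e \<in> H1_fun (interval_of G e)) \<and>
     (\<forall>x. x \<notin> points G \<longrightarrow> u x = 0)}"

definition Cc_graph :: "('v, 'e) metric_graph \<Rightarrow> (('v, 'e) gpoint \<Rightarrow> real) set" where
  "Cc_graph G = {u. continuous_map (graph_topology G) euclideanreal u \<and>
     compactin (graph_topology G) (graph_topology G closure_of {x \<in> points G. u x \<noteq> 0}) \<and>
     (\<forall>x. x \<notin> points G \<longrightarrow> u x = 0)}"

text \<open>Integrands are given edge by edge, since derivatives are not functions on the graph.\<close>

definition graph_integral :: "('v, 'e) metric_graph \<Rightarrow> ('e \<Rightarrow> real \<Rightarrow> real) \<Rightarrow> real" where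
  "graph_integral G F = (\<Sum>e\<in>edges G. LINT x|lebesgue_on (interval_of G e). F e x)"

definition L2_norm_graph :: "('v, 'e) metric_graph \<Rightarrow> (('v, 'e) gpoint \<Rightarrow> real) \<Rightarrow> real" where
  "L2_norm_graph G u = sqrt (graph_integral G (\<lambda>e x. (on_edge G u e x)\<^sup>2))"

definition Linf_norm_graph :: "('v, 'e) metric_graph \<Rightarrow> (('v, 'e) gpoint \<Rightarrow> real) \<Rightarrow> ereal" where
  "Linf_norm_graph G f =
     (SUP e\<in>edges G. esssup (lebesgue_on (interval_of G e)) (\<lambda>x. ereal \<bar>on_edge G f e x\<bar>))"

definition Linf_graph :: "('v, 'e) metric_graph \<Rightarrow> (('v, 'e) gpoint \<Rightarrow> real) set" where
  "Linf_graph G = {f. (\<forall>e \<in> edges G.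
       on_edge G f e \<in> borel_measurable (lebesgue_on (interval_of G e))) \<and>
     Linf_norm_graph G f < \<infinity>}"

definition essinf_core :: "('v, 'e) metric_graph \<Rightarrow> (('v, 'e) gpoint \<Rightarrow> real) \<Rightarrow> ereal" where
  "essinf_core G f =
     (INF e\<in>bounded_edges G.
        - esssup (lebesgue_on (interval_of G e)) (\<lambda>x. - ereal (on_edge G f e x)))"

definition zero_on_half_lines ::
  "('v, 'e) metric_graph \<Rightarrow> (('v, 'e) gpoint \<Rightarrow> real) \<Rightarrow> bool" where
  "zero_on_half_lines G f \<longleftrightarrow>
     (\<forall>e \<in> half_lines G. AE x in lebesgue_on (interval_of G e). on_edge G f e x = 0)"


section \<open>Solutions and Morse index\<close>

definition solves ::
  "('v, 'e) metric_graph \<Rightarrow> real \<Rightarrow> (('v, 'e) gpoint \<Rightarrow> real) \<Rightarrow> (('v, 'e) gpoint \<Rightarrow> real) \<Rightarrow>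
   real \<Rightarrow> (('v, 'e) gpoint \<Rightarrow> real) \<Rightarrow> bool" where
  "solves G p W \<rho> \<Lambda> u \<longleftrightarrow> u \<in> H1_graph G \<and>
     (\<forall>\<phi> \<in> H1_graph G \<inter> Cc_graph G.
        graph_integral G (\<lambda>e x. gderiv G u e x * gderiv G \<phi> e x
            + (on_edge G W e x + \<Lambda>) * on_edge G u e x * on_edge G \<phi> e x)
        = graph_integral G (\<lambda>e x. on_edge G \<rho> e x * \<bar>on_edge G u e x\<bar> powr (p - 2)
            * on_edge G u e x * on_edge G \<phi> e x))"

definition action_hessian ::
  "('v, 'e) metric_graph \<Rightarrow> real \<Rightarrow> (('v, 'e) gpoint \<Rightarrow> real) \<Rightarrow> (('v, 'e) gpoint \<Rightarrow> real) \<Rightarrow>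
   real \<Rightarrow> (('v, 'e) gpoint \<Rightarrow> real) \<Rightarrow> (('v, 'e) gpoint \<Rightarrow> real) \<Rightarrow> real" where
  "action_hessian G p W \<rho> \<Lambda> u \<phi> =
     graph_integral G (\<lambda>e x. (gderiv G \<phi> e x)\<^sup>2
       + (on_edge G W e x + \<Lambda>) * (on_edge G \<phi> e x)\<^sup>2
       - (p - 1) * on_edge G \<rho> e x * \<bar>on_edge G u e x\<bar> powr (p - 2) * (on_edge G \<phi> e x)\<^sup>2)"

interpretation fun_vs: vector_space "\<lambda>(c::real) (f::'a \<Rightarrow> real) x. c * f x"
  by unfold_locales (auto simp: fun_eq_iff algebra_simps)

text \<open>The dimension of the library is a natural number and says nothing useful about
  infinite-dimensional spaces.\<close>

definition edim :: "('a \<Rightarrow> real) set \<Rightarrow> enat" where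
  "edim X = (if \<exists>B. finite B \<and> X \<subseteq> fun_vs.span B then enat (fun_vs.dim X) else \<infinity>)"

definition morse_index ::
  "('v, 'e) metric_graph \<Rightarrow> real \<Rightarrow> (('v, 'e) gpoint \<Rightarrow> real) \<Rightarrow> (('v, 'e) gpoint \<Rightarrow> real) \<Rightarrow>
   real \<Rightarrow> (('v, 'e) gpoint \<Rightarrow> real) \<Rightarrow> enat" where
  "morse_index G p W \<rho> \<Lambda> u = Sup {edim X | X.
     fun_vs.subspace X \<and> X \<subseteq> H1_graph G \<inter> Cc_graph G \<and>
     (\<forall>\<phi> \<in> X - {0}. action_hessian G p W \<rho> \<Lambda> u \<phi> < 0)}"

definition mass_set ::
  "('v, 'e) metric_graph \<Rightarrow> real \<Rightarrow> (('v, 'e) gpoint \<Rightarrow> real) \<Rightarrow> (('v, 'e) gpoint \<Rightarrow> real) \<Rightarrow>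
   nat \<Rightarrow> real \<Rightarrow> ereal set" where
  "mass_set G p W \<rho> m \<Lambda> = {ereal (L2_norm_graph G u) | u.
     u \<in> H1_graph G - {0} \<and> solves G p W \<rho> \<Lambda> u \<and> morse_index G p W \<rho> \<Lambda> u \<le> enat m}"

definition q_max ::
  "('v, 'e) metric_graph \<Rightarrow> real \<Rightarrow> (('v, 'e) gpoint \<Rightarrow> real) \<Rightarrow> (('v, 'e) gpoint \<Rightarrow> real) \<Rightarrow>
   nat \<Rightarrow> real \<Rightarrow> ereal" where
  "q_max G p W \<rho> m \<Lambda> =
     (if mass_set G p W \<rho> m \<Lambda> = {} then 0 else Sup (mass_set G p W \<rho> m \<Lambda>))"

end

theory Submission
  imports Defs
begin

text \<open>On a bounded edge a solution is of class \<open>C\<^sup>1\<close> with Lipschitz derivative. Between two zeros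
  \<open>z < z'\<close> on one edge the weak equation shows that the Hessian is negative at \<open>u\<close> cut off to
  \<open>[z, z']\<close> unless \<open>u\<close> vanishes there, so Morse index at most \<open>m\<close> allows at most \<open>m\<close> disjoint nodal
  intervals. After rescaling a window of length comparable to \<open>(1 + \<Lambda>)\<^sup>-\<^sup>1\<^sup>/\<^sup>2\<close> to \<open>[0, 1]\<close>, a solution
  with few nodal intervals is bounded by a constant: it is bounded with its derivative at some point
  of a subinterval without zeros, because a large positive solution is too concave to stay positive,
  and such bounds survive, with a worse constant, the passage through each of the boundedly many
  nodal intervals. This gives \<open>|u| \<le> C (1 + \<Lambda>)\<^sup>1\<^sup>/\<^sup>(\<^sup>p\<^sup>-\<^sup>2\<^sup>)\<close> on the core, and on the half-lines by the
  explicit solution \<open>u(0) exp (- sqrt \<Lambda> x)\<close>; connectedness attaches every half-line to the core.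

  For the mass at large \<open>\<Lambda>\<close>, an edge is cut into cells of length comparable to \<open>\<Lambda>\<^sup>-\<^sup>1\<^sup>/\<^sup>2\<close>. If the
  Hessian is nonnegative at \<open>u\<eta>\<close>, where \<open>\<eta>\<close> is a trapezoid over the cell, then the mass of the cell
  is at most a quarter of the mass of its two neighbours. Apart from the cells near the ends of the
  edge only \<open>3 m\<close> cells can be exceptional, so the total mass is controlled by a bounded number of
  cells. For \<open>\<Lambda> < 0\<close> wide hat functions on a half-line make the Morse index infinite.\<close>

text \<open>\<open>W\<close> and \<open>\<rho>\<close> are merely measurable, so \<open>u''\<close>
  is available only in integrated form: concavity is expressed through increments of
  \<open>u'\<close>, and \<open>u'\<close> itself has to be recovered from the weak equation first.
  All test functions live in the interior of a single edge, where the Hessian is an explicit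
  one-dimensional form; the edges communicate only through continuity at the vertices. The constants
  have to be uniform in \<Lambda>. This is why a window of length D^(-1/2) is combined with the
  amplitude factor D^(-1/(p-2)), where D is \<Lambda> plus a constant of the edge: all rescaled
  solutions then obey one fixed set of inequalities. The exponents have a single source. The
  supremum is of order \<Lambda>^(1/(p-2)) for large \<Lambda>. The squared mass of a bounded edge
  is comparable to that of boundedly many cells of length about \<Lambda>^(-1/2), and a half-line
  carries u(0)^2 / (2 sqrt \<Lambda>). So the norm costs the supremum times \<Lambda>^(-1/4), and
  1/(p-2) - 1/4 = (6-p)/(4(p-2)).\<close>

section \<open>Weak derivatives on intervals\<close>

text \<open>By Henstock's lemma the Riemann sums of \<open>|h|\<close> over fine divisions are small.\<close>

lemma AE_zero_if_integral_zero:
  fixes h :: "real \<Rightarrow> real"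
  assumes h: "integrable (lebesgue_on {a..b}) h"
    and zero: "\<And>x y. a \<le> x \<Longrightarrow> x \<le> y \<Longrightarrow> y \<le> b \<Longrightarrow> (LINT t|lebesgue_on {x..y}. h t) = 0"
  shows "AE x in lebesgue_on {a..b}. h x = 0"
proof -
  have hI: "h integrable_on cbox a b"
    using h by (simp add: integrable_on_lebesgue_on)
  have sub: "integral {x..y} h = 0" if "a \<le> x" "x \<le> y" "y \<le> b" for x y
  proof -
    have "integrable (lebesgue_on {x..y}) h"
      using h that by (rule_tac integrable_subinterval) auto
    then show ?thesis
      using zero[OF that] by (simp add: lebesgue_integral_eq_integral)
  qed
  have "((\<lambda>x. norm (h x)) has_integral 0) (cbox a b)"
  proof (subst has_integral, intro allI impI)
    fix e :: real assume e: "0 < e"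
    obtain \<gamma> where \<gamma>: "gauge \<gamma>"
      and *: "\<And>p. \<lbrakk>p tagged_partial_division_of cbox a b; \<gamma> fine p\<rbrakk>
            \<Longrightarrow> (\<Sum>(x,k) \<in> p. norm (Henstock_Kurzweil_Integration.content k *\<^sub>R h x - integral k h)) < e"
      by (rule Henstock_lemma[OF hI e]) blast
    show "\<exists>\<gamma>. gauge \<gamma> \<and> (\<forall>\<D>. \<D> tagged_division_of cbox a b \<and> \<gamma> fine \<D> \<longrightarrow>
          norm ((\<Sum>(x, k)\<in>\<D>. Henstock_Kurzweil_Integration.content k *\<^sub>R norm (h x)) - 0) < e)"
    proof (intro exI[of _ \<gamma>] conjI allI impI \<gamma>)
      fix \<D> assume D: "\<D> tagged_division_of cbox a b \<and> \<gamma> fine \<D>"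
      then have "(\<Sum>(x,k) \<in> \<D>. norm (Henstock_Kurzweil_Integration.content k *\<^sub>R h x - integral k h)) < e"
        using *[of \<D>] tagged_division_of_def by auto
      also have "(\<Sum>(x,k) \<in> \<D>. norm (Henstock_Kurzweil_Integration.content k *\<^sub>R h x - integral k h))
          = (\<Sum>(x, k)\<in>\<D>. Henstock_Kurzweil_Integration.content k *\<^sub>R norm (h x))"
      proof (rule sum.cong[OF refl], clarify)
        fix x k assume xk: "(x,k) \<in> \<D>"
        then obtain c d where k: "k = cbox c d" using D xk tagged_division_ofD(4)[of \<D> "cbox a b" x k] by auto
        have "k \<subseteq> cbox a b" "x \<in> k" using D xk tagged_division_ofD(2,3)[of \<D> "cbox a b" x k] by simp_all
        then have "integral k h = 0" using sub[of c d] k by (auto simp: subset_iff)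
        then show "norm (Henstock_Kurzweil_Integration.content k *\<^sub>R h x - integral k h) = Henstock_Kurzweil_Integration.content k *\<^sub>R norm (h x)"
          by (simp add: abs_mult)
      qed
      finally have less: "(\<Sum>(x, k)\<in>\<D>. Henstock_Kurzweil_Integration.content k *\<^sub>R norm (h x)) < e" .
      have "0 \<le> (\<Sum>(x, k)\<in>\<D>. Henstock_Kurzweil_Integration.content k *\<^sub>R norm (h x))"
        by (rule sum_nonneg) auto
      then show "norm ((\<Sum>(x, k)\<in>\<D>. Henstock_Kurzweil_Integration.content k *\<^sub>R norm (h x)) - 0) < e"
        using less by simp
    qed
  qed
  then have "(LINT x|lebesgue_on {a..b}. \<bar>h x\<bar>) = 0"
    using h by (simp add: lebesgue_integral_eq_integral integral_unique)
  then show ?thesis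
    using h integral_nonneg_eq_0_iff_AE[of "lebesgue_on {a..b}" "\<lambda>x. \<bar>h x\<bar>"] by simp
qed

section \<open>Lebesgue integrals and almost-everywhere statements on intervals\<close>

lemma integral_lebesgue_on_support:
  fixes f :: "real \<Rightarrow> real"
  assumes "{a..b} \<subseteq> I" "I \<in> sets lebesgue" "\<And>x. x \<in> I \<Longrightarrow> x \<notin> {a..b} \<Longrightarrow> f x = 0"
  shows "(LINT x|lebesgue_on I. f x) = (LINT x|lebesgue_on {a..b}. f x)"
    and "integrable (lebesgue_on I) f \<longleftrightarrow> integrable (lebesgue_on {a..b}) f"
proof -
  have eq: "(\<lambda>x. indicat_real I x *\<^sub>R f x) = (\<lambda>x. indicat_real {a..b} x *\<^sub>R f x)"
    using assms by (auto simp: fun_eq_iff indicator_def)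
  show "(LINT x|lebesgue_on I. f x) = (LINT x|lebesgue_on {a..b}. f x)"
    using assms(2) by (simp add: integral_restrict_space eq del: real_scaleR_def)
  show "integrable (lebesgue_on I) f \<longleftrightarrow> integrable (lebesgue_on {a..b}) f"
    using assms(2) by (simp add: integrable_restrict_space eq del: real_scaleR_def)
qed

lemma integrable_lebesgue_on_bounded:
  fixes f :: "real \<Rightarrow> real"
  assumes "f \<in> borel_measurable (lebesgue_on {a..b})" "AE x in lebesgue_on {a..b}. \<bar>f x\<bar> \<le> B"
  shows "integrable (lebesgue_on {a..b}) f"
proof -
  interpret finite_measure "lebesgue_on {a..b}"
    by (rule finite_measure_lebesgue_on) (simp add: lmeasurable_interval)
  show ?thesis using assms by (intro integrable_const_bound[where B=B]) auto
qed

lemma borel_measurable_lebesgue_on: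
  "f \<in> borel_measurable borel \<Longrightarrow> f \<in> borel_measurable (lebesgue_on I)"
  by (intro measurable_restrict_space1 measurable_completion) simp

lemma integrable_lebesgue_on_subset:
  fixes f :: "real \<Rightarrow> real"
  assumes "integrable (lebesgue_on I) f" "J \<subseteq> I" "I \<in> sets lebesgue" "J \<in> sets lebesgue"
  shows "integrable (lebesgue_on J) f"
  using set_integrable_subset[of lebesgue I f J] assms
  by (simp add: set_integrable_def integrable_restrict_space)

lemma L2_integrable_on:
  fixes g :: "real \<Rightarrow> real"
  assumes "g \<in> L2_fun I" "{a..b} \<subseteq> I" "I \<in> sets lebesgue"
  shows "integrable (lebesgue_on {a..b}) g"
proof -
  interpret finite_measure "lebesgue_on {a..b}"
    by (rule finite_measure_lebesgue_on) (simp add: lmeasurable_interval)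
  have g2: "integrable (lebesgue_on {a..b}) (\<lambda>x. (g x)\<^sup>2)"
    using assms by (rule_tac integrable_lebesgue_on_subset[of I]) (auto simp: L2_fun_def)
  have gm: "g \<in> borel_measurable (lebesgue_on {a..b})"
    using assms(1,2) unfolding L2_fun_def by (auto intro: measurable_restrict_mono)
  \<comment> \<open>The constant 1 is integrable because \<open>{a..b}\<close> has finite measure,
    so \<open>1 + g^2\<close> is an integrable majorant.\<close>
  have "norm (g x) \<le> norm (1 + (g x)\<^sup>2)" for x
  proof -
    have "0 \<le> (\<bar>g x\<bar> - 1)\<^sup>2 + \<bar>g x\<bar>" by simp
    then have "\<bar>g x\<bar> \<le> 1 + (g x)\<^sup>2" by (simp add: power2_eq_square algebra_simps)
    then show ?thesis by simp
  qed
  then have "AE x in lebesgue_on {a..b}. norm (g x) \<le> norm (1 + (g x)\<^sup>2)" by simp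
  moreover have "integrable (lebesgue_on {a..b}) (\<lambda>x. 1 + (g x)\<^sup>2)"
    by (intro Bochner_Integration.integrable_add g2) simp
  ultimately show ?thesis
    using Bochner_Integration.integrable_bound gm by blast
qed

lemma AE_lebesgue_on_iff:
  "I \<in> sets lebesgue \<Longrightarrow> (AE x in lebesgue_on I. P x) \<longleftrightarrow> (AE x in lebesgue. x \<in> I \<longrightarrow> P x)"
  by (simp add: AE_restrict_space_iff)

lemma AE_lebesgue_on_mono:
  assumes "AE x in lebesgue_on I. P x" "J \<subseteq> I" "I \<in> sets lebesgue" "J \<in> sets lebesgue"
  shows "AE x in lebesgue_on J. P x"
  using assms by (auto simp: AE_lebesgue_on_iff elim!: AE_mp)

text \<open>The compact intervals with rational ends inside \<open>interior I\<close> are countable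
  in number and cover it, so their exceptional null sets still add up to a null set.\<close>

lemma AE_lebesgue_on_interior:
  fixes I :: "real set"
  assumes P: "\<And>a b. a < b \<Longrightarrow> {a..b} \<subseteq> interior I \<Longrightarrow> AE x in lebesgue_on {a..b}. P x"
    and I: "I \<in> sets lebesgue" "negligible (I - interior I)"
  shows "AE x in lebesgue_on I. P x"
proof -
  define C where "C = {(a, b) \<in> \<rat> \<times> \<rat>. a < b \<and> {a..b::real} \<subseteq> interior I}"
  have "countable C"
    by (rule countable_subset[of _ "\<rat> \<times> \<rat>"]) (auto simp: C_def countable_rat)
  moreover have "AE x in lebesgue. x \<in> {a..b} \<longrightarrow> P x" if "(a, b) \<in> C" for a b
    using P[of a b] that by (simp add: C_def AE_lebesgue_on_iff)
  ultimately have "AE x in lebesgue. \<forall>(a, b) \<in> C. x \<in> {a..b} \<longrightarrow> P x"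
    by (subst AE_ball_countable) auto
  moreover have "AE x in lebesgue. x \<notin> I - interior I"
    using I(2) negligible_iff_null_sets AE_not_in by blast
  ultimately have "AE x in lebesgue. x \<in> I \<longrightarrow> P x"
  proof eventually_elim
    case (elim x)
    show ?case
    proof
      assume "x \<in> I"
      then have "x \<in> interior I" using elim by blast
      then obtain e where e: "e > 0" "cball x e \<subseteq> interior I"
        by (meson open_contains_cball open_interior)
      obtain a where a: "a \<in> \<rat>" "x - e < a" "a < x" using Rats_dense_in_real[of "x - e" x] e by auto
      obtain b where b: "b \<in> \<rat>" "x < b" "b < x + e" using Rats_dense_in_real[of x "x + e"] e by auto
      have "{a..b} \<subseteq> cball x e" using a b by (auto simp: dist_real_def)
      then have "(a, b) \<in> C" using a b e by (auto simp: C_def)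
      then show "P x" using elim a b by auto
    qed
  qed
  then show ?thesis using I(1) by (simp add: AE_lebesgue_on_iff)
qed

text \<open>\<open>\<psi>\<close> is a derivative of \<open>\<phi>\<close> off a finite set; its values there are arbitrary.\<close>

definition piecewise_test :: "real \<Rightarrow> real \<Rightarrow> (real \<Rightarrow> real) \<Rightarrow> (real \<Rightarrow> real) \<Rightarrow> bool" where
  "piecewise_test a b \<phi> \<psi> \<longleftrightarrow> continuous_on UNIV \<phi> \<and> \<psi> \<in> borel_measurable borel \<and> bounded (range \<psi>) \<and>
     (\<exists>S. finite S \<and> (\<forall>x. x \<notin> S \<longrightarrow> (\<phi> has_real_derivative \<psi> x) (at x))) \<and>
     (\<forall>x. x \<notin> {a..b} \<longrightarrow> \<phi> x = 0 \<and> \<psi> x = 0)"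

lemma piecewise_test_measurable:
  assumes "piecewise_test a b \<phi> \<psi>"
  shows "\<phi> \<in> borel_measurable (lebesgue_on J)" "\<psi> \<in> borel_measurable (lebesgue_on J)"
proof -
  have "\<phi> \<in> borel_measurable borel"
    using assms by (intro borel_measurable_continuous_onI) (simp add: piecewise_test_def)
  then show "\<phi> \<in> borel_measurable (lebesgue_on J)" "\<psi> \<in> borel_measurable (lebesgue_on J)"
    using assms by (auto simp: piecewise_test_def intro: borel_measurable_lebesgue_on)
qed

text \<open>\<open>piecewise_test\<close> prescribes zeros only outside \<open>{a..b}\<close>;
  continuity from outside carries them to the two ends. This removes the boundary terms in
  integrations by parts.\<close>

lemma piecewise_test_ends:
  assumes "piecewise_test a b \<phi> \<psi>"
  shows "\<phi> a = 0" "\<phi> b = 0"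
proof -
  have "continuous_on A \<phi>" for A
    using assms continuous_on_subset[of UNIV \<phi> A] by (simp add: piecewise_test_def)
  then show "\<phi> a = 0" "\<phi> b = 0"
    using continuous_constant_on_closure[of "{..<a}" \<phi> 0 a]
      continuous_constant_on_closure[of "{b<..}" \<phi> 0 b] assms
    by (auto simp: piecewise_test_def)
qed

lemma piecewise_test_mono:
  assumes "piecewise_test a b \<phi> \<psi>" "a' \<le> a" "b \<le> b'"
  shows "piecewise_test a' b' \<phi> \<psi>"
  using assms by (auto simp: piecewise_test_def)

lemma piecewise_test_add:
  assumes "piecewise_test a b \<phi>1 \<psi>1" "piecewise_test a b \<phi>2 \<psi>2"
  shows "piecewise_test a b (\<lambda>x. \<phi>1 x + \<phi>2 x) (\<lambda>x. \<psi>1 x + \<psi>2 x)"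
proof -
  obtain S T where "finite S" "\<forall>x. x \<notin> S \<longrightarrow> (\<phi>1 has_real_derivative \<psi>1 x) (at x)"
    "finite T" "\<forall>x. x \<notin> T \<longrightarrow> (\<phi>2 has_real_derivative \<psi>2 x) (at x)"
    using assms unfolding piecewise_test_def by blast
  then have ex: "\<exists>S. finite S \<and> (\<forall>x. x \<notin> S \<longrightarrow> ((\<lambda>x. \<phi>1 x + \<phi>2 x) has_real_derivative \<psi>1 x + \<psi>2 x) (at x))"
    by (intro exI[of _ "S \<union> T"] conjI allI impI DERIV_add) auto
  have "bounded (range (\<lambda>x. \<psi>1 x + \<psi>2 x))"
    using assms bounded_plus_comp[of \<psi>1 UNIV \<psi>2] by (simp add: piecewise_test_def)
  then show ?thesis
    using assms ex unfolding piecewise_test_def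
    by (intro conjI continuous_on_add borel_measurable_add) simp_all
qed

lemma piecewise_test_zero: "piecewise_test a b (\<lambda>x. 0) (\<lambda>x. 0)"
  unfolding piecewise_test_def by (auto intro: exI[of _ "{}"])

lemma piecewise_test_scale:
  assumes "piecewise_test a b \<phi> \<psi>"
  shows "piecewise_test a b (\<lambda>x. c * \<phi> x) (\<lambda>x. c * \<psi> x)"
proof -
  obtain S where "finite S" "\<forall>x. x \<notin> S \<longrightarrow> (\<phi> has_real_derivative \<psi> x) (at x)"
    using assms unfolding piecewise_test_def by blast
  then have ex: "\<exists>S. finite S \<and> (\<forall>x. x \<notin> S \<longrightarrow> ((\<lambda>x. c * \<phi> x) has_real_derivative c * \<psi> x) (at x))"
    by (intro exI[of _ S] conjI allI impI DERIV_cmult) auto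
  have "bounded (range (\<lambda>x. c * \<psi> x))"
    using assms bounded_scaleR_comp[of \<psi> UNIV c] by (simp add: piecewise_test_def)
  then show ?thesis
    using assms ex unfolding piecewise_test_def
    by (intro conjI continuous_on_mult borel_measurable_times) simp_all
qed

lemma piecewise_test_sum:
  assumes "finite A" "\<And>i. i \<in> A \<Longrightarrow> piecewise_test a b (\<phi> i) (\<psi> i)"
  shows "piecewise_test a b (\<lambda>x. \<Sum>i\<in>A. \<phi> i x) (\<lambda>x. \<Sum>i\<in>A. \<psi> i x)"
  using assms by (induction A rule: finite_induct) (auto simp: piecewise_test_zero piecewise_test_add)

lemma continuous_bounded_on_interval:
  fixes f :: "real \<Rightarrow> real"
  assumes "continuous_on {a..b} f"
  obtains B where "\<And>x. x \<in> {a..b} \<Longrightarrow> \<bar>f x\<bar> \<le> B"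
proof -
  have "bounded (f ` {a..b})"
    using assms by (intro compact_imp_bounded compact_continuous_image) auto
  then obtain B where "\<forall>y\<in>f ` {a..b}. norm y \<le> B" unfolding bounded_iff by blast
  then show ?thesis using that[of B] by auto
qed

lemma piecewise_test_integrable:
  assumes "piecewise_test a b \<phi> \<psi>" "f \<in> borel_measurable (lebesgue_on {c..d})"
    "AE x in lebesgue_on {c..d}. \<bar>f x\<bar> \<le> B"
  shows "integrable (lebesgue_on {c..d}) (\<lambda>x. f x * \<psi> x)"
    "integrable (lebesgue_on {c..d}) (\<lambda>x. f x * \<phi> x)"
proof -
  obtain M where M: "\<And>x. \<bar>\<psi> x\<bar> \<le> M"
    using assms(1) unfolding piecewise_test_def bounded_iff by auto
  have [measurable]: "\<psi> \<in> borel_measurable (lebesgue_on {c..d})" "\<phi> \<in> borel_measurable (lebesgue_on {c..d})"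
    by (rule piecewise_test_measurable[OF assms(1)])+
  have "continuous_on {c..d} \<phi>"
    using assms(1) continuous_on_subset[of UNIV \<phi>] by (simp add: piecewise_test_def)
  then obtain N where N: "\<And>x. x \<in> {c..d} \<Longrightarrow> \<bar>\<phi> x\<bar> \<le> N"
    by (rule continuous_bounded_on_interval) blast
  have "AE x in lebesgue_on {c..d}. \<bar>f x * \<psi> x\<bar> \<le> B * M"
    using assms(3) by eventually_elim (auto simp: abs_mult intro!: mult_mono M order_trans[OF abs_ge_zero])
  then show "integrable (lebesgue_on {c..d}) (\<lambda>x. f x * \<psi> x)"
    using assms(2) by (intro integrable_lebesgue_on_bounded) auto
  have "AE x in lebesgue_on {c..d}. x \<in> {c..d}"
    by (simp add: AE_lebesgue_on_iff)
  then have "AE x in lebesgue_on {c..d}. \<bar>f x * \<phi> x\<bar> \<le> B * N"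
    using assms(3)
    by eventually_elim (unfold abs_mult, intro mult_mono N, auto intro: order_trans[OF abs_ge_zero])
  then show "integrable (lebesgue_on {c..d}) (\<lambda>x. f x * \<phi> x)"
    using assms(2) by (intro integrable_lebesgue_on_bounded) auto
qed

lemma test_fun_deriv:
  assumes "\<theta> \<in> test_fun I"
  shows "(\<theta> has_real_derivative deriv \<theta> x) (at x)" "continuous_on A (deriv \<theta>)" "continuous_on A \<theta>"
proof -
  obtain D where D: "\<And>x. (\<theta> has_vector_derivative D x) (at x)" "continuous_on UNIV D"
    using assms by (auto simp: test_fun_def C1_differentiable_on_def)
  then have d: "\<And>x. (\<theta> has_real_derivative D x) (at x)"
    by (simp add: has_real_derivative_iff_has_vector_derivative)
  then have eq: "deriv \<theta> = D" by (auto simp: DERIV_imp_deriv)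
  then show "(\<theta> has_real_derivative deriv \<theta> x) (at x)" using d by simp
  show "continuous_on A (deriv \<theta>)" using D(2) eq continuous_on_subset by auto
  show "continuous_on A \<theta>" using d
    by (meson DERIV_isCont continuous_at_imp_continuous_on)
qed

lemma continuous_on_measurable_bounded:
  fixes f :: "real \<Rightarrow> real"
  assumes "continuous_on {a..b} f"
  shows "f \<in> borel_measurable (lebesgue_on {a..b})" "\<exists>B. AE x in lebesgue_on {a..b}. \<bar>f x\<bar> \<le> B"
proof -
  show "f \<in> borel_measurable (lebesgue_on {a..b})"
    using assms by (intro continuous_imp_measurable_on_sets_lebesgue) auto
  obtain B where "\<And>x. x \<in> {a..b} \<Longrightarrow> \<bar>f x\<bar> \<le> B"
    using assms by (rule continuous_bounded_on_interval) blast
  then show "\<exists>B. AE x in lebesgue_on {a..b}. \<bar>f x\<bar> \<le> B"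
    by (auto simp: AE_lebesgue_on_iff)
qed

text \<open>Integration by parts over \<open>{a..b}\<close>: the fundamental theorem tolerates a
  finite exceptional set, and the boundary terms vanish with \<open>\<phi>\<close>.\<close>

lemma piecewise_test_weak_derivative:
  assumes pt: "piecewise_test a b \<phi> \<psi>" and ab: "a \<le> b" "{a..b} \<subseteq> I" and I: "I \<in> sets lebesgue"
  shows "weak_derivative I \<phi> \<psi>"
  unfolding weak_derivative_def
proof
  fix \<theta> assume \<theta>: "\<theta> \<in> test_fun I"
  obtain S where S: "finite S" "\<And>x. x \<notin> S \<Longrightarrow> (\<phi> has_real_derivative \<psi> x) (at x)"
    using pt unfolding piecewise_test_def by blast
  have "((\<lambda>x. deriv \<theta> x * \<phi> x + \<theta> x * \<psi> x) has_integral \<phi> b * \<theta> b - \<phi> a * \<theta> a) {a..b}"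
  proof (rule fundamental_theorem_of_calculus_interior_strong[OF S(1) ab(1)])
    show "continuous_on {a..b} (\<lambda>x. \<phi> x * \<theta> x)"
      using pt test_fun_deriv(3)[OF \<theta>] by (auto simp: piecewise_test_def intro!: continuous_on_mult elim: continuous_on_subset)
    fix x assume "x \<in> {a<..<b} - S"
    then have "((\<lambda>x. \<phi> x * \<theta> x) has_real_derivative deriv \<theta> x * \<phi> x + \<theta> x * \<psi> x) (at x)"
      using DERIV_mult[OF S(2) test_fun_deriv(1)[OF \<theta>], of x] by (simp add: algebra_simps)
    then show "((\<lambda>x. \<phi> x * \<theta> x) has_vector_derivative deriv \<theta> x * \<phi> x + \<theta> x * \<psi> x) (at x)"
      by (simp add: has_real_derivative_iff_has_vector_derivative)
  qed
  then have 0: "integral {a..b} (\<lambda>x. deriv \<theta> x * \<phi> x + \<theta> x * \<psi> x) = 0"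
    using piecewise_test_ends[OF pt] by (simp add: integral_unique)
  have i: "integrable (lebesgue_on {a..b}) (\<lambda>x. deriv \<theta> x * \<phi> x)"
    "integrable (lebesgue_on {a..b}) (\<lambda>x. \<theta> x * \<psi> x)"
    using piecewise_test_integrable[OF pt] continuous_on_measurable_bounded test_fun_deriv(2,3)[OF \<theta>] by metis+
  then have "(LINT x|lebesgue_on {a..b}. deriv \<theta> x * \<phi> x) + (LINT x|lebesgue_on {a..b}. \<theta> x * \<psi> x) = 0"
    using 0 lebesgue_integral_eq_integral[OF Bochner_Integration.integrable_add[OF i]]
    by (simp add: Bochner_Integration.integral_add[OF i])
  moreover have "(LINT x|lebesgue_on I. deriv \<theta> x * \<phi> x) = (LINT x|lebesgue_on {a..b}. deriv \<theta> x * \<phi> x)"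
    "(LINT x|lebesgue_on I. \<theta> x * \<psi> x) = (LINT x|lebesgue_on {a..b}. \<theta> x * \<psi> x)"
    using pt by (auto intro!: integral_lebesgue_on_support ab I simp: piecewise_test_def)
  ultimately show "(LINT x|lebesgue_on I. \<phi> x * deriv \<theta> x) = - (LINT x|lebesgue_on I. \<psi> x * \<theta> x)"
    by (simp add: mult.commute)
qed

lemma piecewise_test_L2:
  assumes pt: "piecewise_test a b \<phi> \<psi>" and ab: "a \<le> b" "{a..b} \<subseteq> I" and I: "I \<in> sets lebesgue"
  shows "\<phi> \<in> L2_fun I" "\<psi> \<in> L2_fun I"
proof -
  have m: "\<phi> \<in> borel_measurable (lebesgue_on J)" "\<psi> \<in> borel_measurable (lebesgue_on J)" for J
    by (rule piecewise_test_measurable[OF pt])+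
  obtain M where M: "\<And>x. \<bar>\<psi> x\<bar> \<le> M"
    using pt unfolding piecewise_test_def bounded_iff by auto
  have "\<exists>B. AE x in lebesgue_on {a..b}. \<bar>\<phi> x\<bar> \<le> B"
    using pt by (intro continuous_on_measurable_bounded) (auto simp: piecewise_test_def elim: continuous_on_subset)
  then have "integrable (lebesgue_on {a..b}) (\<lambda>x. \<phi> x * \<phi> x)" "integrable (lebesgue_on {a..b}) (\<lambda>x. \<psi> x * \<psi> x)"
    using piecewise_test_integrable[OF pt m(1)] piecewise_test_integrable[OF pt m(2), where B=M] M by auto
  moreover have "integrable (lebesgue_on I) (\<lambda>x. \<phi> x * \<phi> x) \<longleftrightarrow> integrable (lebesgue_on {a..b}) (\<lambda>x. \<phi> x * \<phi> x)"
    "integrable (lebesgue_on I) (\<lambda>x. \<psi> x * \<psi> x) \<longleftrightarrow> integrable (lebesgue_on {a..b}) (\<lambda>x. \<psi> x * \<psi> x)"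
    by (rule integral_lebesgue_on_support(2)[OF ab(2) I]; use pt in \<open>simp add: piecewise_test_def\<close>)+
  ultimately show "\<phi> \<in> L2_fun I" "\<psi> \<in> L2_fun I"
    using m by (auto simp: L2_fun_def power2_eq_square)
qed

text \<open>The antiderivative of the tent of height 2 over \<open>[0, 1]\<close>. It is of class
  C1, as \<open>test_fun\<close> demands, and since the tent has integral 1, its derivative also
  serves as an averaging kernel after rescaling.\<close>

definition smooth_step :: "real \<Rightarrow> real" where
  "smooth_step t = 2 * (max 0 t)\<^sup>2 - 4 * (max 0 (t - 1/2))\<^sup>2 + 2 * (max 0 (t - 1))\<^sup>2"

definition smooth_step_deriv :: "real \<Rightarrow> real" where
  "smooth_step_deriv t = 4 * max 0 t - 8 * max 0 (t - 1/2) + 4 * max 0 (t - 1)"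

lemma has_real_derivative_max_square:
  "((\<lambda>t. (max 0 t)\<^sup>2) has_real_derivative 2 * max 0 t) (at (t::real))"
proof (cases "t = 0")
  case False
  show ?thesis
  proof (cases "t < 0")
    case True
    have "((\<lambda>t. 0) has_real_derivative 2 * max 0 t) (at t)" using True by simp
    then show ?thesis
      using True by (rule_tac has_field_derivative_transform_within_open[of _ _ _ "{..<0}"]) auto
  next
    case f: False
    have "((\<lambda>t. t\<^sup>2) has_real_derivative 2 * max 0 t) (at t)"
      using False f by (auto intro!: derivative_eq_intros)
    then show ?thesis
      using False f by (rule_tac has_field_derivative_transform_within_open[of _ _ _ "{0<..}"]) auto
  qed
next
  case True
  have "((\<lambda>h. (max 0 h)\<^sup>2 / h) \<longlongrightarrow> 0) (at (0::real))"
  proof (rule Lim_null_comparison)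
    show "\<forall>\<^sub>F h in at (0::real). norm ((max 0 h)\<^sup>2 / h) \<le> \<bar>h\<bar>"
      by (rule always_eventually) (auto simp: max_def power2_eq_square)
    show "((\<lambda>h. \<bar>h\<bar>) \<longlongrightarrow> 0) (at (0::real))" by (simp add: tendsto_rabs_zero)
  qed
  then show ?thesis by (simp add: True has_field_derivative_iff)
qed

lemma smooth_step_has_derivative:
  "(smooth_step has_real_derivative smooth_step_deriv t) (at t)"
proof -
  have "((\<lambda>t. (max 0 (t - c))\<^sup>2) has_real_derivative 2 * max 0 (t - c)) (at (t::real))" for c
  proof -
    have "((\<lambda>t. t - c) has_real_derivative 1) (at t)"
      by (auto intro!: derivative_eq_intros)
    then show ?thesis
      using DERIV_chain2[OF has_real_derivative_max_square, of "\<lambda>t. t - c" 1 t] by simp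
  qed
  from this[of "1/2"] this[of 1] has_real_derivative_max_square[of t]
  show ?thesis
    using DERIV_add[OF DERIV_diff[OF DERIV_cmult[where c=2] DERIV_cmult[where c=4]] DERIV_cmult[where c=2]]
    unfolding smooth_step_def[abs_def] smooth_step_deriv_def by fastforce
qed

lemma smooth_step_deriv_continuous: "continuous_on A smooth_step_deriv"
  unfolding smooth_step_deriv_def by (intro continuous_intros)

lemma smooth_step_values:
  "t \<le> 0 \<Longrightarrow> smooth_step t = 0" "t \<ge> 1 \<Longrightarrow> smooth_step t = 1"
  by (auto simp: smooth_step_def max_def power2_eq_square field_simps)

lemma smooth_step_deriv_values:
  "t \<le> 0 \<Longrightarrow> smooth_step_deriv t = 0" "t \<ge> 1 \<Longrightarrow> smooth_step_deriv t = 0" "0 \<le> smooth_step_deriv t"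
  by (auto simp: smooth_step_deriv_def max_def)

lemma smooth_step_bounds: "0 \<le> smooth_step t" "smooth_step t \<le> 1"
proof -
  have mono: "smooth_step x \<le> smooth_step y" if "x \<le> y" for x y
    by (rule DERIV_nonneg_imp_nondecreasing[OF that])
      (use smooth_step_has_derivative smooth_step_deriv_values(3) in blast)
  show "0 \<le> smooth_step t" using mono[of "min 0 t" t] by (simp add: smooth_step_values)
  show "smooth_step t \<le> 1" using mono[of t "max 1 t"] by (simp add: smooth_step_values)
qed

lemma scaled_step_has_derivative:
  "((\<lambda>t. smooth_step (n * (t - x))) has_real_derivative n * smooth_step_deriv (n * (t - x))) (at t)"
proof -
  have "((\<lambda>t. n * (t - x)) has_real_derivative n) (at t)"
    by (auto intro!: derivative_eq_intros)
  from DERIV_chain2[OF smooth_step_has_derivative this] show ?thesis by (simp add: mult.commute)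
qed

text \<open>A one-sided approximate identity: the kernel is nonnegative, lives on
  \<open>[x, x + 1/n]\<close> and has integral 1 once \<open>1/n < z - x\<close>, so it averages
  \<open>f\<close> immediately to the right of \<open>x\<close>.\<close>

lemma kernel_limit:
  fixes f :: "real \<Rightarrow> real"
  assumes f: "continuous_on {x..z} f" and xz: "x < z"
  shows "(\<lambda>n. LINT t|lebesgue_on {x..z}. f t * (real n * smooth_step_deriv (real n * (t - x)))) \<longlonglongrightarrow> f x"
proof (rule LIMSEQ_I)
  fix r :: real assume r: "0 < r"
  define k where "k n t = real n * smooth_step_deriv (real n * (t - x))" for n t
  have k0: "0 \<le> k n t" for n t by (simp add: k_def smooth_step_deriv_values)
  have ck: "continuous_on A (k n)" for n A
    unfolding k_def by (intro continuous_intros continuous_on_compose2[OF smooth_step_deriv_continuous[of UNIV]]) auto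
  have int: "integrable (lebesgue_on {x..z}) g" if "continuous_on {x..z} g" for g :: "real \<Rightarrow> real"
    using that continuous_imp_integrable_real by blast
  obtain d where d: "d > 0" "\<And>t. t \<in> {x..z} \<Longrightarrow> dist t x < d \<Longrightarrow> dist (f t) (f x) < r / 2"
    using f[unfolded continuous_on_iff] xz r by (metis atLeastAtMost_iff half_gt_zero less_eq_real_def)
  obtain N where N: "real N > 1 / d" "real N > 1 / (z - x)"
    using reals_Archimedean2[of "max (1/d) (1/(z-x))"] by auto
  show "\<exists>no. \<forall>n\<ge>no. norm ((LINT t|lebesgue_on {x..z}. f t * (real n * smooth_step_deriv (real n * (t - x)))) - f x) < r"
  proof (intro exI[of _ N] allI impI)
    fix n assume n: "n \<ge> N"
    then have n': "real n > 1 / d" "real n > 1 / (z - x)" using N by linarith+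
    then have npos: "real n > 0" using d(1) by (meson less_trans zero_less_divide_1_iff)
    have nd: "real n * d > 1" "real n * (z - x) > 1"
      using n' d xz by (auto simp: field_simps)
    have "(k n has_integral smooth_step (real n * (z - x)) - smooth_step (real n * (x - x))) {x..z}"
      using xz unfolding k_def
      by (intro fundamental_theorem_of_calculus)
        (auto intro!: has_field_derivative_at_within[OF scaled_step_has_derivative]
          simp: has_real_derivative_iff_has_vector_derivative[symmetric])
    then have "integral {x..z} (k n) = 1" using nd by (simp add: integral_unique smooth_step_values)
    then have k1: "(LINT t|lebesgue_on {x..z}. k n t) = 1"
      using lebesgue_integral_eq_integral[OF int[OF ck]] by simp
    have le: "\<bar>(f t - f x) * k n t\<bar> \<le> r / 2 * k n t" if "t \<in> {x..z}" for t
    proof (cases "t - x < d")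
      case True
      then have "\<bar>f t - f x\<bar> \<le> r / 2" using d(2)[OF that] that by (auto simp: dist_real_def)
      from mult_right_mono[OF this k0[of n t]] show ?thesis using k0[of n t] by (simp add: abs_mult)
    next
      case False
      then have "real n * (t - x) \<ge> real n * d" using npos by simp
      then have "k n t = 0" using nd by (simp add: k_def smooth_step_deriv_values)
      then show ?thesis by simp
    qed
    have "\<bar>LINT t|lebesgue_on {x..z}. (f t - f x) * k n t\<bar> \<le> (LINT t|lebesgue_on {x..z}. r / 2 * k n t)"
      by (rule order_trans[OF integral_abs_bound], rule integral_mono)
        (use le in \<open>auto intro!: Bochner_Integration.integrable_abs int continuous_intros f ck\<close>)
    also have "\<dots> = r / 2" using k1 by simp
    finally have 1: "\<bar>LINT t|lebesgue_on {x..z}. (f t - f x) * k n t\<bar> \<le> r / 2" .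
    have "(LINT t|lebesgue_on {x..z}. (f t - f x) * k n t) = (LINT t|lebesgue_on {x..z}. f t * k n t) - f x * 1"
      unfolding left_diff_distrib k1[symmetric]
      by (subst Bochner_Integration.integral_diff) (auto intro!: int continuous_intros f ck)
    then show "norm ((LINT t|lebesgue_on {x..z}. f t * (real n * smooth_step_deriv (real n * (t - x)))) - f x) < r"
      using 1 r unfolding k_def by simp
  qed
qed

text \<open>The equation is tested with smoothed indicators of \<open>[x, y]\<close>.\<close>

lemma weak_derivative_imp_integral:
  fixes f g :: "real \<Rightarrow> real"
  assumes wd: "weak_derivative I f g" and xyz: "x < y" "y < z" "{x..z} \<subseteq> interior I" and I: "I \<in> sets lebesgue"
    and f: "continuous_on {x..z} f" and g: "integrable (lebesgue_on {x..z}) g"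
  shows "(LINT t|lebesgue_on {x..y}. g t) = f y - f x"
proof -
  \<comment> \<open>The rise takes place on \<open>[x, x + 1/n]\<close> and the fall on
    \<open>[y, y + 1/n]\<close>, so the derivative is a difference of two kernels as in
    \<open>kernel_limit\<close>. The fall needs the room between \<open>y\<close> and
    \<open>z\<close>.\<close>
  define \<theta> where "\<theta> n t = smooth_step (real n * (t - x)) - smooth_step (real n * (t - y))" for n t
  define \<theta>' where "\<theta>' n t = real n * smooth_step_deriv (real n * (t - x)) - real n * smooth_step_deriv (real n * (t - y))" for n t
  have xzI: "{x..z} \<subseteq> I" using xyz interior_subset by blast
  have cs: "continuous_on A (\<lambda>t. real n * smooth_step_deriv (real n * (t - c)))" for n A c
    by (intro continuous_intros continuous_on_compose2[OF smooth_step_deriv_continuous[of UNIV]]) auto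
  have der: "(\<theta> n has_real_derivative \<theta>' n t) (at t)" for n t
    unfolding \<theta>_def[abs_def] \<theta>'_def by (intro DERIV_diff scaled_step_has_derivative)
  have deriv: "deriv (\<theta> n) = \<theta>' n" for n using der DERIV_imp_deriv by blast
  have c': "continuous_on A (\<theta>' n)" for A n unfolding \<theta>'_def by (intro continuous_intros cs)
  have c: "continuous_on A (\<theta> n)" for A n
    using der by (meson DERIV_isCont continuous_at_imp_continuous_on)
  obtain N where N: "real N > 1 / (z - y)"
    using reals_Archimedean2 by blast
  have big: "real n * (z - y) > 1" if "n \<ge> N" for n
  proof -
    have "real n > 1 / (z - y)" using N that by linarith
    then show ?thesis using xyz by (simp add: field_simps)
  qed
  have outx: "\<theta> n t = 0" "\<theta>' n t = 0" if "t \<le> x" for n t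
  proof -
    have "real n * (t - x) \<le> 0" "real n * (t - y) \<le> 0" using that xyz by (auto intro!: mult_nonneg_nonpos)
    then show "\<theta> n t = 0" "\<theta>' n t = 0"
      by (auto simp: \<theta>_def \<theta>'_def smooth_step_values smooth_step_deriv_values)
  qed
  have outz: "\<theta> n t = 0" "\<theta>' n t = 0" if "t \<ge> z" "n \<ge> N" for n t
  proof -
    have "real n * (z - y) \<le> real n * (t - y)" "real n * (t - y) \<le> real n * (t - x)" using that xyz by (auto intro!: mult_left_mono)
    then have "real n * (t - x) \<ge> 1" "real n * (t - y) \<ge> 1" using big[OF that(2)] by linarith+
    then show "\<theta> n t = 0" "\<theta>' n t = 0"
      by (auto simp: \<theta>_def \<theta>'_def smooth_step_values smooth_step_deriv_values)
  qed
  have test: "\<theta> n \<in> test_fun I" if "n \<ge> N" for n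
    unfolding test_fun_def
  proof (intro CollectI conjI)
    show "\<theta> n C1_differentiable_on UNIV"
      unfolding C1_differentiable_on_def using der c'
      by (intro exI[of _ "\<theta>' n"]) (auto simp: has_real_derivative_iff_has_vector_derivative[symmetric])
    show "\<exists>K. compact K \<and> K \<subseteq> interior I \<and> (\<forall>t. t \<notin> K \<longrightarrow> \<theta> n t = 0)"
      using xyz outx outz that by (intro exI[of _ "{x..z}"]) auto
  qed
  have eq: "(LINT t|lebesgue_on {x..z}. f t * \<theta>' n t) = - (LINT t|lebesgue_on {x..z}. g t * \<theta> n t)" if n: "n \<ge> N" for n
  proof -
    have "(LINT t|lebesgue_on I. f t * \<theta>' n t) = - (LINT t|lebesgue_on I. g t * \<theta> n t)"
      using wd test[OF n] by (auto simp: weak_derivative_def deriv)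
    moreover have "(LINT t|lebesgue_on I. f t * \<theta>' n t) = (LINT t|lebesgue_on {x..z}. f t * \<theta>' n t)"
      "(LINT t|lebesgue_on I. g t * \<theta> n t) = (LINT t|lebesgue_on {x..z}. g t * \<theta> n t)"
      using outx outz n by (auto intro!: integral_lebesgue_on_support xzI I)
    ultimately show ?thesis by simp
  qed
  have "(\<lambda>n. (LINT t|lebesgue_on {x..z}. f t * (real n * smooth_step_deriv (real n * (t - x))))
      - (LINT t|lebesgue_on {y..z}. f t * (real n * smooth_step_deriv (real n * (t - y))))) \<longlonglongrightarrow> f x - f y"
    using xyz by (intro tendsto_diff kernel_limit continuous_on_subset[OF f]) auto
  also have "(\<lambda>n. (LINT t|lebesgue_on {x..z}. f t * (real n * smooth_step_deriv (real n * (t - x))))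
      - (LINT t|lebesgue_on {y..z}. f t * (real n * smooth_step_deriv (real n * (t - y))))) =
      (\<lambda>n. LINT t|lebesgue_on {x..z}. f t * \<theta>' n t)"
  proof
    fix n
    have "(LINT t|lebesgue_on {x..z}. f t * (real n * smooth_step_deriv (real n * (t - y))))
      = (LINT t|lebesgue_on {y..z}. f t * (real n * smooth_step_deriv (real n * (t - y))))"
      using xyz
      by (intro integral_lebesgue_on_support)
        (auto intro!: smooth_step_deriv_values(1) mult_nonneg_nonpos)
    moreover have "integrable (lebesgue_on {x..z}) (\<lambda>t. f t * (real n * smooth_step_deriv (real n * (t - c))))" for c
      by (intro continuous_imp_integrable_real continuous_on_mult f cs)
    ultimately show "(LINT t|lebesgue_on {x..z}. f t * (real n * smooth_step_deriv (real n * (t - x))))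
      - (LINT t|lebesgue_on {y..z}. f t * (real n * smooth_step_deriv (real n * (t - y)))) =
      (LINT t|lebesgue_on {x..z}. f t * \<theta>' n t)"
      unfolding \<theta>'_def right_diff_distrib by simp
  qed
  finally have lim1: "(\<lambda>n. LINT t|lebesgue_on {x..z}. f t * \<theta>' n t) \<longlonglongrightarrow> f x - f y" .
  have lim2: "(\<lambda>n. LINT t|lebesgue_on {x..z}. g t * \<theta> n t) \<longlonglongrightarrow> (LINT t|lebesgue_on {x..z}. g t * indicator {x<..y} t)"
  proof (rule integral_dominated_convergence[where w = "\<lambda>t. \<bar>g t\<bar>"])
    have [measurable]: "\<theta> n \<in> borel_measurable (lebesgue_on {x..z})" for n
      by (rule continuous_on_measurable_bounded(1)[OF c])
    show "(\<lambda>t. g t * \<theta> n t) \<in> borel_measurable (lebesgue_on {x..z})" for n using g by auto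
    show "(\<lambda>t. g t * indicator {x<..y} t) \<in> borel_measurable (lebesgue_on {x..z})"
      using g borel_measurable_lebesgue_on[of "indicat_real {x<..y}" "{x..z}"] by auto
    show "integrable (lebesgue_on {x..z}) (\<lambda>t. \<bar>g t\<bar>)" using g by simp
    have "\<bar>\<theta> n t\<bar> \<le> 1" for n t
      using smooth_step_bounds[of "real n * (t - x)"] smooth_step_bounds[of "real n * (t - y)"]
      unfolding \<theta>_def by linarith
    then show "AE t in lebesgue_on {x..z}. norm (g t * \<theta> n t) \<le> \<bar>g t\<bar>" for n
      by (auto simp: abs_mult mult_left_le)
    have step: "(\<lambda>n. smooth_step (real n * (t - c))) \<longlonglongrightarrow> indicator {c<..} t" for t c
    proof (cases "c < t")
      case True
      obtain N where N: "real N > 1 / (t - c)" using reals_Archimedean2 by blast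
      have "smooth_step (real n * (t - c)) = 1" if "n \<ge> N" for n
      proof -
        have "real n > 1 / (t - c)" using N that by linarith
        then show ?thesis using True by (simp add: field_simps smooth_step_values)
      qed
      then have "\<forall>\<^sub>F n in sequentially. smooth_step (real n * (t - c)) = 1"
        by (auto simp: eventually_sequentially)
      then show ?thesis using True by (simp add: tendsto_eventually)
    next
      case False
      then have "smooth_step (real n * (t - c)) = 0" for n
        by (intro smooth_step_values mult_nonneg_nonpos) auto
      then show ?thesis using False by simp
    qed
    have "(\<lambda>n. \<theta> n t) \<longlonglongrightarrow> indicator {x<..y} t" for t
    proof -
      have "(\<lambda>n. \<theta> n t) \<longlonglongrightarrow> indicator {x<..} t - indicator {y<..} t"
        unfolding \<theta>_def by (intro tendsto_diff step)
      moreover have "indicator {x<..} t - indicator {y<..} t = (indicator {x<..y} t :: real)"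
        using xyz by (auto simp: indicator_def)
      ultimately show ?thesis by simp
    qed
    then show "AE t in lebesgue_on {x..z}. (\<lambda>n. g t * \<theta> n t) \<longlonglongrightarrow> g t * indicator {x<..y} t"
      by (auto intro!: tendsto_mult)
  qed
  have "(LINT t|lebesgue_on {x..z}. g t * indicator {x<..y} t) = (LINT t|lebesgue_on {x..y}. g t * indicator {x<..y} t)"
    using xyz by (intro integral_lebesgue_on_support) auto
  also have "\<dots> = (LINT t|lebesgue_on {x..y}. g t)"
  proof (rule integral_cong_AE)
    have gm: "g \<in> borel_measurable (lebesgue_on {x..y})"
      using g xyz by (meson atLeastatMost_subset_iff borel_measurable_integrable less_imp_le measurable_restrict_mono order_refl)
    then show "(\<lambda>t. g t * indicator {x<..y} t) \<in> borel_measurable (lebesgue_on {x..y})"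
      using borel_measurable_lebesgue_on[of "indicat_real {x<..y}" "{x..y}"] by auto
    show "g \<in> borel_measurable (lebesgue_on {x..y})" by fact
    have "AE t in lebesgue. t \<notin> {x}"
      by (rule AE_not_in) (simp add: negligible_iff_null_sets[symmetric])
    then show "AE t in lebesgue_on {x..y}. g t * indicator {x<..y} t = g t"
      unfolding AE_lebesgue_on_iff[OF lmeasurable_interval(1)[THEN fmeasurableD]]
      by eventually_elim (auto simp: indicator_def)
  qed
  finally have lim2': "(\<lambda>n. - (LINT t|lebesgue_on {x..z}. g t * \<theta> n t)) \<longlonglongrightarrow> - (LINT t|lebesgue_on {x..y}. g t)"
    using tendsto_minus[OF lim2] by simp
  have "\<forall>\<^sub>F n in sequentially. (LINT t|lebesgue_on {x..z}. f t * \<theta>' n t) = - (LINT t|lebesgue_on {x..z}. g t * \<theta> n t)"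
    using eq by (auto simp: eventually_sequentially)
  then have "(\<lambda>n. LINT t|lebesgue_on {x..z}. f t * \<theta>' n t) \<longlonglongrightarrow> - (LINT t|lebesgue_on {x..y}. g t)"
    using lim2' by (simp add: tendsto_cong)
  then have "f x - f y = - (LINT t|lebesgue_on {x..y}. g t)" using LIMSEQ_unique[OF lim1] by blast
  then show ?thesis by simp
qed

section \<open>Uniqueness of weak derivatives\<close>

lemma AE_eq_if_integrals_eq:
  fixes g h :: "real \<Rightarrow> real"
  assumes I: "I \<in> sets lebesgue" "negligible (I - interior I)"
    and g: "\<And>a b. {a..b} \<subseteq> interior I \<Longrightarrow> integrable (lebesgue_on {a..b}) g"
    and h: "\<And>a b. {a..b} \<subseteq> interior I \<Longrightarrow> integrable (lebesgue_on {a..b}) h"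
    and eq: "\<And>a b. a < b \<Longrightarrow> {a..b} \<subseteq> interior I \<Longrightarrow> (LINT t|lebesgue_on {a..b}. g t) = (LINT t|lebesgue_on {a..b}. h t)"
  shows "AE x in lebesgue_on I. g x = h x"
proof (rule AE_lebesgue_on_interior[OF _ I])
  fix a b :: real assume ab: "a < b" "{a..b} \<subseteq> interior I"
  have "AE x in lebesgue_on {a..b}. g x - h x = 0"
  proof (rule AE_zero_if_integral_zero)
    show "integrable (lebesgue_on {a..b}) (\<lambda>x. g x - h x)" using g h ab(2) by simp
    fix x y assume xy: "a \<le> x" "x \<le> y" "y \<le> b"
    then have sub: "{x..y} \<subseteq> interior I" using ab(2) by auto
    show "(LINT t|lebesgue_on {x..y}. g t - h t) = 0"
    proof (cases "x = y")
      case True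
      then have "integral {x..y} (\<lambda>t. g t - h t) = 0" by simp
      then show ?thesis
        using lebesgue_integral_eq_integral[OF Bochner_Integration.integrable_diff[OF g[OF sub] h[OF sub]]] by simp
    next
      case False
      then show ?thesis using eq[OF _ sub] xy by (simp add: Bochner_Integration.integral_diff[OF g[OF sub] h[OF sub]])
    qed
  qed
  then show "AE x in lebesgue_on {a..b}. g x = h x" by simp
qed

text \<open>\<open>g - h\<close> is a weak derivative of 0, so by
  \<open>weak_derivative_imp_integral\<close> its integrals over compact intervals in the interior
  vanish.\<close>

lemma weak_derivative_unique:
  assumes g: "g \<in> L2_fun I" "weak_derivative I f g" and h: "h \<in> L2_fun I" "weak_derivative I f h"
    and I: "I \<in> sets lebesgue" "negligible (I - interior I)"
  shows "AE x in lebesgue_on I. g x = h x"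
proof (rule AE_eq_if_integrals_eq[OF I])
  have gh: "integrable (lebesgue_on {a..b}) g" "integrable (lebesgue_on {a..b}) h" if "{a..b} \<subseteq> interior I" for a b
    using that interior_subset[of I] g h I by (blast intro: L2_integrable_on)+
  show "integrable (lebesgue_on {a..b}) g" "integrable (lebesgue_on {a..b}) h" if "{a..b} \<subseteq> interior I" for a b
    using gh[OF that] .
  fix a b :: real assume ab: "a < b" "{a..b} \<subseteq> interior I"
  then have "b \<in> interior I" by auto
  \<comment> \<open>\<open>weak_derivative_imp_integral\<close> works on an interval that reaches
    beyond \<open>b\<close>.\<close>
  then obtain e where e: "e > 0" "cball b e \<subseteq> interior I"
    by (meson open_contains_cball open_interior)
  have "{a..b+e} \<subseteq> {a..b} \<union> cball b e" by (auto simp: dist_real_def)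
  then have sub: "{a..b+e} \<subseteq> interior I" using ab e by blast
  have "weak_derivative I (\<lambda>x. 0) (\<lambda>x. g x - h x)"
    unfolding weak_derivative_def
  proof
    fix \<theta> assume \<theta>: "\<theta> \<in> test_fun I"
    \<comment> \<open>The integral of \<open>(g x - h x) * \<theta> x\<close> may be split only when
      both parts are integrable; on the compact support of \<open>\<theta>\<close> the majorant is
      \<open>k^2 + B^2\<close>.\<close>
    have "integrable (lebesgue_on I) (\<lambda>x. k x * \<theta> x)" if k: "k \<in> L2_fun I" for k
    proof -
      obtain K where K: "compact K" "K \<subseteq> interior I" "\<And>x. x \<notin> K \<Longrightarrow> \<theta> x = 0"
        using \<theta> by (auto simp: test_fun_def)
      have "bounded (\<theta> ` K)" by (intro compact_imp_bounded compact_continuous_image test_fun_deriv(3)[OF \<theta>] K)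
      then obtain B where B: "\<And>x. x \<in> K \<Longrightarrow> \<bar>\<theta> x\<bar> \<le> B" unfolding bounded_iff by auto
      have Ks: "K \<in> sets lebesgue" using K(1) by (simp add: lmeasurable_compact fmeasurableD)
      have "integrable (lebesgue_on I) (\<lambda>x. (k x)\<^sup>2 + indicator K x * B\<^sup>2)"
      proof (intro Bochner_Integration.integrable_add)
        show "integrable (lebesgue_on I) (\<lambda>x. (k x)\<^sup>2)" using k by (simp add: L2_fun_def)
        have "integrable lebesgue (\<lambda>x. indicator K x * B\<^sup>2)"
          using K(1) lmeasurable_compact[OF K(1)] by (intro integrable_mult_left integrable_real_indicator) (auto simp: fmeasurable_def Ks)
        then show "integrable (lebesgue_on I) (\<lambda>x. indicator K x * B\<^sup>2)"
          using I(1) by (intro iffD2[OF integrable_restrict_space] integrable_mult_indicator) (simp_all del: integrable_mult_left_iff)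
      qed
      moreover have "\<bar>k x * \<theta> x\<bar> \<le> (k x)\<^sup>2 + indicator K x * B\<^sup>2" for x
      proof (cases "x \<in> K")
        case True
        have "0 \<le> (\<bar>k x\<bar> - \<bar>\<theta> x\<bar>)\<^sup>2 + \<bar>k x * \<theta> x\<bar>" by simp
        then have "\<bar>k x * \<theta> x\<bar> \<le> (k x)\<^sup>2 + (\<theta> x)\<^sup>2"
          by (simp add: power2_eq_square algebra_simps abs_mult)
        moreover have "(\<theta> x)\<^sup>2 \<le> B\<^sup>2" using B[OF True] by (metis abs_ge_zero power2_abs power_mono)
        ultimately show ?thesis using True by simp
      next
        case False then show ?thesis using K(3) by simp
      qed
      moreover have "(\<lambda>x. k x * \<theta> x) \<in> borel_measurable (lebesgue_on I)"
      proof (rule borel_measurable_times)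
        show "k \<in> borel_measurable (lebesgue_on I)" using k by (simp add: L2_fun_def)
        show "\<theta> \<in> borel_measurable (lebesgue_on I)"
          by (intro borel_measurable_lebesgue_on borel_measurable_continuous_onI test_fun_deriv(3)[OF \<theta>])
      qed
      ultimately show ?thesis
        by (rule_tac Bochner_Integration.integrable_bound[where f="\<lambda>x. (k x)\<^sup>2 + indicator K x * B\<^sup>2"]) (auto intro: order_trans[OF _ abs_ge_self])
    qed
    from this[OF g(1)] this[OF h(1)]
    show "(LINT x|lebesgue_on I. 0 * deriv \<theta> x) = - (LINT x|lebesgue_on I. (g x - h x) * \<theta> x)"
      using g(2) h(2) \<theta> by (simp add: weak_derivative_def left_diff_distrib)
  qed
  from weak_derivative_imp_integral[OF this ab(1) _ sub I(1)] e
  have "(LINT t|lebesgue_on {a..b}. g t - h t) = 0"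
    using gh[OF sub] by simp
  then show "(LINT t|lebesgue_on {a..b}. g t) = (LINT t|lebesgue_on {a..b}. h t)"
    using gh[OF ab(2)] by simp
qed

text \<open>This makes the representative picked by \<open>SOME\<close> usable: it agrees almost
  everywhere with any weak derivative that can be exhibited.\<close>

lemma wderiv_eq_AE:
  assumes "g \<in> L2_fun I" "weak_derivative I f g" "I \<in> sets lebesgue" "negligible (I - interior I)"
  shows "AE x in lebesgue_on I. wderiv I f x = g x"
proof -
  have "wderiv I f \<in> L2_fun I \<and> weak_derivative I f (wderiv I f)"
    unfolding wderiv_def by (rule someI[of _ g]) (use assms in blast)
  then show ?thesis using weak_derivative_unique[of "wderiv I f" I f g] assms by blast
qed

section \<open>Test functions on a single edge\<close>

definition open_edge :: "('v, 'e) metric_graph \<Rightarrow> 'e \<Rightarrow> real set" where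
  "open_edge G e = {x. 0 < x \<and> ereal x < edge_length G e}"

lemma interval_of_cases:
  assumes "fin_metric_graph G" "e \<in> edges G"
  obtains "edge_length G e = \<infinity>" "interval_of G e = {0..}" "open_edge G e = {0<..}"
  | l where "edge_length G e = ereal l" "0 < l" "interval_of G e = {0..l}" "open_edge G e = {0<..<l}"
proof (cases "edge_length G e")
  case (real l)
  moreover have "0 < edge_length G e" using assms by (simp add: fin_metric_graph_def)
  ultimately show thesis using that(2)[of l]
    by (auto simp: interval_of_def open_edge_def atLeastAtMost_def atLeast_def atMost_def greaterThanLessThan_def lessThan_def greaterThan_def Int_def)
next
  case PInf
  then show thesis using that(1) by (auto simp: interval_of_def open_edge_def)
next
  case MInf
  then show thesis using assms by (auto simp: fin_metric_graph_def)
qed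

lemma interval_of_facts:
  assumes "fin_metric_graph G" "e \<in> edges G"
  shows "interior (interval_of G e) = open_edge G e" "interval_of G e \<in> sets lebesgue"
    "negligible (interval_of G e - interior (interval_of G e))" "open_edge G e \<subseteq> interval_of G e"
    "closure (open_edge G e) = interval_of G e" "open (open_edge G e)" "closed (interval_of G e)"
    "is_interval (open_edge G e)"
proof -
  have fin: "negligible (interval_of G e - interior (interval_of G e))" if "finite (interval_of G e - interior (interval_of G e))"
    using that negligible_finite by blast
  from assms show "interior (interval_of G e) = open_edge G e" "interval_of G e \<in> sets lebesgue" "open_edge G e \<subseteq> interval_of G e"
    "closure (open_edge G e) = interval_of G e" "open (open_edge G e)" "closed (interval_of G e)"
    "is_interval (open_edge G e)"
    by (cases rule: interval_of_cases; force simp: is_interval_1)+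
  moreover have "interval_of G e - open_edge G e \<subseteq> {0, real_of_ereal (edge_length G e)}"
    by (rule interval_of_cases[OF assms]) auto
  ultimately have "interval_of G e - interior (interval_of G e) \<subseteq> {0, real_of_ereal (edge_length G e)}"
    by simp
  then show "negligible (interval_of G e - interior (interval_of G e))"
    using fin finite_subset by blast
qed

lemma open_edge_interval:
  "a \<in> open_edge G e \<Longrightarrow> b \<in> open_edge G e \<Longrightarrow> {a..b} \<subseteq> open_edge G e"
  by (auto simp: open_edge_def) (metis ereal_less_eq(3) le_less_trans)

lemma continuous_map_edge_pt:
  assumes "fin_metric_graph G" "e \<in> edges G"
  shows "continuous_map (top_of_set (interval_of G e)) (graph_topology G) (edge_pt G e)"
  using assms edge_pt_in_points[of e G]
  by (auto simp: continuous_map_def topspace_graph_topology openin_graph_topology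
      fin_metric_graph_def bounded_edges_def)

text \<open>The universal property of the quotient topology.\<close>

lemma continuous_map_graph_iff:
  assumes "fin_metric_graph G"
  shows "continuous_map (graph_topology G) euclideanreal u \<longleftrightarrow>
    (\<forall>e\<in>edges G. continuous_on (interval_of G e) (on_edge G u e))"
proof
  assume u: "continuous_map (graph_topology G) euclideanreal u"
  show "\<forall>e\<in>edges G. continuous_on (interval_of G e) (on_edge G u e)"
  proof
    fix e assume "e \<in> edges G"
    from continuous_map_compose[OF continuous_map_edge_pt[OF assms this] u]
    show "continuous_on (interval_of G e) (on_edge G u e)"
      by (simp add: on_edge_def[abs_def] comp_def)
  qed
next
  assume u: "\<forall>e\<in>edges G. continuous_on (interval_of G e) (on_edge G u e)"
  show "continuous_map (graph_topology G) euclideanreal u"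
    unfolding continuous_map_def topspace_graph_topology[OF assms]
  proof (intro conjI allI impI)
    fix U :: "real set" assume "openin euclideanreal U"
    then have U: "open U" by simp
    show "openin (graph_topology G) {x \<in> points G. u x \<in> U}"
      unfolding openin_graph_topology
    proof (intro conjI ballI)
      fix e assume e: "e \<in> edges G"
      have "{x \<in> interval_of G e. edge_pt G e x \<in> {x \<in> points G. u x \<in> U}}
        = interval_of G e \<inter> on_edge G u e -` U"
        using edge_pt_in_points[OF e] assms e
        by (auto simp: on_edge_def fin_metric_graph_def bounded_edges_def)
      then show "openin (top_of_set (interval_of G e)) {x \<in> interval_of G e. edge_pt G e x \<in> {x \<in> points G. u x \<in> U}}"
        using continuous_openin_preimage_gen[OF u[rule_format, OF e] U] by simp
    qed auto
  qed auto
qed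

section \<open>Extension by zero from one open edge\<close>

definition edge_bump :: "'e \<Rightarrow> (real \<Rightarrow> real) \<Rightarrow> ('v, 'e) gpoint \<Rightarrow> real" where
  "edge_bump e \<phi> x = (case x of Vertex v \<Rightarrow> 0 | Inner e' t \<Rightarrow> if e' = e then \<phi> t else 0)"

lemma on_edge_bump:
  assumes "piecewise_test a b \<phi> \<psi>" "{a..b} \<subseteq> open_edge G e"
  shows "on_edge G (edge_bump e \<phi>) e' = (if e' = e then \<phi> else (\<lambda>x. 0))"
proof
  fix x
  have "\<phi> x = 0" if "x = 0 \<or> ereal x = edge_length G e"
  proof -
    have "x \<notin> {a..b}" using that subsetD[OF assms(2), of x] by (auto simp: open_edge_def)
    then show ?thesis using assms(1) by (simp add: piecewise_test_def)
  qed
  then show "on_edge G (edge_bump e \<phi>) e' x = (if e' = e then \<phi> else (\<lambda>x. 0)) x"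
    by (auto simp: on_edge_def edge_pt_def edge_bump_def)
qed

lemma zero_test: "(\<lambda>x. 0) \<in> L2_fun I" "weak_derivative I (\<lambda>x. 0) (\<lambda>x. 0)"
  by (auto simp: L2_fun_def weak_derivative_def)

lemma edge_bump_in_spaces:
  assumes G: "fin_metric_graph G" and e: "e \<in> edges G"
    and pt: "piecewise_test a b \<phi> \<psi>" and ab: "a \<le> b" "{a..b} \<subseteq> open_edge G e"
  shows "edge_bump e \<phi> \<in> H1_graph G" "edge_bump e \<phi> \<in> Cc_graph G"
proof -
  have zero: "\<And>x. x \<notin> {a..b} \<Longrightarrow> \<phi> x = 0" using pt by (auto simp: piecewise_test_def)
  note oe = on_edge_bump[OF pt ab(2)]
  have cont: "continuous_map (graph_topology G) euclideanreal (edge_bump e \<phi>)"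
    unfolding continuous_map_graph_iff[OF G] oe using pt
    by (auto simp: piecewise_test_def intro: continuous_on_subset)
  have out: "edge_bump e \<phi> x = 0" if "x \<notin> points G" for x
  proof (cases x)
    case (Inner e' t)
    have "\<phi> t = 0" if "e' = e"
    proof (rule zero)
      show "t \<notin> {a..b}"
        using that \<open>x \<notin> points G\<close> Inner e ab(2) by (auto simp: points_def open_edge_def)
    qed
    then show ?thesis by (simp add: edge_bump_def Inner)
  qed (simp add: edge_bump_def)
  have abI: "{a..b} \<subseteq> interval_of G e" using ab(2) interval_of_facts(4)[OF G e] by blast
  have "on_edge G (edge_bump e \<phi>) e' \<in> H1_fun (interval_of G e')" for e'
  proof (cases "e' = e")
    case True
    then show ?thesis
      using piecewise_test_L2[OF pt ab(1) abI interval_of_facts(2)[OF G e]]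
        piecewise_test_weak_derivative[OF pt ab(1) abI interval_of_facts(2)[OF G e]]
      by (auto simp: oe H1_fun_def)
  next
    case False
    then show ?thesis using zero_test by (auto simp: oe H1_fun_def)
  qed
  then show "edge_bump e \<phi> \<in> H1_graph G"
    using cont out by (auto simp: H1_graph_def)
  define K where "K = edge_pt G e ` {a..b}"
  have inner: "edge_pt G e x = Inner e x" if "x \<in> {a..b}" for x
    using that ab(2) by (auto simp: edge_pt_def open_edge_def)
  have Kiff: "edge_pt G e' x \<in> K \<longleftrightarrow> e' = e \<and> x \<in> {a..b}" for e' x
    using inner ab(2) by (auto simp: K_def edge_pt_def open_edge_def subset_iff image_iff split: if_splits)
  have Kc: "compactin (graph_topology G) K"
    unfolding K_def
    by (rule image_compactin[OF _ continuous_map_edge_pt[OF G e]])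
      (use abI in \<open>simp add: compactin_subtopology\<close>)
  have Ksub: "K \<subseteq> points G"
    using compactin_subset_topspace[OF Kc] topspace_graph_topology[OF G] by simp
  \<comment> \<open>The topology has not been shown to be Hausdorff, so compactness of
    \<open>K\<close> does not yet give closedness. It is read off from the preimages on the edges:
    \<open>{a..b}\<close> on \<open>e\<close> and nothing elsewhere.\<close>
  have Kcl: "closedin (graph_topology G) K"
    unfolding closedin_def topspace_graph_topology[OF G]
  proof
    show "openin (graph_topology G) (points G - K)"
      unfolding openin_graph_topology
    proof (intro conjI ballI)
      fix e' assume e': "e' \<in> edges G"
      have "{x \<in> interval_of G e'. edge_pt G e' x \<in> points G - K}
        = interval_of G e' - (if e' = e then {a..b} else {})"
        using edge_pt_in_points[OF e'] G e' Kiff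
        by (auto simp: fin_metric_graph_def bounded_edges_def)
      moreover have "openin (top_of_set (interval_of G e')) (interval_of G e' - {a..b})"
        unfolding Diff_eq by (intro openin_open_Int open_Compl) simp
      ultimately show "openin (top_of_set (interval_of G e')) {x \<in> interval_of G e'. edge_pt G e' x \<in> points G - K}"
        by auto
    qed auto
  qed (fact Ksub)
  have "{x \<in> points G. edge_bump e \<phi> x \<noteq> 0} \<subseteq> K"
  proof
    fix x assume x: "x \<in> {x \<in> points G. edge_bump e \<phi> x \<noteq> 0}"
    then obtain t where t: "x = Inner e t" "\<phi> t \<noteq> 0"
      by (cases x) (auto simp: edge_bump_def split: if_splits)
    then have "t \<in> {a..b}" using zero by blast
    then show "x \<in> K" unfolding K_def t(1) by (metis inner imageI)
  qed
  then have "graph_topology G closure_of {x \<in> points G. edge_bump e \<phi> x \<noteq> 0} \<subseteq> K"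
    by (rule closure_of_minimal[OF _ Kcl])
  then have "compactin (graph_topology G) (graph_topology G closure_of {x \<in> points G. edge_bump e \<phi> x \<noteq> 0})"
    by (rule closed_compactin[OF Kc _ closedin_closure_of])
  then show "edge_bump e \<phi> \<in> Cc_graph G"
    using cont out by (auto simp: Cc_graph_def)
qed

lemma gderiv_edge_bump:
  assumes G: "fin_metric_graph G" and e: "e \<in> edges G"
    and pt: "piecewise_test a b \<phi> \<psi>" and ab: "a \<le> b" "{a..b} \<subseteq> open_edge G e" and e': "e' \<in> edges G"
  shows "AE x in lebesgue_on (interval_of G e'). gderiv G (edge_bump e \<phi>) e' x = (if e' = e then \<psi> x else 0)"
proof -
  have abI: "{a..b} \<subseteq> interval_of G e" using ab(2) interval_of_facts(4)[OF G e] by blast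
  have zero: "\<And>x. x \<notin> {a..b} \<Longrightarrow> \<phi> x = 0" using pt by (auto simp: piecewise_test_def)
  note oe = on_edge_bump[OF pt ab(2)]
  show ?thesis
  proof (cases "e' = e")
    case True
    have "AE x in lebesgue_on (interval_of G e). wderiv (interval_of G e) \<phi> x = \<psi> x"
      by (rule wderiv_eq_AE[OF piecewise_test_L2(2)[OF pt ab(1) abI] piecewise_test_weak_derivative[OF pt ab(1) abI]])
        (simp_all add: interval_of_facts(2,3)[OF G e])
    then show ?thesis unfolding True by (simp add: gderiv_def oe)
  next
    case False
    \<comment> \<open>Even for the zero function the chosen representative is known to be 0 only
      almost everywhere.\<close>
    have "AE x in lebesgue_on (interval_of G e'). wderiv (interval_of G e') (\<lambda>x. 0) x = 0"
      by (rule wderiv_eq_AE[OF zero_test interval_of_facts(2,3)[OF G e']])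
    then show ?thesis using False by (simp add: gderiv_def oe)
  qed
qed

lemma gderiv_L2:
  assumes "u \<in> H1_graph G" "e \<in> edges G"
  shows "gderiv G u e \<in> L2_fun (interval_of G e)" "weak_derivative (interval_of G e) (on_edge G u e) (gderiv G u e)"
proof -
  obtain g where "g \<in> L2_fun (interval_of G e) \<and> weak_derivative (interval_of G e) (on_edge G u e) g"
    using assms by (auto simp: H1_graph_def H1_fun_def)
  then have "gderiv G u e \<in> L2_fun (interval_of G e) \<and> weak_derivative (interval_of G e) (on_edge G u e) (gderiv G u e)"
    unfolding gderiv_def wderiv_def by (rule someI[where P = "\<lambda>g. g \<in> L2_fun (interval_of G e) \<and> weak_derivative (interval_of G e) (on_edge G u e) g"])
  then show "gderiv G u e \<in> L2_fun (interval_of G e)" "weak_derivative (interval_of G e) (on_edge G u e) (gderiv G u e)"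
    by auto
qed

lemma graph_integral_single:
  assumes "finite (edges G)" "e \<in> edges G"
    "\<And>e'. e' \<in> edges G \<Longrightarrow> e' \<noteq> e \<Longrightarrow> AE x in lebesgue_on (interval_of G e'). F e' x = 0"
  shows "graph_integral G F = (LINT x|lebesgue_on (interval_of G e). F e x)"
proof -
  have "graph_integral G F = (LINT x|lebesgue_on (interval_of G e). F e x) +
      (\<Sum>e'\<in>edges G - {e}. LINT x|lebesgue_on (interval_of G e'). F e' x)"
    unfolding graph_integral_def using assms by (simp add: sum.remove)
  also have "(\<Sum>e'\<in>edges G - {e}. LINT x|lebesgue_on (interval_of G e'). F e' x) = 0"
    using assms(3) by (intro sum.neutral ballI integral_eq_zero_AE) auto
  finally show ?thesis by simp
qed

lemma integrable_mult_bounded: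
  fixes g \<psi> :: "real \<Rightarrow> real"
  assumes "integrable M g" "\<psi> \<in> borel_measurable M" "AE x in M. \<bar>\<psi> x\<bar> \<le> C"
  shows "integrable M (\<lambda>x. g x * \<psi> x)"
proof (rule Bochner_Integration.integrable_bound)
  show "integrable M (\<lambda>x. C * g x)" using assms(1) by simp
  show "AE x in M. norm (g x * \<psi> x) \<le> norm (C * g x)"
    using assms(3)
  proof eventually_elim
    case (elim x)
    then have "\<bar>\<psi> x\<bar> \<le> \<bar>C\<bar>" by linarith
    then show ?case by (simp add: abs_mult mult.commute mult_right_mono)
  qed
qed (use assms in measurable)

text \<open>The hypotheses in numerical form: one \<open>B\<close> dominates both coefficients and
  \<open>\<rho>0\<close> bounds \<open>\<rho>\<close> from below on the core. The constants below
  can then be built from \<open>p\<close>, \<open>B\<close>, \<open>\<rho>0\<close>, the edge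
  lengths and the bound on the Morse index.\<close>

locale nls_graph =
  fixes G :: "('v, 'e) metric_graph" and p B \<rho>0 :: real and W \<rho> :: "('v, 'e) gpoint \<Rightarrow> real"
  assumes fin: "fin_metric_graph G" and p: "2 < p" and B: "0 < B" and \<rho>0: "0 < \<rho>0"
    and W_meas: "e \<in> edges G \<Longrightarrow> on_edge G W e \<in> borel_measurable (lebesgue_on (interval_of G e))"
    and \<rho>_meas: "e \<in> edges G \<Longrightarrow> on_edge G \<rho> e \<in> borel_measurable (lebesgue_on (interval_of G e))"
    and W_bound: "e \<in> edges G \<Longrightarrow> AE x in lebesgue_on (interval_of G e). \<bar>on_edge G W e x\<bar> \<le> B"
    and \<rho>_bound: "e \<in> edges G \<Longrightarrow> AE x in lebesgue_on (interval_of G e). \<bar>on_edge G \<rho> e x\<bar> \<le> B"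
    and \<rho>_lower: "e \<in> bounded_edges G \<Longrightarrow> AE x in lebesgue_on (interval_of G e). \<rho>0 \<le> on_edge G \<rho> e x"
    and W_half: "e \<in> half_lines G \<Longrightarrow> AE x in lebesgue_on (interval_of G e). on_edge G W e x = 0"
    and \<rho>_half: "e \<in> half_lines G \<Longrightarrow> AE x in lebesgue_on (interval_of G e). on_edge G \<rho> e x = 0"
begin

text \<open>The equation on an edge reads \<open>u'' = source \<Lambda> u e\<close>.\<close>

definition source :: "real \<Rightarrow> (('v, 'e) gpoint \<Rightarrow> real) \<Rightarrow> 'e \<Rightarrow> real \<Rightarrow> real" where
  "source \<Lambda> u e x = (on_edge G W e x + \<Lambda>) * on_edge G u e x
     - on_edge G \<rho> e x * \<bar>on_edge G u e x\<bar> powr (p - 2) * on_edge G u e x"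

lemma on_edge_continuous:
  "u \<in> H1_graph G \<Longrightarrow> e \<in> edges G \<Longrightarrow> continuous_on (interval_of G e) (on_edge G u e)"
  using continuous_map_graph_iff[OF fin] by (auto simp: H1_graph_def)

lemma measurable_on_subinterval:
  fixes f :: "real \<Rightarrow> real"
  assumes "e \<in> edges G" "{a..b} \<subseteq> interval_of G e" "f \<in> borel_measurable (lebesgue_on (interval_of G e))"
  shows "f \<in> borel_measurable (lebesgue_on {a..b})"
  by (rule measurable_restrict_mono[OF assms(3,2)])

lemma source_measurable:
  assumes "u \<in> H1_graph G" "e \<in> edges G"
  shows "source \<Lambda> u e \<in> borel_measurable (lebesgue_on (interval_of G e))"
proof -
  note [measurable] = W_meas[OF assms(2)] \<rho>_meas[OF assms(2)]
  have [measurable]: "on_edge G u e \<in> borel_measurable (lebesgue_on (interval_of G e))"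
    using assms by (auto simp: H1_graph_def H1_fun_def L2_fun_def)
  show ?thesis unfolding source_def[abs_def] by measurable
qed

lemma source_bounded:
  assumes u: "u \<in> H1_graph G" and e: "e \<in> edges G" and ab: "{a..b} \<subseteq> interval_of G e"
  obtains M where "AE x in lebesgue_on {a..b}. \<bar>source \<Lambda> u e x\<bar> \<le> M"
proof -
  obtain U where U: "\<And>x. x \<in> {a..b} \<Longrightarrow> \<bar>on_edge G u e x\<bar> \<le> U"
    using continuous_bounded_on_interval[OF continuous_on_subset[OF on_edge_continuous[OF u e] ab]] by blast
  have sub: "AE x in lebesgue_on {a..b}. P x" if "AE x in lebesgue_on (interval_of G e). P x" for P
    by (rule AE_lebesgue_on_mono[OF that ab]) (auto simp: interval_of_facts(2)[OF fin e])
  have "AE x in lebesgue_on {a..b}. x \<in> {a..b}" by (simp add: AE_lebesgue_on_iff)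
  then have "AE x in lebesgue_on {a..b}. \<bar>source \<Lambda> u e x\<bar> \<le> (B + \<bar>\<Lambda>\<bar>) * U + B * U powr (p - 2) * U"
    using sub[OF W_bound[OF e]] sub[OF \<rho>_bound[OF e]]
  proof eventually_elim
    case (elim x)
    have u: "\<bar>on_edge G u e x\<bar> \<le> U" "0 \<le> U" using U[OF elim(1)] by linarith+
    have "\<bar>(on_edge G W e x + \<Lambda>) * on_edge G u e x\<bar> \<le> (B + \<bar>\<Lambda>\<bar>) * U"
      unfolding abs_mult by (intro mult_mono u) (use elim B in auto)
    moreover have "\<bar>on_edge G \<rho> e x * \<bar>on_edge G u e x\<bar> powr (p - 2) * on_edge G u e x\<bar> \<le> B * U powr (p - 2) * U"
      unfolding abs_mult using elim B u p by (intro mult_mono) (auto intro!: powr_mono2)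
    ultimately show ?case unfolding source_def by linarith
  qed
  then show ?thesis using that by blast
qed

lemma source_integrable:
  assumes u: "u \<in> H1_graph G" and e: "e \<in> edges G" and ab: "{a..b} \<subseteq> interval_of G e"
  shows "integrable (lebesgue_on {a..b}) (source \<Lambda> u e)"
  using integrable_lebesgue_on_bounded[OF measurable_on_subinterval[OF e ab source_measurable[OF u e]]]
    source_bounded[OF u e ab] by metis

text \<open>The graph equation is tested with the extension of \<open>\<phi>\<close> by zero, which
  reduces it to a single edge. Because the support stays inside the open edge, no vertex
  contributes.\<close>

lemma weak_equation:
  assumes u: "solves G p W \<rho> \<Lambda> u" and e: "e \<in> edges G"
    and pt: "piecewise_test a b \<phi> \<psi>" and ab: "a \<le> b" "{a..b} \<subseteq> open_edge G e"
  shows "(LINT x|lebesgue_on {a..b}. gderiv G u e x * \<psi> x) = - (LINT x|lebesgue_on {a..b}. source \<Lambda> u e x * \<phi> x)"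
    and "integrable (lebesgue_on {a..b}) (\<lambda>x. gderiv G u e x * \<psi> x)"
    and "integrable (lebesgue_on {a..b}) (\<lambda>x. source \<Lambda> u e x * \<phi> x)"
proof -
  let ?I = "interval_of G e"
  have abI: "{a..b} \<subseteq> ?I" using ab(2) interval_of_facts(4)[OF fin e] by blast
  have uH: "u \<in> H1_graph G" using u by (simp add: solves_def)
  have zero: "\<And>x. x \<notin> {a..b} \<Longrightarrow> \<phi> x = 0" "\<And>x. x \<notin> {a..b} \<Longrightarrow> \<psi> x = 0"
    using pt by (auto simp: piecewise_test_def)
  note oe = on_edge_bump[OF pt ab(2)]
  note gd = gderiv_edge_bump[OF fin e pt ab]
  note bump = edge_bump_in_spaces[OF fin e pt ab]
  note [measurable] = W_meas[OF e] \<rho>_meas[OF e] piecewise_test_measurable[OF pt]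
  have [measurable]: "on_edge G u e \<in> borel_measurable (lebesgue_on ?I)"
    using uH e by (auto simp: H1_graph_def H1_fun_def L2_fun_def)
  have [measurable]: "gderiv G u e \<in> borel_measurable (lebesgue_on ?I)"
    "gderiv G (edge_bump e \<phi>) e \<in> borel_measurable (lebesgue_on ?I)"
    using gderiv_L2[OF uH e] gderiv_L2[OF bump(1) e] by (auto simp: L2_fun_def)
  have eq: "graph_integral G (\<lambda>e' x. gderiv G u e' x * gderiv G (edge_bump e \<phi>) e' x
            + (on_edge G W e' x + \<Lambda>) * on_edge G u e' x * on_edge G (edge_bump e \<phi>) e' x)
        = graph_integral G (\<lambda>e' x. on_edge G \<rho> e' x * \<bar>on_edge G u e' x\<bar> powr (p - 2)
            * on_edge G u e' x * on_edge G (edge_bump e \<phi>) e' x)"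
    using u bump by (auto simp: solves_def)
  have finE: "finite (edges G)" using fin by (simp add: fin_metric_graph_def)
  have "(LINT x|lebesgue_on ?I. gderiv G u e x * gderiv G (edge_bump e \<phi>) e x
      + (on_edge G W e x + \<Lambda>) * on_edge G u e x * on_edge G (edge_bump e \<phi>) e x)
    = (LINT x|lebesgue_on ?I. on_edge G \<rho> e x * \<bar>on_edge G u e x\<bar> powr (p - 2) * on_edge G u e x * on_edge G (edge_bump e \<phi>) e x)"
  proof -
    have "graph_integral G (\<lambda>e' x. gderiv G u e' x * gderiv G (edge_bump e \<phi>) e' x
        + (on_edge G W e' x + \<Lambda>) * on_edge G u e' x * on_edge G (edge_bump e \<phi>) e' x)
      = (LINT x|lebesgue_on ?I. gderiv G u e x * gderiv G (edge_bump e \<phi>) e x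
        + (on_edge G W e x + \<Lambda>) * on_edge G u e x * on_edge G (edge_bump e \<phi>) e x)"
    proof (rule graph_integral_single[OF finE e])
      fix e' assume "e' \<in> edges G" "e' \<noteq> e"
      with gd[of e'] show "AE x in lebesgue_on (interval_of G e'). gderiv G u e' x * gderiv G (edge_bump e \<phi>) e' x
          + (on_edge G W e' x + \<Lambda>) * on_edge G u e' x * on_edge G (edge_bump e \<phi>) e' x = 0"
        by (auto simp: oe)
    qed
    moreover have "graph_integral G (\<lambda>e' x. on_edge G \<rho> e' x * \<bar>on_edge G u e' x\<bar> powr (p - 2)
        * on_edge G u e' x * on_edge G (edge_bump e \<phi>) e' x)
      = (LINT x|lebesgue_on ?I. on_edge G \<rho> e x * \<bar>on_edge G u e x\<bar> powr (p - 2) * on_edge G u e x * on_edge G (edge_bump e \<phi>) e x)"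
      by (rule graph_integral_single[OF finE e]) (auto simp: oe)
    ultimately show ?thesis using eq by simp
  qed
  also have "(LINT x|lebesgue_on ?I. gderiv G u e x * gderiv G (edge_bump e \<phi>) e x
      + (on_edge G W e x + \<Lambda>) * on_edge G u e x * on_edge G (edge_bump e \<phi>) e x)
    = (LINT x|lebesgue_on ?I. gderiv G u e x * \<psi> x + (on_edge G W e x + \<Lambda>) * on_edge G u e x * \<phi> x)"
  proof (rule integral_cong_AE)
    show "AE x in lebesgue_on ?I. gderiv G u e x * gderiv G (edge_bump e \<phi>) e x
      + (on_edge G W e x + \<Lambda>) * on_edge G u e x * on_edge G (edge_bump e \<phi>) e x
      = gderiv G u e x * \<psi> x + (on_edge G W e x + \<Lambda>) * on_edge G u e x * \<phi> x"
      using gd[OF e] by eventually_elim (simp add: oe)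
  qed (simp_all add: oe)
  also have "\<dots> = (LINT x|lebesgue_on {a..b}. gderiv G u e x * \<psi> x + (on_edge G W e x + \<Lambda>) * on_edge G u e x * \<phi> x)"
    by (rule integral_lebesgue_on_support[OF abI interval_of_facts(2)[OF fin e]]) (simp add: zero)
  also have "(LINT x|lebesgue_on ?I. on_edge G \<rho> e x * \<bar>on_edge G u e x\<bar> powr (p - 2) * on_edge G u e x * on_edge G (edge_bump e \<phi>) e x)
    = (LINT x|lebesgue_on {a..b}. on_edge G \<rho> e x * \<bar>on_edge G u e x\<bar> powr (p - 2) * on_edge G u e x * \<phi> x)"
    unfolding oe by (subst integral_lebesgue_on_support(1)[OF abI interval_of_facts(2)[OF fin e]]) (simp_all add: zero)
  finally have eq2: "(LINT x|lebesgue_on {a..b}. gderiv G u e x * \<psi> x + (on_edge G W e x + \<Lambda>) * on_edge G u e x * \<phi> x)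
    = (LINT x|lebesgue_on {a..b}. on_edge G \<rho> e x * \<bar>on_edge G u e x\<bar> powr (p - 2) * on_edge G u e x * \<phi> x)" .
  obtain M where M: "\<And>x. \<bar>\<psi> x\<bar> \<le> M" using pt unfolding piecewise_test_def bounded_iff by auto
  show i1: "integrable (lebesgue_on {a..b}) (\<lambda>x. gderiv G u e x * \<psi> x)"
    using L2_integrable_on[OF gderiv_L2(1)[OF uH e] abI interval_of_facts(2)[OF fin e]] M
    by (intro integrable_mult_bounded[where C = M] piecewise_test_measurable[OF pt]) auto
  have sm: "source \<Lambda> u e \<in> borel_measurable (lebesgue_on {a..b})"
    by (rule measurable_on_subinterval[OF e abI source_measurable[OF uH e]])
  show i2: "integrable (lebesgue_on {a..b}) (\<lambda>x. source \<Lambda> u e x * \<phi> x)"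
    using piecewise_test_integrable(2)[OF pt sm] source_bounded[OF uH e abI] by metis
  obtain U where U: "\<And>x. x \<in> {a..b} \<Longrightarrow> \<bar>on_edge G u e x\<bar> \<le> U"
    using continuous_bounded_on_interval[OF continuous_on_subset[OF on_edge_continuous[OF uH e] abI]] by blast
  have "AE x in lebesgue_on {a..b}. x \<in> {a..b}" by (simp add: AE_lebesgue_on_iff)
  moreover have "AE x in lebesgue_on {a..b}. \<bar>on_edge G W e x\<bar> \<le> B"
    by (rule AE_lebesgue_on_mono[OF W_bound[OF e] abI]) (auto simp: interval_of_facts(2)[OF fin e])
  ultimately have "AE x in lebesgue_on {a..b}. \<bar>(on_edge G W e x + \<Lambda>) * on_edge G u e x\<bar> \<le> (B + \<bar>\<Lambda>\<bar>) * U"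
  proof eventually_elim
    case (elim x)
    show ?case unfolding abs_mult by (intro mult_mono U elim(1)) (use elim B in auto)
  qed
  then have i3: "integrable (lebesgue_on {a..b}) (\<lambda>x. (on_edge G W e x + \<Lambda>) * on_edge G u e x * \<phi> x)"
    by (intro piecewise_test_integrable(2)[OF pt] measurable_on_subinterval[OF e abI]) measurable
  have "(\<lambda>x. on_edge G \<rho> e x * \<bar>on_edge G u e x\<bar> powr (p - 2) * on_edge G u e x * \<phi> x)
    = (\<lambda>x. (on_edge G W e x + \<Lambda>) * on_edge G u e x * \<phi> x - source \<Lambda> u e x * \<phi> x)"
    by (auto simp: source_def algebra_simps)
  then show "(LINT x|lebesgue_on {a..b}. gderiv G u e x * \<psi> x) = - (LINT x|lebesgue_on {a..b}. source \<Lambda> u e x * \<phi> x)"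
    using eq2 by (simp add: Bochner_Integration.integral_add[OF i1 i3] Bochner_Integration.integral_diff[OF i3 i2])
qed

end

section \<open>Regularity of solutions\<close>

lemma abs_integral_le:
  fixes f :: "real \<Rightarrow> real"
  assumes "integrable (lebesgue_on {x..y}) f" "AE t in lebesgue_on {x..y}. \<bar>f t\<bar> \<le> K" "x \<le> y"
  shows "\<bar>integral {x..y} f\<bar> \<le> K * (y - x)"
proof -
  have "\<bar>LINT t|lebesgue_on {x..y}. f t\<bar> \<le> (LINT t|lebesgue_on {x..y}. \<bar>f t\<bar>)"
    by (rule integral_abs_bound)
  also have "\<dots> \<le> (LINT t|lebesgue_on {x..y}. K)"
    using assms by (intro integral_mono_AE) auto
  also have "\<dots> = K * (y - x)"
    using assms(3) by (simp add: measure_restrict_space)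
  finally show ?thesis using assms(1) by (simp add: lebesgue_integral_eq_integral)
qed

text \<open>With \<open>b = c\<close> this is a hat, used for second differences and for the
  half-lines; with \<open>b < c\<close> it is the cutoff that equals 1 on a whole cell.\<close>

definition trapezoid :: "real \<Rightarrow> real \<Rightarrow> real \<Rightarrow> real \<Rightarrow> real \<Rightarrow> real" where
  "trapezoid a b c d t = max 0 (min 1 (min ((t - a) / (b - a)) ((d - t) / (d - c))))"

definition trapezoid_deriv :: "real \<Rightarrow> real \<Rightarrow> real \<Rightarrow> real \<Rightarrow> real \<Rightarrow> real" where
  "trapezoid_deriv a b c d t = (if t \<in> {a<..<b} then 1 / (b - a) else if t \<in> {c<..<d} then - 1 / (d - c) else 0)"

lemma trapezoid_values:
  assumes "a < b" "b \<le> c" "c < d"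
  shows "t \<le> a \<Longrightarrow> trapezoid a b c d t = 0" "d \<le> t \<Longrightarrow> trapezoid a b c d t = 0"
    "t \<in> {a..b} \<Longrightarrow> trapezoid a b c d t = (t - a) / (b - a)" "t \<in> {b..c} \<Longrightarrow> trapezoid a b c d t = 1"
    "t \<in> {c..d} \<Longrightarrow> trapezoid a b c d t = (d - t) / (d - c)"
    "0 \<le> trapezoid a b c d t" "trapezoid a b c d t \<le> 1"
proof -
  show "0 \<le> trapezoid a b c d t" "trapezoid a b c d t \<le> 1" by (auto simp: trapezoid_def)
  show "trapezoid a b c d t = 0" if "t \<le> a"
  proof -
    have "(t - a) / (b - a) \<le> 0" using that assms by (simp add: divide_nonpos_pos)
    then show ?thesis by (auto simp: trapezoid_def)
  qed
  show "trapezoid a b c d t = 0" if "d \<le> t"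
  proof -
    have "(d - t) / (d - c) \<le> 0" using that assms by (simp add: divide_nonpos_pos)
    then show ?thesis by (auto simp: trapezoid_def)
  qed
  show "trapezoid a b c d t = (t - a) / (b - a)" if "t \<in> {a..b}"
  proof -
    have "0 \<le> (t - a) / (b - a)" "(t - a) / (b - a) \<le> 1" "1 \<le> (d - t) / (d - c)"
      using that assms by (auto simp: field_simps)
    then show ?thesis by (auto simp: trapezoid_def)
  qed
  show "trapezoid a b c d t = 1" if "t \<in> {b..c}"
  proof -
    have "1 \<le> (t - a) / (b - a)" "1 \<le> (d - t) / (d - c)"
      using that assms by (auto simp: field_simps)
    then show ?thesis by (auto simp: trapezoid_def)
  qed
  show "trapezoid a b c d t = (d - t) / (d - c)" if "t \<in> {c..d}"
  proof -
    have "1 \<le> (t - a) / (b - a)" "0 \<le> (d - t) / (d - c)" "(d - t) / (d - c) \<le> 1"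
      using that assms by (auto simp: field_simps)
    then show ?thesis by (auto simp: trapezoid_def)
  qed
qed

lemma piecewise_test_trapezoid:
  assumes abcd: "a < b" "b \<le> c" "c < d"
  shows "piecewise_test a d (trapezoid a b c d) (trapezoid_deriv a b c d)"
  unfolding piecewise_test_def
proof (intro conjI)
  show "continuous_on UNIV (trapezoid a b c d)"
    unfolding trapezoid_def[abs_def] using assms by (intro continuous_intros) auto
  show "trapezoid_deriv a b c d \<in> borel_measurable borel"
    unfolding trapezoid_deriv_def[abs_def] by measurable
  have "norm (trapezoid_deriv a b c d t) \<le> 1 / (b - a) + 1 / (d - c)" for t
    using assms by (auto simp: trapezoid_deriv_def)
  then show "bounded (range (trapezoid_deriv a b c d))" unfolding bounded_iff by blast
  show "\<forall>x. x \<notin> {a..d} \<longrightarrow> trapezoid a b c d x = 0 \<and> trapezoid_deriv a b c d x = 0"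
    using assms trapezoid_values(1,2)[OF abcd] by (auto simp: trapezoid_deriv_def)
  have "(trapezoid a b c d has_real_derivative trapezoid_deriv a b c d t) (at t)" if t: "t \<notin> {a, b, c, d}" for t
  proof -
    have *: "(trapezoid a b c d has_real_derivative D) (at t)"
      if "open U" "t \<in> U" "\<And>s. s \<in> U \<Longrightarrow> trapezoid a b c d s = f s" "(f has_real_derivative D) (at t)" for U f D
      using has_field_derivative_transform_within_open[OF that(4,1,2)] that(3) by simp
    have "t < a \<or> t \<in> {a<..<b} \<or> t \<in> {b<..<c} \<or> t \<in> {c<..<d} \<or> d < t" using t by auto
    then consider "t < a" | "t \<in> {a<..<b}" | "t \<in> {b<..<c}" | "t \<in> {c<..<d}" | "d < t" by blast
    then show ?thesis
    proof cases
      case 1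
      then show ?thesis using assms trapezoid_values(1)[OF abcd]
        by (intro *[of "{..<a}" "\<lambda>s. 0"]) (auto simp: trapezoid_deriv_def)
    next
      case 2
      have "((\<lambda>s. (s - a) / (b - a)) has_real_derivative 1 / (b - a)) (at t)"
        using assms by (auto intro!: derivative_eq_intros)
      then show ?thesis using 2 assms trapezoid_values(3)[OF abcd]
        by (intro *[of "{a<..<b}" "\<lambda>s. (s - a) / (b - a)"]) (auto simp: trapezoid_deriv_def)
    next
      case 3
      then show ?thesis using assms trapezoid_values(4)[OF abcd]
        by (intro *[of "{b<..<c}" "\<lambda>s. 1"]) (auto simp: trapezoid_deriv_def)
    next
      case 4
      have "((\<lambda>s. d - s) has_real_derivative - 1) (at t)"
        by (auto intro!: derivative_eq_intros)
      from DERIV_cdivide[OF this, of "d - c"]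
      have "((\<lambda>s. (d - s) / (d - c)) has_real_derivative - 1 / (d - c)) (at t)" .
      then show ?thesis using 4 assms trapezoid_values(5)[OF abcd]
        by (intro *[of "{c<..<d}" "\<lambda>s. (d - s) / (d - c)"]) (auto simp: trapezoid_deriv_def)
    next
      case 5
      then show ?thesis using assms trapezoid_values(2)[OF abcd]
        by (intro *[of "{d<..}" "\<lambda>s. 0"]) (auto simp: trapezoid_deriv_def)
    qed
  qed
  then show "\<exists>S. finite S \<and> (\<forall>x. x \<notin> S \<longrightarrow> (trapezoid a b c d has_real_derivative trapezoid_deriv a b c d x) (at x))"
    by (intro exI[of _ "{a, b, c, d}"]) auto
qed

section \<open>Test functions obtained from a solution by cutting off\<close>

lemma borel_measurable_extend_zero:
  fixes w :: "real \<Rightarrow> real"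
  assumes "continuous_on {a..b} w"
  shows "(\<lambda>x. if x \<in> {a..b} then w x else 0) \<in> borel_measurable borel"
proof -
  have "(\<lambda>x. if x \<in> {a..b} then w x else 0) = (\<lambda>x. indicator {a..b} x *\<^sub>R w x)"
    by (auto simp: indicator_def)
  then show ?thesis using borel_measurable_continuous_on_indicator[OF _ assms] by simp
qed

lemma bounded_extend_zero:
  fixes w :: "real \<Rightarrow> real"
  assumes "continuous_on {a..b} w"
  obtains M where "\<And>x. \<bar>if x \<in> {a..b} then w x else 0\<bar> \<le> M"
proof -
  obtain M where "\<And>x. x \<in> {a..b} \<Longrightarrow> \<bar>w x\<bar> \<le> M"
    using continuous_bounded_on_interval[OF assms] by blast
  then have "\<bar>if x \<in> {a..b} then w x else 0\<bar> \<le> max 0 M" for x by fastforce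
  then show ?thesis using that by blast
qed

text \<open>\<open>f\<close> is controlled only on \<open>{a..b}\<close>, and outside the product
  vanishes with \<open>\<eta>\<close>. Differentiability of \<open>f\<close> at the two ends is
  two-sided, which gives continuity of the product across them.\<close>

lemma piecewise_test_mult:
  assumes pt: "piecewise_test a b \<eta> \<eta>'"
    and f: "\<And>x. x \<in> {a..b} \<Longrightarrow> (f has_real_derivative w x) (at x)" and w: "continuous_on {a..b} w"
  shows "piecewise_test a b (\<lambda>x. f x * \<eta> x) (\<lambda>x. if x \<in> {a..b} then w x * \<eta> x + f x * \<eta>' x else 0)"
  unfolding piecewise_test_def
proof (intro conjI)
  have zero: "\<eta> x = 0" "\<eta>' x = 0" if "x \<notin> {a..b}" for x using pt that by (auto simp: piecewise_test_def)
  have near: "((\<lambda>x. f x * \<eta> x) has_real_derivative 0) (at x)" if x: "x \<notin> {a..b}" for x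
    by (rule has_field_derivative_transform_within_open[of "\<lambda>x. 0" _ _ "- {a..b}"]) (use x zero in auto)
  have fc: "continuous_on {a..b} f"
    using f by (meson DERIV_isCont continuous_at_imp_continuous_on)
  have ec: "continuous_on UNIV \<eta>" using pt by (simp add: piecewise_test_def)
  show "continuous_on UNIV (\<lambda>x. f x * \<eta> x)"
  proof (intro continuous_at_imp_continuous_on ballI)
    fix x :: real
    show "isCont (\<lambda>x. f x * \<eta> x) x"
    proof (cases "x \<in> {a..b}")
      case True
      then show ?thesis using DERIV_isCont[OF f] ec by (auto simp: continuous_on_eq_continuous_at)
    next
      case False
      then show ?thesis using DERIV_isCont[OF near] by blast
    qed
  qed
  note fe = borel_measurable_extend_zero[OF fc] borel_measurable_extend_zero[OF w]
  obtain F where F: "\<And>x. \<bar>if x \<in> {a..b} then f x else 0\<bar> \<le> F" using bounded_extend_zero[OF fc] by blast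
  obtain E where E: "\<And>x. \<bar>if x \<in> {a..b} then \<eta> x else 0\<bar> \<le> E"
    using bounded_extend_zero[OF continuous_on_subset[OF ec subset_UNIV]] by blast
  obtain V where V: "\<And>x. \<bar>if x \<in> {a..b} then w x else 0\<bar> \<le> V" using bounded_extend_zero[OF w] by blast
  obtain M where M: "\<And>x. \<bar>\<eta>' x\<bar> \<le> M" using pt unfolding piecewise_test_def bounded_iff by auto
  have em: "\<eta> \<in> borel_measurable borel" "\<eta>' \<in> borel_measurable borel"
    using pt ec by (auto simp: piecewise_test_def intro: borel_measurable_continuous_onI)
  have eq: "(\<lambda>x. if x \<in> {a..b} then w x * \<eta> x + f x * \<eta>' x else 0) =
    (\<lambda>x. (if x \<in> {a..b} then w x else 0) * \<eta> x + (if x \<in> {a..b} then f x else 0) * \<eta>' x)"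
    by auto
  show "(\<lambda>x. if x \<in> {a..b} then w x * \<eta> x + f x * \<eta>' x else 0) \<in> borel_measurable borel"
    unfolding eq by (intro borel_measurable_add borel_measurable_times fe em)
  have "norm (if x \<in> {a..b} then w x * \<eta> x + f x * \<eta>' x else 0) \<le> V * E + F * M" for x
  proof (cases "x \<in> {a..b}")
    case True
    have "\<bar>w x * \<eta> x\<bar> \<le> V * E" "\<bar>f x * \<eta>' x\<bar> \<le> F * M"
      unfolding abs_mult using V[of x] E[of x] F[of x] M[of x] True by (auto intro!: mult_mono)
    then show ?thesis using True by simp
  next
    case False
    have "0 \<le> V" "0 \<le> E" "0 \<le> F" "0 \<le> M"
      using V[of x] E[of x] F[of x] M[of x] by linarith+
    then show ?thesis using False by auto
  qed
  then show "bounded (range (\<lambda>x. if x \<in> {a..b} then w x * \<eta> x + f x * \<eta>' x else 0))"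
    unfolding bounded_iff by blast
  show "\<forall>x. x \<notin> {a..b} \<longrightarrow> f x * \<eta> x = 0 \<and> (if x \<in> {a..b} then w x * \<eta> x + f x * \<eta>' x else 0) = 0"
    using zero by simp
  obtain S where S: "finite S" "\<And>x. x \<notin> S \<Longrightarrow> (\<eta> has_real_derivative \<eta>' x) (at x)"
    using pt unfolding piecewise_test_def by blast
  have "((\<lambda>x. f x * \<eta> x) has_real_derivative (if x \<in> {a..b} then w x * \<eta> x + f x * \<eta>' x else 0)) (at x)"
    if "x \<notin> S" for x
  proof (cases "x \<in> {a..b}")
    case True
    then show ?thesis using DERIV_mult[OF f[OF True] S(2)[OF that]] by (simp add: mult.commute)
  next
    case False
    show ?thesis by (subst if_not_P[OF False]) (rule near[OF False])
  qed
  then show "\<exists>S. finite S \<and> (\<forall>x. x \<notin> S \<longrightarrow> ((\<lambda>x. f x * \<eta> x) has_real_derivative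
      (if x \<in> {a..b} then w x * \<eta> x + f x * \<eta>' x else 0)) (at x))"
    using S(1) by blast
qed

lemma piecewise_test_nodal:
  assumes ab: "a < b" and f: "\<And>x. x \<in> {a..b} \<Longrightarrow> (f has_real_derivative w x) (at x)" and w: "continuous_on {a..b} w"
    and z: "f a = 0" "f b = 0"
  shows "piecewise_test a b (\<lambda>x. if x \<in> {a..b} then f x else 0) (\<lambda>x. if x \<in> {a..b} then w x else 0)"
  unfolding piecewise_test_def
proof (intro conjI)
  have fc: "continuous_on {a..b} f"
    using f by (meson DERIV_isCont continuous_at_imp_continuous_on)
  have "continuous_on ({a..b} \<union> ({..a} \<union> {b..})) (\<lambda>x. if x \<in> {a..b} then f x else 0)"
    using fc z ab by (intro continuous_on_If) auto
  moreover have "{a..b} \<union> ({..a} \<union> {b..}) = UNIV" by auto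
  ultimately show "continuous_on UNIV (\<lambda>x. if x \<in> {a..b} then f x else 0)" by simp
  show "(\<lambda>x. if x \<in> {a..b} then w x else 0) \<in> borel_measurable borel"
    by (rule borel_measurable_extend_zero[OF w])
  obtain V where V: "\<And>x. \<bar>if x \<in> {a..b} then w x else 0\<bar> \<le> V" using bounded_extend_zero[OF w] by blast
  then show "bounded (range (\<lambda>x. if x \<in> {a..b} then w x else 0))"
    unfolding bounded_iff by (intro exI[of _ V] ballI) (elim imageE, simp only: real_norm_def V)
  have "((\<lambda>x. if x \<in> {a..b} then f x else 0) has_real_derivative (if x \<in> {a..b} then w x else 0)) (at x)"
    if x: "x \<notin> {a, b}" for x
  proof (cases "x \<in> {a..b}")
    case True
    then show ?thesis
      using has_field_derivative_transform_within_open[OF f[OF True], of "{a<..<b}" "\<lambda>x. if x \<in> {a..b} then f x else 0"] x by auto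
  next
    case False
    have "((\<lambda>x. if x \<in> {a..b} then f x else 0) has_real_derivative 0) (at x)"
      by (rule has_field_derivative_transform_within_open[of "\<lambda>x. 0" _ _ "- {a..b}"]) (use False in auto)
    then show ?thesis by (subst if_not_P[OF False])
  qed
  then show "\<exists>S. finite S \<and> (\<forall>x. x \<notin> S \<longrightarrow> ((\<lambda>x. if x \<in> {a..b} then f x else 0) has_real_derivative
      (if x \<in> {a..b} then w x else 0)) (at x))"
    by (intro exI[of _ "{a, b}"]) auto
qed auto

text \<open>The second antiderivative of \<open>F\<close> is written as \<open>t \<integral>F - \<integral>s F(s)\<close>, which makes its
  second differences computable without Fubini's theorem.\<close>

lemma second_antiderivative:
  fixes F :: "real \<Rightarrow> real"
  assumes F: "integrable (lebesgue_on {\<alpha>..\<beta>}) F" "AE t in lebesgue_on {\<alpha>..\<beta>}. \<bar>F t\<bar> \<le> M" and x: "x \<in> {\<alpha>..\<beta>}"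
  shows "((\<lambda>t. t * integral {\<alpha>..t} F - integral {\<alpha>..t} (\<lambda>s. s * F s)) has_real_derivative integral {\<alpha>..x} F)
    (at x within {\<alpha>..\<beta>})"
proof -
  define G0 where "G0 t = integral {\<alpha>..t} F" for t
  define G1 where "G1 t = integral {\<alpha>..t} (\<lambda>s. s * F s)" for t
  have iF: "integrable (lebesgue_on {a..b}) (\<lambda>s. F s * (c - s))" if "\<alpha> \<le> a" "b \<le> \<beta>" for a b c
  proof -
    have i: "integrable (lebesgue_on {a..b}) F"
      by (rule integrable_lebesgue_on_subset[OF F(1)]) (use that in auto)
    have "continuous_on {a..b} (\<lambda>s. c - s)" by (intro continuous_intros)
    from continuous_on_measurable_bounded(2)[OF this]
    obtain K where "AE s in lebesgue_on {a..b}. \<bar>c - s\<bar> \<le> K" by blast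
    with i show ?thesis by (intro integrable_mult_bounded) (auto intro!: borel_measurable_lebesgue_on)
  qed
  have Fi: "F integrable_on {\<alpha>..\<beta>}" "(\<lambda>s. s * F s) integrable_on {\<alpha>..\<beta>}"
    using integrable_on_lebesgue_on[OF F(1)] integrable_neg[OF integrable_on_lebesgue_on[OF iF[of \<alpha> \<beta> 0]]]
    by (simp_all add: mult.commute)
  have bound: "\<bar>integral {a..b} (\<lambda>s. F s * (c - s))\<bar> \<le> M * (b - a) * (b - a)"
    if ab: "\<alpha> \<le> a" "a \<le> b" "b \<le> \<beta>" "c \<in> {a..b}" for a b c
  proof (rule abs_integral_le)
    have "AE t in lebesgue_on {a..b}. \<bar>F t\<bar> \<le> M"
      by (rule AE_lebesgue_on_mono[OF F(2)]) (use ab in auto)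
    moreover have "AE t in lebesgue_on {a..b}. t \<in> {a..b}" by (simp add: AE_lebesgue_on_iff)
    ultimately show "AE t in lebesgue_on {a..b}. \<bar>F t * (c - t)\<bar> \<le> M * (b - a)"
    proof eventually_elim
      case (elim t)
      show ?case unfolding abs_mult by (intro mult_mono) (use elim ab in auto)
    qed
  qed (use ab iF in auto)
  \<comment> \<open>The left side is the integral of \<open>F s * (y - s)\<close> from
    \<open>x\<close> to \<open>y\<close>, which is quadratically small. This yields
    differentiability although \<open>F\<close> is merely bounded.\<close>
  have key: "\<bar>y * G0 y - G1 y - (x * G0 x - G1 x) - (y - x) * G0 x\<bar> \<le> M * (y - x)\<^sup>2"
    if y: "y \<in> {\<alpha>..\<beta>}" for y
  proof -
    have sub: "F integrable_on {a..b}" "(\<lambda>s. s * F s) integrable_on {a..b}" if "\<alpha> \<le> a" "b \<le> \<beta>" for a b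
      using that integrable_on_subinterval[OF Fi(1)] integrable_on_subinterval[OF Fi(2)] by auto
    have G: "G0 b - G0 a = integral {a..b} F" "G1 b - G1 a = integral {a..b} (\<lambda>s. s * F s)"
      if "\<alpha> \<le> a" "a \<le> b" "b \<le> \<beta>" for a b
      using Henstock_Kurzweil_Integration.integral_combine[OF that(1,2) sub(1)[OF order_refl that(3)]]
        Henstock_Kurzweil_Integration.integral_combine[OF that(1,2) sub(2)[OF order_refl that(3)]]
      by (simp_all add: G0_def G1_def)
    have lin: "integral {a..b} (\<lambda>s. F s * (c - s)) = c * integral {a..b} F - integral {a..b} (\<lambda>s. s * F s)"
      if "\<alpha> \<le> a" "b \<le> \<beta>" for a b c
    proof -
      have "(\<lambda>s. F s * (c - s)) = (\<lambda>s. c * F s - s * F s)" by (auto simp: algebra_simps)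
      then show ?thesis
        using Henstock_Kurzweil_Integration.integral_diff[OF integrable_on_cmult_left[OF sub(1)[OF that], of c] sub(2)[OF that]]
        by simp
    qed
    show ?thesis
    proof (cases "x \<le> y")
      case True
      have "y * G0 y - G1 y - (x * G0 x - G1 x) - (y - x) * G0 x = y * (G0 y - G0 x) - (G1 y - G1 x)"
        by (simp add: algebra_simps)
      also have "\<dots> = integral {x..y} (\<lambda>s. F s * (y - s))" using True x y by (simp add: G lin)
      finally show ?thesis using bound[of x y y] True x y by (simp add: power2_eq_square mult.assoc)
    next
      case False
      have "y * G0 y - G1 y - (x * G0 x - G1 x) - (y - x) * G0 x = - (y * (G0 x - G0 y) - (G1 x - G1 y))"
        by (simp add: algebra_simps)
      also have "\<dots> = - integral {y..x} (\<lambda>s. F s * (y - s))" using False x y by (simp add: G lin)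
      finally show ?thesis using bound[of y x y] False x y
        by (simp add: power2_eq_square mult.assoc) (simp add: algebra_simps)
    qed
  qed
  have "((\<lambda>y. (y * G0 y - G1 y - (x * G0 x - G1 x)) / (y - x) - G0 x) \<longlongrightarrow> 0) (at x within {\<alpha>..\<beta>})"
  proof (rule Lim_null_comparison)
    show "\<forall>\<^sub>F y in at x within {\<alpha>..\<beta>}. norm ((y * G0 y - G1 y - (x * G0 x - G1 x)) / (y - x) - G0 x) \<le> M * \<bar>y - x\<bar>"
      unfolding eventually_at_filter
    proof (rule always_eventually, intro allI impI)
      fix y assume y: "y \<noteq> x" "y \<in> {\<alpha>..\<beta>}"
      have "norm ((y * G0 y - G1 y - (x * G0 x - G1 x)) / (y - x) - G0 x)
        = \<bar>y * G0 y - G1 y - (x * G0 x - G1 x) - (y - x) * G0 x\<bar> / \<bar>y - x\<bar>"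
      proof -
        have "(y * G0 y - G1 y - (x * G0 x - G1 x)) / (y - x) - G0 x
          = (y * G0 y - G1 y - (x * G0 x - G1 x) - (y - x) * G0 x) / (y - x)"
          using y by (simp add: diff_divide_distrib[of _ "(y - x) * G0 x"])
        then show ?thesis by (simp add: abs_divide)
      qed
      also have "\<dots> \<le> M * (y - x)\<^sup>2 / \<bar>y - x\<bar>"
        by (intro divide_right_mono key y) auto
      also have "\<dots> = M * \<bar>y - x\<bar>" using y by (simp add: field_simps power2_eq_square abs_mult_self_eq)
      finally show "norm ((y * G0 y - G1 y - (x * G0 x - G1 x)) / (y - x) - G0 x) \<le> M * \<bar>y - x\<bar>" .
    qed
    have "((\<lambda>y. M * \<bar>y - x\<bar>) \<longlongrightarrow> M * \<bar>x - x\<bar>) (at x within {\<alpha>..\<beta>})" by (intro tendsto_intros)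
    then show "((\<lambda>y. M * \<bar>y - x\<bar>) \<longlongrightarrow> 0) (at x within {\<alpha>..\<beta>})" by simp
  qed
  then have "((\<lambda>y. (y * G0 y - G1 y - (x * G0 x - G1 x)) / (y - x)) \<longlongrightarrow> G0 x) (at x within {\<alpha>..\<beta>})"
    by (simp add: LIM_zero_iff)
  then show ?thesis unfolding has_field_derivative_iff G0_def G1_def by simp
qed

section \<open>Classical derivatives of solutions on open edges\<close>

context nls_graph
begin

abbreviation dedge :: "(('v, 'e) gpoint \<Rightarrow> real) \<Rightarrow> 'e \<Rightarrow> real \<Rightarrow> real" where
  "dedge u e \<equiv> deriv (on_edge G u e)"

lemma gderiv_integral:
  assumes u: "u \<in> H1_graph G" and e: "e \<in> edges G" and xy: "x < y" "{x..y} \<subseteq> open_edge G e"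
  shows "(LINT t|lebesgue_on {x..y}. gderiv G u e t) = on_edge G u e y - on_edge G u e x"
    "integrable (lebesgue_on {x..y}) (gderiv G u e)"
proof -
  note I = interval_of_facts[OF fin e]
  have "y \<in> open_edge G e" using xy by auto
  then obtain d where d: "d > 0" "cball y d \<subseteq> open_edge G e"
    using I(6) open_contains_cball by blast
  have "{x..y+d} \<subseteq> {x..y} \<union> cball y d" by (auto simp: dist_real_def)
  then have sub: "{x..y+d} \<subseteq> open_edge G e" using xy d by blast
  have int: "integrable (lebesgue_on {a..b}) (gderiv G u e)" if "{a..b} \<subseteq> open_edge G e" for a b
    by (rule L2_integrable_on[OF gderiv_L2(1)[OF u e] _ I(2)]) (use that I(4) in blast)
  show "integrable (lebesgue_on {x..y}) (gderiv G u e)" by (rule int[OF xy(2)])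
  show "(LINT t|lebesgue_on {x..y}. gderiv G u e t) = on_edge G u e y - on_edge G u e x"
  proof (rule weak_derivative_imp_integral[OF gderiv_L2(2)[OF u e] xy(1) _ _ I(2) _ int[OF sub]])
    show "y < y + d" using d by simp
    show "{x..y + d} \<subseteq> interior (interval_of G e)" using sub I(1) by simp
    show "continuous_on {x..y + d} (on_edge G u e)"
      by (rule continuous_on_subset[OF on_edge_continuous[OF u e]]) (use sub I(4) in blast)
  qed
qed

text \<open>The weak equation is tested with the hat that peaks at \<open>x2\<close>. Its derivative
  is constant on both sides of the peak, so \<open>\<integral>u'h'\<close> is the difference of two
  secant slopes of \<open>u\<close>; the right side is the same difference for a second
  antiderivative of the source.\<close>

lemma solution_three_points:
  assumes s: "solves G p W \<rho> \<Lambda> u" and e: "e \<in> edges G"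
    and x: "x1 < x2" "x2 < x3" "{x1..x3} \<subseteq> open_edge G e"
  shows "(on_edge G u e x2 - on_edge G u e x1) / (x2 - x1) - (on_edge G u e x3 - on_edge G u e x2) / (x3 - x2)
    = - ((integral {x1..x2} (\<lambda>s. s * source \<Lambda> u e s) - x1 * integral {x1..x2} (source \<Lambda> u e)) / (x2 - x1)
       + (x3 * integral {x2..x3} (source \<Lambda> u e) - integral {x2..x3} (\<lambda>s. s * source \<Lambda> u e s)) / (x3 - x2))"
proof -
  let ?h = "trapezoid x1 x2 x2 x3" and ?h' = "trapezoid_deriv x1 x2 x2 x3"
  let ?g = "gderiv G u e" and ?F = "source \<Lambda> u e"
  note tv = trapezoid_values[OF x(1) order_refl x(2)]
  have u: "u \<in> H1_graph G" using s by (simp add: solves_def)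
  have sub: "{x1..x2} \<subseteq> open_edge G e" "{x2..x3} \<subseteq> open_edge G e" using x by auto
  note we = weak_equation[OF s e piecewise_test_trapezoid[OF x(1) order_refl x(2)] _ x(3)]
  have x13: "x1 \<le> x3" using x by simp
  note g12 = gderiv_integral[OF u e x(1) sub(1)] and g23 = gderiv_integral[OF u e x(2) sub(2)]
  have G: "integral {x1..x3} (\<lambda>t. ?g t * ?h' t) = (on_edge G u e x2 - on_edge G u e x1) / (x2 - x1) - (on_edge G u e x3 - on_edge G u e x2) / (x3 - x2)"
  proof -
    have i: "(\<lambda>t. ?g t * ?h' t) integrable_on {x1..x3}"
      using we(2)[OF x13] by (intro integrable_on_lebesgue_on) auto
    have "integral {x1..x2} (\<lambda>t. ?g t * ?h' t) = integral {x1..x2} (\<lambda>t. (1 / (x2 - x1)) * ?g t)"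
      by (rule integral_spike[of "{x1, x2}"]) (auto simp: trapezoid_deriv_def)
    also have "\<dots> = (on_edge G u e x2 - on_edge G u e x1) / (x2 - x1)"
      using lebesgue_integral_eq_integral[OF g12(2)] g12(1) by simp
    finally have 1: "integral {x1..x2} (\<lambda>t. ?g t * ?h' t) = (on_edge G u e x2 - on_edge G u e x1) / (x2 - x1)" .
    have "integral {x2..x3} (\<lambda>t. ?g t * ?h' t) = integral {x2..x3} (\<lambda>t. (- 1 / (x3 - x2)) * ?g t)"
      by (rule integral_spike[of "{x2, x3}"]) (auto simp: trapezoid_deriv_def)
    also have "\<dots> = - (on_edge G u e x3 - on_edge G u e x2) / (x3 - x2)"
      using lebesgue_integral_eq_integral[OF g23(2)] g23(1) by simp
    finally have 2: "integral {x2..x3} (\<lambda>t. ?g t * ?h' t) = - (on_edge G u e x3 - on_edge G u e x2) / (x3 - x2)" .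
    show ?thesis
      using Henstock_Kurzweil_Integration.integral_combine[OF _ _ i, of x2] x 1 2 by (simp add: diff_divide_distrib)
  qed
  have subI: "{x1..x3} \<subseteq> interval_of G e" using x(3) interval_of_facts(4)[OF fin e] by blast
  have Fi: "?F integrable_on {x1..x3}"
    by (rule integrable_on_lebesgue_on[OF source_integrable[OF u e subI]]) auto
  have sFi: "(\<lambda>s. s * ?F s) integrable_on {x1..x3}"
  proof -
    have "integrable (lebesgue_on {x1..x3}) (\<lambda>s. ?F s * s)"
      by (rule integrable_mult_bounded[where C = "max \<bar>x1\<bar> \<bar>x3\<bar>", OF source_integrable[OF u e subI]])
        (auto simp: AE_lebesgue_on_iff intro!: borel_measurable_lebesgue_on)
    from integrable_on_lebesgue_on[OF this] show ?thesis by (simp add: mult.commute)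
  qed
  have F: "integral {x1..x3} (\<lambda>t. ?F t * ?h t) =
      (integral {x1..x2} (\<lambda>s. s * ?F s) - x1 * integral {x1..x2} ?F) / (x2 - x1)
       + (x3 * integral {x2..x3} ?F - integral {x2..x3} (\<lambda>s. s * ?F s)) / (x3 - x2)"
  proof -
    have i: "(\<lambda>t. ?F t * ?h t) integrable_on {x1..x3}"
      using we(3)[OF x13] by (intro integrable_on_lebesgue_on) auto
    have sub: "?F integrable_on {a..b}" "(\<lambda>s. s * ?F s) integrable_on {a..b}" if "x1 \<le> a" "b \<le> x3" for a b
      using that integrable_on_subinterval[OF Fi] integrable_on_subinterval[OF sFi] by auto
    have lin: "integral {a..b} (\<lambda>s. s * ?F s - c * ?F s) = integral {a..b} (\<lambda>s. s * ?F s) - c * integral {a..b} ?F"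
      if "x1 \<le> a" "b \<le> x3" for a b c
      using Henstock_Kurzweil_Integration.integral_diff[OF sub(2)[OF that] integrable_on_cmult_left[OF sub(1)[OF that], of c]]
      by simp
    have "integral {x1..x2} (\<lambda>t. ?F t * ?h t) = integral {x1..x2} (\<lambda>s. (1 / (x2 - x1)) * (s * ?F s - x1 * ?F s))"
      by (rule Henstock_Kurzweil_Integration.integral_cong) (simp add: tv(3) algebra_simps add_divide_distrib diff_divide_distrib)
    also have "\<dots> = (integral {x1..x2} (\<lambda>s. s * ?F s) - x1 * integral {x1..x2} ?F) / (x2 - x1)"
      using x by (simp add: lin del: integral_diff)
    finally have 1: "integral {x1..x2} (\<lambda>t. ?F t * ?h t) = (integral {x1..x2} (\<lambda>s. s * ?F s) - x1 * integral {x1..x2} ?F) / (x2 - x1)" .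
    have "integral {x2..x3} (\<lambda>t. ?F t * ?h t) = integral {x2..x3} (\<lambda>s. (- 1 / (x3 - x2)) * (s * ?F s - x3 * ?F s))"
      by (rule Henstock_Kurzweil_Integration.integral_cong) (simp add: tv(5) algebra_simps add_divide_distrib diff_divide_distrib)
    also have "\<dots> = (- 1 / (x3 - x2)) * (integral {x2..x3} (\<lambda>s. s * ?F s) - x3 * integral {x2..x3} ?F)"
      using x by (simp only: integral_mult_right lin)
    finally have 2: "integral {x2..x3} (\<lambda>t. ?F t * ?h t) = (- 1 / (x3 - x2)) * (integral {x2..x3} (\<lambda>s. s * ?F s) - x3 * integral {x2..x3} ?F)" .
    show ?thesis
      using Henstock_Kurzweil_Integration.integral_combine[OF _ _ i, of x2] x 1 2 by (simp add: diff_divide_distrib)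
  qed
  have "integral {x1..x3} (\<lambda>t. ?g t * ?h' t) = - integral {x1..x3} (\<lambda>t. ?F t * ?h t)"
    using we(1)[OF x13] lebesgue_integral_eq_integral[OF we(2)[OF x13]] lebesgue_integral_eq_integral[OF we(3)[OF x13]] by simp
  then show ?thesis unfolding G F .
qed

text \<open>\<open>D\<close>, the difference between \<open>u\<close> and a second antiderivative of
  the source, has equal secant slopes on both sides of every interior point by
  \<open>solution_three_points\<close>. Hence it is affine with some slope \<open>m\<close>, and
  \<open>u\<close> inherits the differentiability of the antiderivative.\<close>

lemma solution_derivative_within:
  assumes s: "solves G p W \<rho> \<Lambda> u" and e: "e \<in> edges G" and ab: "a < b" "{a..b} \<subseteq> open_edge G e"
  obtains m where "\<And>x. x \<in> {a..b} \<Longrightarrow>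
    (on_edge G u e has_real_derivative integral {a..x} (source \<Lambda> u e) + m) (at x within {a..b})"
proof -
  let ?F = "source \<Lambda> u e"
  have u: "u \<in> H1_graph G" using s by (simp add: solves_def)
  have subI: "{a..b} \<subseteq> interval_of G e" using ab(2) interval_of_facts(4)[OF fin e] by blast
  define G0 where "G0 t = integral {a..t} ?F" for t
  define G1 where "G1 t = integral {a..t} (\<lambda>s. s * ?F s)" for t
  define D where "D t = on_edge G u e t - (t * G0 t - G1 t)" for t
  have Fi: "?F integrable_on {a..b}"
    by (rule integrable_on_lebesgue_on[OF source_integrable[OF u e subI]]) auto
  have sFi: "(\<lambda>s. s * ?F s) integrable_on {a..b}"
  proof -
    have "integrable (lebesgue_on {a..b}) (\<lambda>s. ?F s * s)"
      by (rule integrable_mult_bounded[where C = "max \<bar>a\<bar> \<bar>b\<bar>", OF source_integrable[OF u e subI]])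
        (auto simp: AE_lebesgue_on_iff intro!: borel_measurable_lebesgue_on)
    from integrable_on_lebesgue_on[OF this] show ?thesis by (simp add: mult.commute)
  qed
  have sub: "?F integrable_on {c..d}" "(\<lambda>s. s * ?F s) integrable_on {c..d}" if "a \<le> c" "d \<le> b" for c d
    using that integrable_on_subinterval[OF Fi] integrable_on_subinterval[OF sFi] by auto
  have G: "integral {c..d} ?F = G0 d - G0 c" "integral {c..d} (\<lambda>s. s * ?F s) = G1 d - G1 c"
    if "a \<le> c" "c \<le> d" "d \<le> b" for c d
    using Henstock_Kurzweil_Integration.integral_combine[OF that(1,2) sub(1)[OF order_refl that(3)]]
      Henstock_Kurzweil_Integration.integral_combine[OF that(1,2) sub(2)[OF order_refl that(3)]]
    by (simp_all add: G0_def G1_def)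
  have slope: "(D x - D a) / (x - a) = (D b - D x) / (b - x)" if x: "a < x" "x < b" for x
  proof -
    have 3: "(on_edge G u e x - on_edge G u e a) / (x - a) - (on_edge G u e b - on_edge G u e x) / (b - x)
      = - ((G1 x - G1 a - a * (G0 x - G0 a)) / (x - a) + (b * (G0 b - G0 x) - (G1 b - G1 x)) / (b - x))"
      using solution_three_points[OF s e x ab(2)] x by (simp add: G)
    have "(x * G0 x - G1 x - (a * G0 a - G1 a)) / (x - a) + (G1 x - G1 a - a * (G0 x - G0 a)) / (x - a) = G0 x"
      using x by (simp add: add_divide_distrib[symmetric]) (simp add: divide_eq_eq algebra_simps)
    moreover have "(b * G0 b - G1 b - (x * G0 x - G1 x)) / (b - x) - (b * (G0 b - G0 x) - (G1 b - G1 x)) / (b - x) = G0 x"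
      using x by (simp add: diff_divide_distrib[symmetric]) (simp add: divide_eq_eq algebra_simps)
    moreover have "(D x - D a) / (x - a) = (on_edge G u e x - on_edge G u e a) / (x - a) - (x * G0 x - G1 x - (a * G0 a - G1 a)) / (x - a)"
      "(D b - D x) / (b - x) = (on_edge G u e b - on_edge G u e x) / (b - x) - (b * G0 b - G1 b - (x * G0 x - G1 x)) / (b - x)"
      by (simp_all add: D_def diff_divide_distrib)
    ultimately show ?thesis using 3 by linarith
  qed
  define m where "m = (D b - D a) / (b - a)"
  have affine: "D x = D a + m * (x - a)" if x: "x \<in> {a..b}" for x
  proof -
    consider "x = a" | "x = b" | "a < x" "x < b" using x by fastforce
    then show ?thesis
    proof cases
      case 3
      have "(D x - D a) * (b - x) = (D b - D x) * (x - a)"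
        using slope[OF 3] 3 by (simp add: frac_eq_eq)
      then have "(D x - D a) * (b - a) = (D b - D a) * (x - a)" by algebra
      then have "D x - D a = (D b - D a) * (x - a) / (b - a)" using ab by (simp add: eq_divide_eq)
      then show ?thesis by (simp add: m_def)
    qed (use ab in \<open>auto simp: m_def\<close>)
  qed
  obtain M where M: "AE t in lebesgue_on {a..b}. \<bar>?F t\<bar> \<le> M"
    using source_bounded[OF u e subI] by blast
  have "(on_edge G u e has_real_derivative integral {a..x} ?F + m) (at x within {a..b})" if x: "x \<in> {a..b}" for x
  proof -
    have "((\<lambda>t. (t * G0 t - G1 t) + (D a + m * (t - a))) has_real_derivative G0 x + m) (at x within {a..b})"
    proof (rule DERIV_add)
      show "((\<lambda>t. t * G0 t - G1 t) has_real_derivative G0 x) (at x within {a..b})"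
        using second_antiderivative[OF source_integrable[OF u e subI] M x] unfolding G0_def G1_def .
      show "((\<lambda>t. D a + m * (t - a)) has_real_derivative m) (at x within {a..b})"
        by (auto intro!: derivative_eq_intros)
    qed
    then have "(on_edge G u e has_real_derivative G0 x + m) (at x within {a..b})"
    proof (rule has_field_derivative_transform_within[of _ _ _ _ 1])
      fix t assume "t \<in> {a..b}"
      from affine[OF this] show "(t * G0 t - G1 t) + (D a + m * (t - a)) = on_edge G u e t"
        by (simp add: D_def)
    qed (use x in auto)
    then show ?thesis by (simp add: G0_def)
  qed
  then show ?thesis using that by blast
qed

lemma solution_has_derivative:
  assumes s: "solves G p W \<rho> \<Lambda> u" and e: "e \<in> edges G" and x: "x \<in> open_edge G e"
  shows "(on_edge G u e has_real_derivative dedge u e x) (at x)"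
proof -
  obtain d where d: "d > 0" "cball x d \<subseteq> open_edge G e"
    using interval_of_facts(6)[OF fin e] x open_contains_cball by blast
  have "{x-d..x+d} \<subseteq> open_edge G e" using d by (auto simp: dist_real_def cball_eq_atLeastAtMost)
  then obtain k where k: "\<And>z. z \<in> {x-d..x+d} \<Longrightarrow>
      (on_edge G u e has_real_derivative integral {x-d..z} (source \<Lambda> u e) + k) (at z within {x-d..x+d})"
    using solution_derivative_within[OF s e, of "x-d" "x+d"] d by auto
  obtain m where "(on_edge G u e has_real_derivative m) (at x within {x-d..x+d})"
    using k[of x] d by auto
  moreover have "at x within {x-d..x+d} = at x"
    by (rule at_within_interior) (use d in auto)
  ultimately have "(on_edge G u e has_real_derivative m) (at x)" by simp
  then show ?thesis by (simp add: DERIV_imp_deriv)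
qed

lemma solution_derivative_diff:
  assumes s: "solves G p W \<rho> \<Lambda> u" and e: "e \<in> edges G" and xy: "x \<le> y" "x \<in> open_edge G e" "y \<in> open_edge G e"
  shows "integral {x..y} (source \<Lambda> u e) = dedge u e y - dedge u e x"
proof (cases "x = y")
  case False
  then have "x < y" using xy by simp
  obtain dx where dx: "dx > 0" "cball x dx \<subseteq> open_edge G e"
    using interval_of_facts(6)[OF fin e] xy open_contains_cball by blast
  obtain dy where dy: "dy > 0" "cball y dy \<subseteq> open_edge G e"
    using interval_of_facts(6)[OF fin e] xy open_contains_cball by blast
  define a b where "a = x - dx" and "b = y + dy"
  have ab: "a < x" "y < b" "a < b" using dx dy xy by (auto simp: a_def b_def)
  have "a \<in> open_edge G e" "b \<in> open_edge G e"
    using dx dy by (auto simp: a_def b_def dist_real_def subset_iff)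
  then have sub: "{a..b} \<subseteq> open_edge G e" by (rule open_edge_interval)
  obtain m where m: "\<And>z. z \<in> {a..b} \<Longrightarrow>
    (on_edge G u e has_real_derivative integral {a..z} (source \<Lambda> u e) + m) (at z within {a..b})"
    using solution_derivative_within[OF s e ab(3) sub] by blast
  have d: "dedge u e z = integral {a..z} (source \<Lambda> u e) + m" if "z \<in> {a<..<b}" for z
  proof -
    have "at z within {a..b} = at z" by (rule at_within_interior) (use that in auto)
    then show ?thesis using m[of z] that DERIV_imp_deriv by auto
  qed
  have u: "u \<in> H1_graph G" using s by (simp add: solves_def)
  have "{a..y} \<subseteq> {a..b}" using ab by auto
  then have "{a..y} \<subseteq> interval_of G e" using sub interval_of_facts(4)[OF fin e] by blast
  then have "source \<Lambda> u e integrable_on {a..y}"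
    by (intro integrable_on_lebesgue_on source_integrable[OF u e]) auto
  from Henstock_Kurzweil_Integration.integral_combine[OF _ xy(1) this] ab d[of x] d[of y] xy
  show ?thesis by auto
qed simp

lemma dedge_continuous:
  assumes s: "solves G p W \<rho> \<Lambda> u" and e: "e \<in> edges G" and ab: "{a..b} \<subseteq> open_edge G e"
  shows "continuous_on {a..b} (dedge u e)"
proof (cases "a \<le> b")
  case True
  have u: "u \<in> H1_graph G" using s by (simp add: solves_def)
  have "{a..b} \<subseteq> interval_of G e" using ab interval_of_facts(4)[OF fin e] by auto
  then have "source \<Lambda> u e integrable_on {a..b}"
    by (intro integrable_on_lebesgue_on source_integrable[OF u e]) auto
  then have "continuous_on {a..b} (\<lambda>x. dedge u e a + integral {a..x} (source \<Lambda> u e))"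
    by (intro continuous_intros indefinite_integral_continuous_1)
  then show ?thesis
  proof (rule continuous_on_eq)
    fix x assume "x \<in> {a..b}"
    then show "dedge u e a + integral {a..x} (source \<Lambda> u e) = dedge u e x"
      using solution_derivative_diff[OF s e, of a x] subsetD[OF ab, of a] subsetD[OF ab, of x] True by auto
  qed
qed simp

text \<open>Both functions integrate to the increments of \<open>u\<close> over compact intervals.
  The arbitrary representative \<open>gderiv\<close> can thus be exchanged for the continuous
  \<open>dedge\<close> in energy identities.\<close>

lemma gderiv_eq_dedge:
  assumes s: "solves G p W \<rho> \<Lambda> u" and e: "e \<in> edges G"
  shows "AE x in lebesgue_on (interval_of G e). gderiv G u e x = dedge u e x"
proof (rule AE_eq_if_integrals_eq[OF interval_of_facts(2,3)[OF fin e]], unfold interval_of_facts(1)[OF fin e])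
  have u: "u \<in> H1_graph G" using s by (simp add: solves_def)
  fix a b assume ab: "{a..b} \<subseteq> open_edge G e"
  show i: "integrable (lebesgue_on {a..b}) (dedge u e)"
    by (rule continuous_imp_integrable_real[OF dedge_continuous[OF s e ab]])
  show "integrable (lebesgue_on {a..b}) (gderiv G u e)"
    by (rule L2_integrable_on[OF gderiv_L2(1)[OF u e] _ interval_of_facts(2)[OF fin e]])
      (use ab interval_of_facts(4)[OF fin e] in blast)
  assume lt: "a < b"
  have "(dedge u e has_integral on_edge G u e b - on_edge G u e a) {a..b}"
    by (rule fundamental_theorem_of_calculus)
      (use lt ab in \<open>auto intro!: has_field_derivative_at_within[OF solution_has_derivative[OF s e]]
        simp: has_real_derivative_iff_has_vector_derivative[symmetric]\<close>)
  then show "(LINT t|lebesgue_on {a..b}. gderiv G u e t) = (LINT t|lebesgue_on {a..b}. dedge u e t)"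
    using gderiv_integral(1)[OF u e lt ab] lebesgue_integral_eq_integral[OF i] by (simp add: integral_unique)
qed

lemma weak_equation_dedge:
  assumes s: "solves G p W \<rho> \<Lambda> u" and e: "e \<in> edges G"
    and pt: "piecewise_test a b \<phi> \<psi>" and ab: "a \<le> b" "{a..b} \<subseteq> open_edge G e"
  shows "(LINT x|lebesgue_on {a..b}. dedge u e x * \<psi> x) = - (LINT x|lebesgue_on {a..b}. source \<Lambda> u e x * \<phi> x)"
    and "integrable (lebesgue_on {a..b}) (\<lambda>x. dedge u e x * \<psi> x)"
    and "integrable (lebesgue_on {a..b}) (\<lambda>x. source \<Lambda> u e x * \<phi> x)"
proof -
  have c: "continuous_on {a..b} (dedge u e)" by (rule dedge_continuous[OF s e ab(2)])
  show i: "integrable (lebesgue_on {a..b}) (\<lambda>x. dedge u e x * \<psi> x)"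
    using piecewise_test_integrable(1)[OF pt] continuous_on_measurable_bounded[OF c] by metis
  note we = weak_equation[OF s e pt ab]
  show "integrable (lebesgue_on {a..b}) (\<lambda>x. source \<Lambda> u e x * \<phi> x)" by (rule we(3))
  have "AE x in lebesgue_on {a..b}. gderiv G u e x = dedge u e x"
    by (rule AE_lebesgue_on_mono[OF gderiv_eq_dedge[OF s e]])
      (use ab interval_of_facts[OF fin e] in auto)
  then have "AE x in lebesgue_on {a..b}. gderiv G u e x * \<psi> x = dedge u e x * \<psi> x" by eventually_elim simp
  then have "(LINT x|lebesgue_on {a..b}. gderiv G u e x * \<psi> x) = (LINT x|lebesgue_on {a..b}. dedge u e x * \<psi> x)"
    using we(2) i by (intro integral_cong_AE) auto
  then show "(LINT x|lebesgue_on {a..b}. dedge u e x * \<psi> x) = - (LINT x|lebesgue_on {a..b}. source \<Lambda> u e x * \<phi> x)"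
    using we(1) by simp
qed

end

section \<open>A priori bounds for oscillating functions\<close>

text \<open>The conditions are the differential inequalities that \<open>v'' = (W + \<Lambda>) v - \<rho>|v|\<^sup>p\<^sup>-\<^sup>2 v\<close> with
  \<open>|W + \<Lambda>| \<le> 1\<close> and \<open>\<rho>0 \<le> \<rho> \<le> \<rho>1\<close> implies for \<open>v\<close> and, with \<open>\<sigma> = -1\<close>, for \<open>-v\<close>. They are
  stated in integrated form since \<open>W\<close> and \<open>\<rho>\<close> are only measurable.\<close>

definition oscillator :: "real \<Rightarrow> real \<Rightarrow> real \<Rightarrow> (real \<Rightarrow> real) \<Rightarrow> (real \<Rightarrow> real) \<Rightarrow> bool" where
  "oscillator \<rho>0 \<rho>1 p v w \<longleftrightarrow>
     (\<forall>t\<in>{0..1}. (v has_real_derivative w t) (at t)) \<and>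
     (\<forall>\<sigma>\<in>{-1,1}. \<forall>x y S. 0 \<le> x \<and> x \<le> y \<and> y \<le> 1 \<and> (\<forall>t\<in>{x..y}. 0 \<le> \<sigma> * v t \<and> \<sigma> * v t \<le> S) \<longrightarrow>
        \<sigma> * (w y - w x) \<le> S * (y - x) \<and> - ((S + \<rho>1 * S powr (p - 1)) * (y - x)) \<le> \<sigma> * (w y - w x)) \<and>
     (\<forall>\<sigma>\<in>{-1,1}. \<forall>x y s. 0 \<le> x \<and> x \<le> y \<and> y \<le> 1 \<and> 0 \<le> s \<and> 1 \<le> \<rho>0 * s powr (p - 2) \<and> (\<forall>t\<in>{x..y}. s \<le> \<sigma> * v t) \<longrightarrow>
        \<sigma> * (w y - w x) \<le> - ((\<rho>0 * s powr (p - 2) - 1) * s * (y - x)))"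

text \<open>The intervals may contain further zeros and are numbered in no particular order. Only
  what the Morse index needs is recorded: disjoint interiors, and a nonzero value inside, which
  makes the Hessian strictly negative.\<close>

definition nodal_intervals :: "(real \<Rightarrow> real) \<Rightarrow> real \<Rightarrow> real \<Rightarrow> nat \<Rightarrow> bool" where
  "nodal_intervals v a b k \<longleftrightarrow> (\<exists>z z'. (\<forall>i<k. a \<le> z i \<and> z i < z' i \<and> z' i \<le> b \<and> v (z i) = 0 \<and> v (z' i) = 0
      \<and> (\<exists>t\<in>{z i<..<z' i}. v t \<noteq> 0))
      \<and> (\<forall>i<k. \<forall>j<k. i \<noteq> j \<longrightarrow> z' i \<le> z j \<or> z' j \<le> (z i :: real)))"

lemma nodal_intervals_0: "nodal_intervals v a b 0"
  unfolding nodal_intervals_def by blast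

lemma nodal_intervals_mono:
  assumes "nodal_intervals v a b k" "a' \<le> a" "b \<le> b'"
  shows "nodal_intervals v a' b' k"
proof -
  obtain z z' where z: "\<forall>i<k. a \<le> z i \<and> z i < z' i \<and> z' i \<le> b \<and> v (z i) = 0 \<and> v (z' i) = 0
      \<and> (\<exists>t\<in>{z i<..<z' i}. v t \<noteq> 0)" "\<forall>i<k. \<forall>j<k. i \<noteq> j \<longrightarrow> z' i \<le> z j \<or> z' j \<le> z i"
    using assms(1) unfolding nodal_intervals_def by blast
  have "a' \<le> z i \<and> z i < z' i \<and> z' i \<le> b' \<and> v (z i) = 0 \<and> v (z' i) = 0
      \<and> (\<exists>t\<in>{z i<..<z' i}. v t \<noteq> 0)" if i: "i < k" for i
    using z(1)[rule_format, OF i] assms(2,3) by (simp del: greaterThanLessThan_iff)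
  then show ?thesis unfolding nodal_intervals_def
    by (rule_tac exI[of _ z], rule_tac exI[of _ z']) (use z(2) in blast)
qed

lemma nodal_intervals_Suc:
  assumes "nodal_intervals v a y k" "y < z" "v y = 0" "v z = 0" "t \<in> {y<..<z}" "v t \<noteq> 0" "a \<le> y"
  shows "nodal_intervals v a z (Suc k)"
proof -
  obtain f g where fg: "\<forall>i<k. a \<le> f i \<and> f i < g i \<and> g i \<le> y \<and> v (f i) = 0 \<and> v (g i) = 0
      \<and> (\<exists>t\<in>{f i<..<g i}. v t \<noteq> 0)" "\<forall>i<k. \<forall>j<k. i \<noteq> j \<longrightarrow> g i \<le> f j \<or> g j \<le> f i"
    using assms(1) unfolding nodal_intervals_def by blast
  have 1: "a \<le> (f(k := y)) i \<and> (f(k := y)) i < (g(k := z)) i \<and> (g(k := z)) i \<le> z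
      \<and> v ((f(k := y)) i) = 0 \<and> v ((g(k := z)) i) = 0 \<and> (\<exists>t\<in>{(f(k := y)) i<..<(g(k := z)) i}. v t \<noteq> 0)"
    if i: "i < Suc k" for i
  proof (cases "i = k")
    case True
    then show ?thesis using assms by (simp del: greaterThanLessThan_iff) blast
  next
    case False
    then have "i < k" using i by simp
    then show ?thesis using fg(1)[rule_format, of i] False assms(2) by (simp del: greaterThanLessThan_iff)
  qed
  have 2: "(g(k := z)) i \<le> (f(k := y)) j \<or> (g(k := z)) j \<le> (f(k := y)) i"
    if "i < Suc k" "j < Suc k" "i \<noteq> j" for i j
    using fg that by (auto simp: less_Suc_eq)
  show ?thesis unfolding nodal_intervals_def
    by (rule exI[of _ "f(k := y)"], rule exI[of _ "g(k := z)"]) (use 1 2 in blast)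
qed

lemma nodal_intervals_reflect:
  assumes "nodal_intervals (\<lambda>t. v (1 - t)) 0 1 k"
  shows "nodal_intervals v 0 1 k"
proof -
  obtain z z' where z: "\<forall>i<k. 0 \<le> z i \<and> z i < z' i \<and> z' i \<le> 1 \<and> v (1 - z i) = 0 \<and> v (1 - z' i) = 0
      \<and> (\<exists>t\<in>{z i<..<z' i}. v (1 - t) \<noteq> 0)" "\<forall>i<k. \<forall>j<k. i \<noteq> j \<longrightarrow> z' i \<le> z j \<or> z' j \<le> (z i :: real)"
    using assms(1) unfolding nodal_intervals_def by blast
  have 1: "0 \<le> 1 - z' i \<and> 1 - z' i < 1 - z i \<and> 1 - z i \<le> 1 \<and> v (1 - z' i) = 0 \<and> v (1 - z i) = 0
      \<and> (\<exists>t\<in>{1 - z' i<..<1 - z i}. v t \<noteq> 0)" if i: "i < k" for i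
  proof -
    obtain t where "t \<in> {z i<..<z' i}" "v (1 - t) \<noteq> 0" using z i by blast
    then have "\<exists>t\<in>{1 - z' i<..<1 - z i}. v t \<noteq> 0" by (intro bexI[of _ "1 - t"]) auto
    then show ?thesis using z i by auto
  qed
  have 2: "1 - z i \<le> 1 - z' j \<or> 1 - z j \<le> 1 - z' i" if "i < k" "j < k" "i \<noteq> j" for i j
    using z(2)[rule_format, OF that] by auto
  show ?thesis unfolding nodal_intervals_def
    by (rule exI[of _ "\<lambda>i. 1 - z' i"], rule exI[of _ "\<lambda>i. 1 - z i"]) (use 1 2 in blast)
qed

lemma sign_constant:
  fixes v :: "real \<Rightarrow> real"
  assumes c: "continuous_on I v" and I: "is_interval I" and nz: "\<And>t. t \<in> I \<Longrightarrow> v t \<noteq> 0"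
  shows "(\<forall>t\<in>I. 0 < v t) \<or> (\<forall>t\<in>I. v t < 0)"
proof (rule ccontr)
  assume "\<not> ?thesis"
  then obtain s t where st: "s \<in> I" "t \<in> I" "v s \<le> 0" "0 \<le> v t" by force
  have "connected (v ` I)" by (intro connected_continuous_image c is_interval_connected I)
  then have "0 \<in> v ` I" using connectedD_interval[of "v ` I" "v s" "v t" 0] st by auto
  then show False using nz by auto
qed

context
  fixes \<rho>0 \<rho>1 p :: real
  assumes \<rho>: "0 < \<rho>0" "0 \<le> \<rho>1" and p: "2 < p"
begin

lemma oscD:
  assumes "oscillator \<rho>0 \<rho>1 p v w"
  shows "t \<in> {0..1} \<Longrightarrow> (v has_real_derivative w t) (at t)"
    "0 \<le> x \<Longrightarrow> x \<le> y \<Longrightarrow> y \<le> 1 \<Longrightarrow> (\<And>t. t \<in> {x..y} \<Longrightarrow> 0 \<le> v t \<and> v t \<le> S) \<Longrightarrow> w y - w x \<le> S * (y - x)"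
    "0 \<le> x \<Longrightarrow> x \<le> y \<Longrightarrow> y \<le> 1 \<Longrightarrow> (\<And>t. t \<in> {x..y} \<Longrightarrow> 0 \<le> v t \<and> v t \<le> S) \<Longrightarrow> - ((S + \<rho>1 * S powr (p - 1)) * (y - x)) \<le> w y - w x"
    "0 \<le> x \<Longrightarrow> x \<le> y \<Longrightarrow> y \<le> 1 \<Longrightarrow> 0 \<le> s \<Longrightarrow> 1 \<le> \<rho>0 * s powr (p - 2) \<Longrightarrow> (\<And>t. t \<in> {x..y} \<Longrightarrow> s \<le> v t) \<Longrightarrow>
      w y - w x \<le> - ((\<rho>0 * s powr (p - 2) - 1) * s * (y - x))"
proof -
  have 1: "\<forall>x y S. 0 \<le> x \<and> x \<le> y \<and> y \<le> 1 \<and> (\<forall>t\<in>{x..y}. 0 \<le> 1 * v t \<and> 1 * v t \<le> S) \<longrightarrow>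
        1 * (w y - w x) \<le> S * (y - x) \<and> - ((S + \<rho>1 * S powr (p - 1)) * (y - x)) \<le> 1 * (w y - w x)"
    and 2: "\<forall>x y s. 0 \<le> x \<and> x \<le> y \<and> y \<le> 1 \<and> 0 \<le> s \<and> 1 \<le> \<rho>0 * s powr (p - 2) \<and> (\<forall>t\<in>{x..y}. s \<le> 1 * v t) \<longrightarrow>
        1 * (w y - w x) \<le> - ((\<rho>0 * s powr (p - 2) - 1) * s * (y - x))"
    using assms unfolding oscillator_def by blast+
  show "t \<in> {0..1} \<Longrightarrow> (v has_real_derivative w t) (at t)"
    using assms unfolding oscillator_def by blast
  show "0 \<le> x \<Longrightarrow> x \<le> y \<Longrightarrow> y \<le> 1 \<Longrightarrow> (\<And>t. t \<in> {x..y} \<Longrightarrow> 0 \<le> v t \<and> v t \<le> S) \<Longrightarrow> w y - w x \<le> S * (y - x)"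
    "0 \<le> x \<Longrightarrow> x \<le> y \<Longrightarrow> y \<le> 1 \<Longrightarrow> (\<And>t. t \<in> {x..y} \<Longrightarrow> 0 \<le> v t \<and> v t \<le> S) \<Longrightarrow> - ((S + \<rho>1 * S powr (p - 1)) * (y - x)) \<le> w y - w x"
    using 1[rule_format, of x y S] by auto
  show "0 \<le> x \<Longrightarrow> x \<le> y \<Longrightarrow> y \<le> 1 \<Longrightarrow> 0 \<le> s \<Longrightarrow> 1 \<le> \<rho>0 * s powr (p - 2) \<Longrightarrow> (\<And>t. t \<in> {x..y} \<Longrightarrow> s \<le> v t) \<Longrightarrow>
      w y - w x \<le> - ((\<rho>0 * s powr (p - 2) - 1) * s * (y - x))"
    using 2[rule_format, of x y s] by auto
qed

lemma osc_minus:
  assumes "oscillator \<rho>0 \<rho>1 p v w"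
  shows "oscillator \<rho>0 \<rho>1 p (\<lambda>t. - v t) (\<lambda>t. - w t)"
proof -
  have 1: "\<sigma> * - v t = (- \<sigma>) * v t" "\<sigma> * (- w y - - w x) = (- \<sigma>) * (w y - w x)" for \<sigma> t x y by (auto simp: algebra_simps)
  have 2: "(\<forall>\<sigma>\<in>{-1,1::real}. P (- \<sigma>)) \<longleftrightarrow> (\<forall>\<sigma>\<in>{-1,1}. P \<sigma>)" for P by auto
  show ?thesis
    using assms unfolding oscillator_def 1 2[of "\<lambda>\<sigma>. \<forall>x y S. 0 \<le> x \<and> x \<le> y \<and> y \<le> 1 \<and> (\<forall>t\<in>{x..y}. 0 \<le> \<sigma> * v t \<and> \<sigma> * v t \<le> S) \<longrightarrow>
        \<sigma> * (w y - w x) \<le> S * (y - x) \<and> - ((S + \<rho>1 * S powr (p - 1)) * (y - x)) \<le> \<sigma> * (w y - w x)"]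
      2[of "\<lambda>\<sigma>. \<forall>x y s. 0 \<le> x \<and> x \<le> y \<and> y \<le> 1 \<and> 0 \<le> s \<and> 1 \<le> \<rho>0 * s powr (p - 2) \<and> (\<forall>t\<in>{x..y}. s \<le> \<sigma> * v t) \<longrightarrow>
        \<sigma> * (w y - w x) \<le> - ((\<rho>0 * s powr (p - 2) - 1) * s * (y - x))"]
    by (auto intro: DERIV_minus)
qed

text \<open>Reversing time turns estimates that run to the right into estimates that run to the
  left; the derivative changes its sign.\<close>

lemma osc_reflect:
  assumes "oscillator \<rho>0 \<rho>1 p v w"
  shows "oscillator \<rho>0 \<rho>1 p (\<lambda>t. v (1 - t)) (\<lambda>t. - w (1 - t))"
  unfolding oscillator_def
proof (intro conjI ballI allI impI)
  fix t :: real assume t: "t \<in> {0..1}"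
  then have "(v has_real_derivative w (1 - t)) (at (1 - t))" using oscD(1)[OF assms, of "1 - t"] by auto
  moreover have "((\<lambda>t. 1 - t) has_real_derivative - 1) (at t)" by (auto intro!: derivative_eq_intros)
  ultimately show "((\<lambda>t. v (1 - t)) has_real_derivative - w (1 - t)) (at t)"
    using DERIV_chain2[of v "w (1 - t)" "\<lambda>t. 1 - t" t "-1"] by simp
next
  fix \<sigma> x y S :: real assume \<sigma>: "\<sigma> \<in> {-1,1}"
    and h: "0 \<le> x \<and> x \<le> y \<and> y \<le> 1 \<and> (\<forall>t\<in>{x..y}. 0 \<le> \<sigma> * v (1 - t) \<and> \<sigma> * v (1 - t) \<le> S)"
  have "0 \<le> \<sigma> * v t \<and> \<sigma> * v t \<le> S" if "t \<in> {1-y..1-x}" for t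
    using h[THEN conjunct2, THEN conjunct2, THEN conjunct2, rule_format, of "1 - t"] that by auto
  moreover have "\<forall>x y S. 0 \<le> x \<and> x \<le> y \<and> y \<le> 1 \<and> (\<forall>t\<in>{x..y}. 0 \<le> \<sigma> * v t \<and> \<sigma> * v t \<le> S) \<longrightarrow>
        \<sigma> * (w y - w x) \<le> S * (y - x) \<and> - ((S + \<rho>1 * S powr (p - 1)) * (y - x)) \<le> \<sigma> * (w y - w x)"
    using assms \<sigma> unfolding oscillator_def by blast
  from this[rule_format, of "1 - y" "1 - x" S] calculation
  have "\<sigma> * (w (1 - x) - w (1 - y)) \<le> S * (1 - x - (1 - y)) \<and> - ((S + \<rho>1 * S powr (p - 1)) * (1 - x - (1 - y))) \<le> \<sigma> * (w (1 - x) - w (1 - y))"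
    using h by auto
  then show "\<sigma> * (- w (1 - y) - - w (1 - x)) \<le> S * (y - x)" "- ((S + \<rho>1 * S powr (p - 1)) * (y - x)) \<le> \<sigma> * (- w (1 - y) - - w (1 - x))"
    by (simp_all add: algebra_simps)
next
  fix \<sigma> x y s :: real assume \<sigma>: "\<sigma> \<in> {-1,1}"
    and h: "0 \<le> x \<and> x \<le> y \<and> y \<le> 1 \<and> 0 \<le> s \<and> 1 \<le> \<rho>0 * s powr (p - 2) \<and> (\<forall>t\<in>{x..y}. s \<le> \<sigma> * v (1 - t))"
  have "s \<le> \<sigma> * v t" if "t \<in> {1-y..1-x}" for t
  proof -
    have "\<forall>t\<in>{x..y}. s \<le> \<sigma> * v (1 - t)" using h by blast
    from this[rule_format, of "1 - t"] that show ?thesis by auto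
  qed
  moreover have "\<forall>x y s. 0 \<le> x \<and> x \<le> y \<and> y \<le> 1 \<and> 0 \<le> s \<and> 1 \<le> \<rho>0 * s powr (p - 2) \<and> (\<forall>t\<in>{x..y}. s \<le> \<sigma> * v t) \<longrightarrow>
        \<sigma> * (w y - w x) \<le> - ((\<rho>0 * s powr (p - 2) - 1) * s * (y - x))"
    using assms \<sigma> unfolding oscillator_def by blast
  from this[rule_format, of "1 - y" "1 - x" s] calculation
  have "\<sigma> * (w (1 - x) - w (1 - y)) \<le> - ((\<rho>0 * s powr (p - 2) - 1) * s * (1 - x - (1 - y)))"
    using h by auto
  then show "\<sigma> * (- w (1 - y) - - w (1 - x)) \<le> - ((\<rho>0 * s powr (p - 2) - 1) * s * (y - x))"
    by (simp add: algebra_simps)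
qed

section \<open>Propagation of bounds from one point to the interval\<close>

lemma osc_continuous:
  assumes "oscillator \<rho>0 \<rho>1 p v w" "A \<subseteq> {0..1}"
  shows "continuous_on A v"
proof (rule continuous_at_imp_continuous_on, rule ballI)
  fix t assume "t \<in> A"
  then show "isCont v t" using DERIV_isCont[OF oscD(1)[OF assms(1)]] assms(2) by blast
qed

text \<open>Within a nodal interval the bound \<open>K\<close> for the function and its derivative at one end yields the bound
  \<open>growth K\<close> at the other end.\<close>

definition growth :: "real \<Rightarrow> real" where "growth K = 5 * K + \<rho>1 * (4 * K) powr (p - 1)"

lemma growth_ge: "0 \<le> K \<Longrightarrow> K \<le> growth K" "0 \<le> K \<Longrightarrow> 0 \<le> growth K"
  "0 \<le> K \<Longrightarrow> 4 * K \<le> growth K"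
proof -
  assume K: "0 \<le> K"
  have "0 \<le> \<rho>1 * (4 * K) powr (p - 1)" using \<rho> by simp
  then show "K \<le> growth K" "0 \<le> growth K" "4 * K \<le> growth K" using K unfolding growth_def by linarith+
qed

text \<open>With \<open>M\<close> the maximum of \<open>v\<close>, the slope satisfies
  \<open>w t \<le> K + M * (t - y)\<close>. Integrating up to the maximum point over a length of at
  most 1 gives \<open>M \<le> 2 * K + M / 2\<close>, that is \<open>M \<le> 4 * K\<close>. The
  two-sided bound on increments of \<open>w\<close> for functions between 0 and \<open>4 * K\<close>
  then controls \<open>w z\<close>.\<close>

lemma growth_pos_step:
  assumes o: "oscillator \<rho>0 \<rho>1 p v w" and yz: "0 \<le> y" "y < z" "z \<le> 1"
    and pos: "\<And>t. t \<in> {y<..<z} \<Longrightarrow> 0 < v t" and K: "\<bar>v y\<bar> \<le> K" "\<bar>w y\<bar> \<le> K"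
  shows "\<bar>v z\<bar> \<le> growth K \<and> \<bar>w z\<bar> \<le> growth K"
proof -
  have c: "continuous_on {y..z} v" by (rule osc_continuous[OF o]) (use yz in auto)
  have ge0: "0 \<le> v t" if t: "t \<in> {y..z}" for t
  proof -
    have "closure {y<..<z} = {y..z}" using yz by simp
    then show ?thesis
      using continuous_ge_on_closure[of "{y<..<z}" v t 0] c t pos by (simp add: less_imp_le)
  qed
  obtain ts where ts: "ts \<in> {y..z}" "\<And>t. t \<in> {y..z} \<Longrightarrow> v t \<le> v ts"
    using continuous_attains_sup[OF compact_Icc _ c] yz by force
  define M where "M = v ts"
  have wle: "w t \<le> K + M * (t - y)" if "t \<in> {y..z}" for t
    using oscD(2)[OF o, of y t M] that yz ts ge0 K by (auto simp: M_def)
  define h where "h t = v t - K * (t - y) - M * (t - y)\<^sup>2 / 2" for t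
  have "h ts \<le> h y"
  proof (rule DERIV_nonpos_imp_nonincreasing[of y ts h])
    fix t assume t: "y \<le> t" "t \<le> ts"
    then have "(v has_real_derivative w t) (at t)" using oscD(1)[OF o, of t] ts yz by auto
    then have "(h has_real_derivative w t - K - M * (t - y)) (at t)"
      unfolding h_def[abs_def] by (auto intro!: derivative_eq_intros)
    then show "\<exists>D. (h has_real_derivative D) (at t) \<and> D \<le> 0" using wle[of t] t ts by force
  qed (use ts in auto)
  then have "M \<le> v y + K * (ts - y) + M * (ts - y)\<^sup>2 / 2" by (simp add: h_def M_def)
  moreover have "K * (ts - y) \<le> K" using K ts yz by (intro mult_left_le) auto
  moreover have "M * (ts - y)\<^sup>2 \<le> M"
  proof (rule mult_left_le)
    show "(ts - y)\<^sup>2 \<le> 1" using ts yz by (intro power_le_one) auto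
    show "0 \<le> M" using ge0 ts by (simp add: M_def)
  qed
  ultimately have M: "M \<le> 4 * K" using K by linarith
  have le: "0 \<le> v t \<and> v t \<le> 4 * K" if "t \<in> {y..z}" for t
    using ge0[OF that] ts(2)[OF that] M by (simp add: M_def)
  have K0: "0 \<le> K" using K by linarith
  have "w z - w y \<le> 4 * K * (z - y)" "- ((4 * K + \<rho>1 * (4 * K) powr (p - 1)) * (z - y)) \<le> w z - w y"
    using oscD(2)[OF o, of y z "4 * K"] oscD(3)[OF o, of y z "4 * K"] le yz by auto
  moreover have "4 * K * (z - y) \<le> 4 * K" "(4 * K + \<rho>1 * (4 * K) powr (p - 1)) * (z - y) \<le> 4 * K + \<rho>1 * (4 * K) powr (p - 1)"
    using K0 yz \<rho> by (auto intro!: mult_left_le add_nonneg_nonneg mult_nonneg_nonneg)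
  moreover have "0 \<le> \<rho>1 * (4 * K) powr (p - 1)" using \<rho> by simp
  ultimately show ?thesis using le[of z] K yz unfolding growth_def by auto
qed

lemma growth_step:
  assumes o: "oscillator \<rho>0 \<rho>1 p v w" and yz: "0 \<le> y" "y < z" "z \<le> 1"
    and nz: "\<And>t. t \<in> {y<..<z} \<Longrightarrow> v t \<noteq> 0" and K: "\<bar>v y\<bar> \<le> K" "\<bar>w y\<bar> \<le> K"
  shows "\<bar>v z\<bar> \<le> growth K \<and> \<bar>w z\<bar> \<le> growth K"
proof -
  have "continuous_on {y<..<z} v" by (rule osc_continuous[OF o]) (use yz in auto)
  from sign_constant[OF this _ nz]
  consider "\<forall>t\<in>{y<..<z}. 0 < v t" | "\<forall>t\<in>{y<..<z}. v t < 0" by (auto simp: is_interval_1)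
  then show ?thesis
  proof cases
    case 1
    then show ?thesis using growth_pos_step[OF o yz _ K] by blast
  next
    case 2
    then show ?thesis using growth_pos_step[OF osc_minus[OF o] yz, of K] K by auto
  qed
qed

text \<open>The cases are distinguished by the supremum of the zeros in \<open>{x..<y}\<close>. If
  it equals \<open>y\<close>, then \<open>y\<close> is a limit of zeros, and the difference
  quotients at \<open>y\<close> along these zeros vanish, which forces
  \<open>w y = 0\<close>.\<close>

lemma last_zero:
  assumes o: "oscillator \<rho>0 \<rho>1 p v w" and xy: "0 \<le> x" "x < y" "y \<le> 1"
  obtains "\<And>t. t \<in> {x..<y} \<Longrightarrow> v t \<noteq> 0"
  | "v y = 0" "w y = 0"
  | z where "x \<le> z" "z < y" "v z = 0" "\<And>t. t \<in> {z<..<y} \<Longrightarrow> v t \<noteq> 0"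
proof -
  define Z where "Z = {t \<in> {x..<y}. v t = 0}"
  show thesis
  proof (cases "Z = {}")
    case True
    then show thesis using that(1) unfolding Z_def by blast
  next
    case False
    define z where "z = Sup Z"
    have bdd: "bdd_above Z" unfolding Z_def by (intro bdd_aboveI[of _ y]) auto
    have zy: "z \<le> y" unfolding z_def using False by (intro cSup_least) (auto simp: Z_def)
    have xz: "x \<le> z" 
    proof -
      obtain t where t: "t \<in> Z" using False by blast
      then have "t \<le> z" unfolding z_def using bdd by (rule cSup_upper)
      then show ?thesis using t by (simp add: Z_def)
    qed
    have cl: "z \<in> closure Z" unfolding z_def by (rule closure_contains_Sup[OF False bdd])
    have zero: "v t = 0" if "t \<in> closure Z" for t
    proof -
      have "Z \<subseteq> {x..y}" by (auto simp: Z_def)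
      then have "closure Z \<subseteq> {x..y}" by (rule closure_minimal) simp
      then have "continuous_on (closure Z) v" using xy by (intro osc_continuous[OF o]) auto
      moreover have "\<And>t. t \<in> Z \<Longrightarrow> v t = 0" by (simp add: Z_def)
      ultimately show ?thesis using that by (rule continuous_constant_on_closure)
    qed
    show thesis
    proof (cases "z = y")
      case True
      have vy: "v y = 0" using zero[OF cl] True by simp
      have "(v has_real_derivative w y) (at y)" using oscD(1)[OF o, of y] xy by auto
      then have lim: "((\<lambda>t. v t / (t - y)) \<longlongrightarrow> w y) (at y within Z)"
        using has_field_derivative_at_within[of v "w y" y Z] vy by (simp add: has_field_derivative_iff)
      have "((\<lambda>t. v t / (t - y)) \<longlongrightarrow> 0) (at y within Z)"
        by (rule tendsto_eventually) (auto simp: eventually_at_filter Z_def)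
      moreover have "at y within Z \<noteq> bot"
      proof -
        have "y \<notin> Z" by (simp add: Z_def)
        then have "y islimpt Z" using cl True by (metis closure_def UnE mem_Collect_eq)
        then show ?thesis by (simp add: trivial_limit_within)
      qed
      ultimately have "w y = 0" using tendsto_unique[OF _ lim] by blast
      then show thesis using that(2) vy by blast
    next
      case f: False
      have "v t \<noteq> 0" if t: "t \<in> {z<..<y}" for t
      proof
        assume "v t = 0"
        then have "t \<in> Z" using t xz by (auto simp: Z_def)
        then have "t \<le> z" unfolding z_def using bdd by (rule cSup_upper)
        then show False using t by simp
      qed
      moreover have "z < y" using zy f by simp
      ultimately show thesis using that(3) xz zero[OF cl] by blast
    qed
  qed
qed

lemma growth_pow_nonneg: "0 \<le> K \<Longrightarrow> 0 \<le> (growth ^^ k) K" "0 \<le> K \<Longrightarrow> K \<le> (growth ^^ k) K"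
proof -
  assume K: "0 \<le> K"
  show "0 \<le> (growth ^^ k) K" by (induction k) (auto simp: K growth_ge)
  show "K \<le> (growth ^^ k) K"
  proof (induction k)
    case (Suc k)
    then show ?case using growth_ge(1)[of "(growth ^^ k) K"] K by auto
  qed simp
qed

text \<open>A zero that is not a limit of earlier zeros ends a whole nodal interval, so going back from \<open>y\<close> zero by
  zero reaches \<open>x\<close> after \<open>k\<close> steps unless \<open>k\<close> nodal intervals have been collected. A limit of
  zeros has \<open>w y = 0\<close> and needs no estimate.\<close>

lemma propagate_zero:
  assumes o: "oscillator \<rho>0 \<rho>1 p v w" and x: "0 \<le> x" and K: "\<bar>v x\<bar> \<le> K" "\<bar>w x\<bar> \<le> K"
  shows "x \<le> y \<Longrightarrow> y \<le> 1 \<Longrightarrow> v y = 0 \<Longrightarrow> \<bar>w y\<bar> \<le> (growth ^^ k) (growth K) \<or> nodal_intervals v x y k"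
proof (induction k arbitrary: y)
  case 0
  then show ?case by (simp add: nodal_intervals_0)
next
  case (Suc k)
  have K0: "0 \<le> K" using K by linarith
  have big: "growth K \<le> (growth ^^ Suc k) (growth K)" "K \<le> growth K" "0 \<le> growth K"
    using growth_pow_nonneg(2)[of "growth K" "Suc k"] growth_ge[OF K0] by auto
  show ?case
  proof (cases "x = y")
    case True
    then show ?thesis using K big by auto
  next
    case False
    then have xy: "x < y" using Suc.prems by simp
    consider "\<And>t. t \<in> {x..<y} \<Longrightarrow> v t \<noteq> 0" | "w y = 0"
      | z where "x \<le> z" "z < y" "v z = 0" "\<And>t. t \<in> {z<..<y} \<Longrightarrow> v t \<noteq> 0"
      using last_zero[OF o x xy Suc.prems(2)] by metis
    then show ?thesis
    proof cases
      case 1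
      then show ?thesis using growth_step[OF o x xy Suc.prems(2) _ K] big by force
    next
      case 2
      then show ?thesis using big by auto
    next
      case 3
      have z0: "0 \<le> z" "z \<le> 1" using 3 x Suc.prems by auto
      from Suc.IH[OF 3(1) z0(2) 3(3)] show ?thesis
      proof
        assume "\<bar>w z\<bar> \<le> (growth ^^ k) (growth K)"
        then show ?thesis
          using growth_step[OF o z0(1) 3(2) Suc.prems(2) 3(4), of "(growth ^^ k) (growth K)"] 3(3) growth_pow_nonneg(1)[OF big(3)]
          by simp
      next
        assume "nodal_intervals v x z k"
        then have "nodal_intervals v x y (Suc k)"
          using 3 Suc.prems by (intro nodal_intervals_Suc[where t = "(z + y) / 2"]) auto
        then show ?thesis ..
      qed
    qed
  qed
qed

text \<open>Compared with \<open>propagate_zero\<close> there is one more growth step: the stretch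
  from the last zero to \<open>y\<close> need not end at a zero and so is not counted as a nodal
  interval.\<close>

lemma propagate:
  assumes o: "oscillator \<rho>0 \<rho>1 p v w" and x: "0 \<le> x" and K: "\<bar>v x\<bar> \<le> K" "\<bar>w x\<bar> \<le> K"
    and y: "x \<le> y" "y \<le> 1"
  shows "\<bar>v y\<bar> \<le> (growth ^^ Suc k) (growth K) \<or> nodal_intervals v 0 1 k"
proof -
  have K0: "0 \<le> K" using K by linarith
  have big: "growth K \<le> (growth ^^ Suc k) (growth K)" "K \<le> growth K" "0 \<le> growth K"
    using growth_pow_nonneg(2)[of "growth K" "Suc k"] growth_ge[OF K0] by auto
  show ?thesis
  proof (cases "x = y")
    case True
    then show ?thesis using K big by auto
  next
    case False
    then have xy: "x < y" using y by simp
    consider "\<And>t. t \<in> {x..<y} \<Longrightarrow> v t \<noteq> 0" | "v y = 0"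
      | z where "x \<le> z" "z < y" "v z = 0" "\<And>t. t \<in> {z<..<y} \<Longrightarrow> v t \<noteq> 0"
      using last_zero[OF o x xy y(2)] by metis
    then show ?thesis
    proof cases
      case 1
      then show ?thesis using growth_step[OF o x xy y(2) _ K] big by force
    next
      case 2
      then show ?thesis using big by auto
    next
      case 3
      have z0: "0 \<le> z" "z \<le> 1" using 3 x y by auto
      from propagate_zero[OF o x K 3(1) z0(2) 3(3), of k] show ?thesis
      proof
        assume "\<bar>w z\<bar> \<le> (growth ^^ k) (growth K)"
        then show ?thesis
          using growth_step[OF o z0(1) 3(2) y(2) 3(4), of "(growth ^^ k) (growth K)"] 3(3) growth_pow_nonneg(1)[OF big(3)]
          by simp
      next
        assume "nodal_intervals v x z k"
        then show ?thesis using nodal_intervals_mono[of v x z k 0 1] x z0 by blast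
      qed
    qed
  qed
qed

text \<open>A large positive solution is so concave that it cannot stay positive on an interval of
  prescribed length.\<close>

lemma no_large_decreasing:
  assumes o: "oscillator \<rho>0 \<rho>1 p v w" and c: "0 \<le> c" "c + 2 * r \<le> 1" "0 < r"
    and s: "0 < s" "1 + 1 / r\<^sup>2 \<le> \<rho>0 * s powr (p - 2)" and v: "\<And>t. t \<in> {c..c+2*r} \<Longrightarrow> s \<le> v t" and w: "w c \<le> 0"
  shows False
proof -
  have mono: "1 + 1 / r\<^sup>2 \<le> \<rho>0 * s' powr (p - 2)" if "s \<le> s'" for s'
  proof -
    have "\<rho>0 * s powr (p - 2) \<le> \<rho>0 * s' powr (p - 2)" using that s p \<rho> by (intro mult_left_mono powr_mono2) auto
    then show ?thesis using s by linarith
  qed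
  have r2: "0 < 1 / r\<^sup>2" using c by simp
  have C2: "w y - w x \<le> - (1 / r\<^sup>2 * s' * (y - x))" if "c \<le> x" "x \<le> y" "y \<le> c + 2 * r" "s \<le> s'" "\<And>t. t \<in> {x..y} \<Longrightarrow> s' \<le> v t" for x y s'
  proof -
    have "w y - w x \<le> - ((\<rho>0 * s' powr (p - 2) - 1) * s' * (y - x))"
    proof (rule oscD(4)[OF o])
      show "1 \<le> \<rho>0 * s' powr (p - 2)" using mono[OF that(4)] r2 by linarith
    qed (use that c s in auto)
    moreover have "1 / r\<^sup>2 * s' * (y - x) \<le> (\<rho>0 * s' powr (p - 2) - 1) * s' * (y - x)"
      using mono[OF that(4)] that s by (intro mult_right_mono) auto
    ultimately show ?thesis by linarith
  qed
  have dec: "w y \<le> w x" if "c \<le> x" "x \<le> y" "y \<le> c + 2 * r" for x y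
  proof -
    have "0 \<le> 1 / r\<^sup>2 * s * (y - x)" using that s by simp
    then show ?thesis using C2[of x y s] that v by auto
  qed
  have der: "(v has_real_derivative w t) (at t)" if "c \<le> t" "t \<le> c + 2 * r" for t
    using oscD(1)[OF o, of t] that c by auto
  have vdec: "v y \<le> v x" if "c \<le> x" "x \<le> y" "y \<le> c + 2 * r" for x y
  proof (rule DERIV_nonpos_imp_nonincreasing[OF that(2)])
    fix t assume "x \<le> t" "t \<le> y"
    then show "\<exists>D. (v has_real_derivative D) (at t) \<and> D \<le> 0"
      using der[of t] dec[of c t] that w by (intro exI[of _ "w t"]) auto
  qed
  \<comment> \<open>On \<open>{c..c+r}\<close> the function stays above \<open>V\<close>, so
    concavity lowers the slope to \<open>- V / r\<close> at \<open>c + r\<close>. On the second half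
    this slope consumes the whole remaining height \<open>V\<close>, which brings \<open>v\<close>
    down to 0.\<close>
  define V where "V = v (c + r)"
  have V: "s \<le> V" using v[of "c + r"] c by (simp add: V_def)
  have "w (c + r) - w c \<le> - (1 / r\<^sup>2 * V * (c + r - c))"
    by (rule C2) (use c V vdec in \<open>auto simp: V_def\<close>)
  then have wq: "w (c + r) \<le> - V / r" using w c by (simp add: power2_eq_square)
  have "v (c + 2 * r) - v (c + r) \<le> - V"
  proof -
    obtain \<xi> where \<xi>: "c + r < \<xi>" "\<xi> < c + 2 * r" "v (c + 2 * r) - v (c + r) = (c + 2 * r - (c + r)) * w \<xi>"
      using MVT2[of "c + r" "c + 2 * r" v w] der c by auto
    have "w \<xi> \<le> - V / r" using dec[of "c + r" \<xi>] \<xi> c wq by auto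
    then have "r * w \<xi> \<le> r * (- V / r)" using c by (intro mult_left_mono) auto
    then show ?thesis using \<xi> c by simp
  qed
  then have "v (c + 2 * r) \<le> 0" by (simp add: V_def)
  then show False using v[of "c + 2 * r"] s c by auto
qed

text \<open>Let \<open>M\<close> be the maximum of \<open>v\<close> on the window of length
  \<open>r\<close> to the left of \<open>x\<close>. Going left, the slope drops by at most
  \<open>M * r\<close>. If \<open>w x \<ge> M * r\<close>, then \<open>v\<close> is nondecreasing on
  the window, so \<open>M \<le> s\<close>, and positivity of \<open>v (x - r)\<close> limits the
  slope. If \<open>0 \<le> w x < M * r\<close>, the mean value theorem gives
  \<open>M \<le> 2 * s\<close>, which bounds \<open>w x\<close> in turn.\<close>

lemma slope_bound:
  assumes o: "oscillator \<rho>0 \<rho>1 p v w" and x: "r \<le> x" "x \<le> 1" "0 < r" "r \<le> 1 / 4"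
    and pos: "\<And>t. t \<in> {x-r..x} \<Longrightarrow> 0 < v t" and s: "v x < s"
  shows "w x \<le> s / r + 2 * s"
proof -
  have c: "continuous_on {x-r..x} v" by (rule osc_continuous[OF o]) (use x in auto)
  obtain ts where ts: "ts \<in> {x-r..x}" "\<And>t. t \<in> {x-r..x} \<Longrightarrow> v t \<le> v ts"
    using continuous_attains_sup[OF compact_Icc _ c] x by force
  define M where "M = v ts"
  have s0: "0 < s" using pos[of x] s x by auto
  have M0: "0 < M" using pos ts by (simp add: M_def)
  have up: "w x - w t \<le> S * (x - t)" if "t \<in> {x-r..x}" "\<And>t. t \<in> {x-r..x} \<Longrightarrow> v t \<le> S" for t S
    by (rule oscD(2)[OF o]) (use that x pos in \<open>auto simp: less_imp_le\<close>)
  have der: "(v has_real_derivative w t) (at t)" if "t \<in> {x-r..x}" for t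
    using oscD(1)[OF o, of t] that x by auto
  have low: "(x - t) * (w x - S * r) \<le> v x - v t" if t: "t \<in> {x-r..x}" and S: "\<And>t. t \<in> {x-r..x} \<Longrightarrow> v t \<le> S" "0 \<le> S" for t S
  proof (cases "t = x")
    case False
    then obtain \<xi> where \<xi>: "t < \<xi>" "\<xi> < x" "v x - v t = (x - t) * w \<xi>"
      using MVT2[of t x v w] der t by force
    have "S * (x - \<xi>) \<le> S * r" using \<xi> t S by (intro mult_left_mono) auto
    then have "w x - S * r \<le> w \<xi>" using up[of \<xi> S] \<xi> t S by auto
    then show ?thesis using \<xi> t by (simp add: mult_left_mono)
  qed simp
  show ?thesis
  proof (cases "M * r \<le> w x")
    case True
    have "0 \<le> (x - ts) * (w x - M * r)" using True ts by simp
    then have "M \<le> s" using low[of ts M] ts M0 s by (auto simp: M_def)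
    then have "(x - (x - r)) * (w x - s * r) \<le> v x - v (x - r)"
      using ts s0 x by (intro low) (auto simp: M_def intro: order_trans)
    then have "r * (w x - s * r) < s" using pos[of "x - r"] s x by auto
    then have "w x - s * r < s / r" using x by (simp add: field_simps)
    moreover have "s * r \<le> s" using s0 x by (intro mult_left_le) auto
    ultimately show ?thesis using s0 by linarith
  next
    case False
    have "M - s \<le> (x - ts) * (M * r - w x)"
      using low[of ts M] ts M0 s by (auto simp: M_def algebra_simps)
    show ?thesis
    proof (cases "0 \<le> w x")
      case True
      have "(x - ts) * (M * r - w x) \<le> (1/4) * (M * r)"
        using False True ts x M0 by (intro mult_mono) auto
      moreover have "M * r \<le> M * (1/4)" using x M0 by (intro mult_left_mono) auto
      ultimately have "M \<le> 2 * s" using \<open>M - s \<le> (x - ts) * (M * r - w x)\<close> M0 s0 by linarith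
      moreover have "M * r \<le> M" using x M0 by (intro mult_left_le) auto
      moreover have "0 < s / r" using s0 x by simp
      ultimately show ?thesis using False by linarith
    next
      case f: False
      have "0 < s / r" using s0 x by simp
      then show ?thesis using f s0 by linarith
    qed
  qed
qed

text \<open>If \<open>v\<close> were at least \<open>s\<close> on the middle half, it could be
  followed from the midpoint in the direction in which it does not increase, and
  \<open>no_large_decreasing\<close> with \<open>r = d / 8\<close> would give a contradiction; this
  is the origin of \<open>64 / d^2\<close>. So \<open>v x < s\<close> for some \<open>x\<close> with
  distance at least \<open>d / 4\<close> from both ends, and \<open>slope_bound\<close>, applied in
  both directions, controls \<open>w x\<close>.\<close>

lemma start_pos:
  assumes o: "oscillator \<rho>0 \<rho>1 p v w" and a: "0 \<le> a" "a + d \<le> 1" "0 < d"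
    and pos: "\<And>t. t \<in> {a..a+d} \<Longrightarrow> 0 < v t"
    and s: "0 < s" "1 + 64 / d\<^sup>2 \<le> \<rho>0 * s powr (p - 2)"
  shows "\<exists>x\<in>{a..a+d}. \<bar>v x\<bar> \<le> 4 * s / d + 2 * s \<and> \<bar>w x\<bar> \<le> 4 * s / d + 2 * s"
proof -
  have d1: "d \<le> 1" using a by simp
  have eq: "1 / (d / 8)\<^sup>2 = 64 / d\<^sup>2" by (simp add: power2_eq_square field_simps)
  have "\<exists>x\<in>{a+d/4..a+3*d/4}. v x < s"
  proof (rule ccontr)
    assume "\<not> ?thesis"
    then have ge: "\<And>t. t \<in> {a+d/4..a+3*d/4} \<Longrightarrow> s \<le> v t" by force
    show False
    proof (cases "w (a + d/2) \<le> 0")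
      case True
      show False
        by (rule no_large_decreasing[OF o, of "a + d/2" "d/8" s]) (use True a s ge eq in auto)
    next
      case False
      show False
        by (rule no_large_decreasing[OF osc_reflect[OF o], of "1 - (a + d/2)" "d/8" s]) (use False a s ge eq in auto)
    qed
  qed
  then obtain x where x: "x \<in> {a+d/4..a+3*d/4}" "v x < s" by blast
  have w1: "w x \<le> s / (d/4) + 2 * s"
    by (rule slope_bound[OF o]) (use x a d1 pos in auto)
  have "- w (1 - (1 - x)) \<le> s / (d/4) + 2 * s"
    by (rule slope_bound[OF osc_reflect[OF o], of "d/4" "1 - x"]) (use x a d1 pos in auto)
  then have w2: "- w x \<le> s / (d/4) + 2 * s" by simp
  have xa: "x \<in> {a..a+d}" using x a by auto
  have "0 \<le> 4 * s / d" using s a by simp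
  then have "\<bar>v x\<bar> \<le> 4 * s / d + 2 * s" using x(2) pos[OF xa] s by linarith
  moreover have eq: "s / (d/4) = 4 * s / d" by simp
  ultimately show ?thesis using w1[unfolded eq] w2[unfolded eq] xa
    by (intro bexI[of _ x] conjI) (auto simp: abs_le_iff)
qed

text \<open>The interval is cut into \<open>k + 1\<close> cells. If \<open>v\<close> has no zero on
  the first half of some cell, \<open>start_pos\<close> applies there. Otherwise each of these
  halves contains a zero, and consecutive zeros bound \<open>k\<close> nodal intervals, unless
  \<open>v\<close> vanishes identically between two of them; then \<open>v\<close> and
  \<open>w\<close> are both 0 at the midpoint.\<close>

lemma start:
  assumes s: "0 < s" "1 + 64 * (2 * real (Suc k))\<^sup>2 \<le> \<rho>0 * s powr (p - 2)" and o: "oscillator \<rho>0 \<rho>1 p v w"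
  shows "(\<exists>x\<in>{0..1}. \<bar>v x\<bar> \<le> 8 * s * real (Suc k) + 2 * s \<and> \<bar>w x\<bar> \<le> 8 * s * real (Suc k) + 2 * s) \<or> nodal_intervals v 0 1 k"
proof -
  define N where "N = real (Suc k)"
  have N: "0 < N" "1 \<le> N" by (auto simp: N_def)
  \<comment> \<open>Half of a cell: the gaps between the chosen halves make the zeros picked in
    different cells distinct and ordered.\<close>
  define d where "d = 1 / (2 * N)"
  have d: "0 < d" using N by (simp add: d_def)
  have cell: "real j / N + d < real (Suc j) / N" for j
  proof -
    have "1 / (2 * N) < 1 / N" by (rule divide_strict_left_mono) (use N in auto)
    then show ?thesis by (simp add: d_def add_divide_distrib)
  qed
  show ?thesis
  proof (cases "\<exists>j\<le>k. \<forall>t\<in>{real j / N..real j / N + d}. v t \<noteq> 0")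
    case True
    then obtain j where j: "j \<le> k" "\<And>t. t \<in> {real j / N..real j / N + d} \<Longrightarrow> v t \<noteq> 0" by blast
    define a where "a = real j / N"
    have "real (Suc j) / N \<le> 1" using j N by (simp add: N_def)
    then have a: "0 \<le> a" "a + d \<le> 1" using N cell[of j] unfolding a_def by (simp, linarith)
    have c: "continuous_on {a..a+d} v" by (rule osc_continuous[OF o]) (use a in auto)
    have s2: "1 + 64 / d\<^sup>2 \<le> \<rho>0 * s powr (p - 2)"
    proof -
      have "64 / d\<^sup>2 = 64 * (2 * N)\<^sup>2" by (simp add: d_def power2_eq_square)
      then show ?thesis using s(2) by (simp only: N_def)
    qed
    have eq: "4 * s / d + 2 * s = 8 * s * N + 2 * s" using N by (simp add: d_def)
    have "\<exists>x\<in>{a..a+d}. \<bar>v x\<bar> \<le> 4 * s / d + 2 * s \<and> \<bar>w x\<bar> \<le> 4 * s / d + 2 * s"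
    proof -
      from sign_constant[OF c _ j(2)[folded a_def]]
      consider "\<forall>t\<in>{a..a+d}. 0 < v t" | "\<forall>t\<in>{a..a+d}. v t < 0" by (auto simp: is_interval_1)
      then show ?thesis
      proof cases
        case 1
        then show ?thesis using start_pos[OF o a d _ s(1) s2] by blast
      next
        case 2
        then show ?thesis using start_pos[OF osc_minus[OF o] a d _ s(1) s2] by auto
      qed
    qed
    then show ?thesis using a unfolding eq N_def by fastforce
  next
    case False
    then have "\<forall>j\<le>k. \<exists>t. t \<in> {real j / N..real j / N + d} \<and> v t = 0" by blast
    then obtain z where z: "\<And>j. j \<le> k \<Longrightarrow> z j \<in> {real j / N..real j / N + d} \<and> v (z j) = 0" by metis
    have zlt: "z i < z j" if "i < j" "j \<le> k" for i j
    proof -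
      have "z i \<le> real i / N + d" using z[of i] that by auto
      also have "\<dots> < real (Suc i) / N" by (rule cell)
      also have "\<dots> \<le> real j / N" using that N by (intro divide_right_mono) auto
      also have "\<dots> \<le> z j" using z[of j] that by auto
      finally show ?thesis .
    qed
    have z01: "0 \<le> z j" "z j \<le> 1" if "j \<le> k" for j
    proof -
      have "0 \<le> real j / N" using N by simp
      then show "0 \<le> z j" using z[OF that] by auto
      have "real (Suc j) / N \<le> 1" using that N by (simp add: N_def)
      then show "z j \<le> 1" using z[OF that] cell[of j] by auto
    qed
    show ?thesis
    proof (cases "\<forall>i<k. \<exists>t\<in>{z i<..<z (Suc i)}. v t \<noteq> 0")
      case True
      have "nodal_intervals v 0 1 k"
      proof -
        have le: "z a \<le> z b" if "a \<le> b" "b \<le> k" for a b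
          using zlt[of a b] that by (cases "a = b") auto
        have 1: "0 \<le> z i \<and> z i < z (Suc i) \<and> z (Suc i) \<le> 1 \<and> v (z i) = 0 \<and> v (z (Suc i)) = 0
            \<and> (\<exists>t\<in>{z i<..<z (Suc i)}. v t \<noteq> 0)" if i: "i < k" for i
          using i True z[of i] z[of "Suc i"] z01(1)[of i] z01(2)[of "Suc i"] zlt[of i "Suc i"] by simp
        have 2: "z (Suc i) \<le> z j \<or> z (Suc j) \<le> z i" if "i < k" "j < k" "i \<noteq> j" for i j
          using le[of "Suc i" j] le[of "Suc j" i] that by linarith
        show ?thesis unfolding nodal_intervals_def
          by (rule exI[of _ z], rule exI[of _ "\<lambda>i. z (Suc i)"]) (use 1 2 in blast)
      qed
      then show ?thesis ..
    next
      case False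
      then obtain i where i: "i < k" "\<And>t. t \<in> {z i<..<z (Suc i)} \<Longrightarrow> v t = 0" by blast
      have lt: "z i < z (Suc i)" using zlt[of i "Suc i"] i by auto
      define m where "m = (z i + z (Suc i)) / 2"
      have m: "m \<in> {z i<..<z (Suc i)}" using lt by (auto simp: m_def)
      have m01: "m \<in> {0..1}" using m z01(1)[of i] z01(2)[of "Suc i"] i by auto
      have "(v has_real_derivative 0) (at m)"
        by (rule has_field_derivative_transform_within_open[of "\<lambda>x. 0" _ _ "{z i<..<z (Suc i)}"]) (use m i in auto)
      then have "w m = 0" using oscD(1)[OF o m01] DERIV_unique by blast
      then have "\<bar>v m\<bar> \<le> 8 * s * real (Suc k) + 2 * s \<and> \<bar>w m\<bar> \<le> 8 * s * real (Suc k) + 2 * s"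
        using i(2)[OF m] s(1) by (simp del: of_nat_Suc)
      then show ?thesis using m01 by blast
    qed
  qed
qed

lemma oscillator_bound:
  "\<exists>C\<ge>0. \<forall>v w. oscillator \<rho>0 \<rho>1 p v w \<longrightarrow> (\<forall>t\<in>{0..1}. \<bar>v t\<bar> \<le> C) \<or> nodal_intervals v 0 1 k"
proof -
  \<comment> \<open>\<open>s\<close> is the value for which the threshold on
    \<open>\<rho>0 * s powr (p - 2)\<close> in \<open>start\<close> holds with equality.\<close>
  define T where "T = (1 + 64 * (2 * real (Suc k))\<^sup>2) / \<rho>0"
  have T: "0 < T" using \<rho> by (auto simp: T_def intro!: divide_pos_pos add_pos_nonneg)
  define s where "s = T powr (1 / (p - 2))"
  have s: "0 < s" "1 + 64 * (2 * real (Suc k))\<^sup>2 \<le> \<rho>0 * s powr (p - 2)"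
  proof -
    show "0 < s" using T by (simp add: s_def)
    have "s powr (p - 2) = T" using T p by (simp add: s_def powr_powr)
    then show "1 + 64 * (2 * real (Suc k))\<^sup>2 \<le> \<rho>0 * s powr (p - 2)" using \<rho> by (simp add: T_def)
  qed
  define K where "K = 8 * s * real (Suc k) + 2 * s"
  have K: "0 \<le> K" using s by (simp add: K_def)
  define C where "C = (growth ^^ Suc k) (growth K)"
  have C: "0 \<le> C" unfolding C_def using growth_pow_nonneg(1)[OF growth_ge(2)[OF K]] .
  show ?thesis
  proof (intro exI[of _ C] conjI C allI impI)
    fix v w assume o: "oscillator \<rho>0 \<rho>1 p v w"
    show "(\<forall>t\<in>{0..1}. \<bar>v t\<bar> \<le> C) \<or> nodal_intervals v 0 1 k"
    proof (cases "nodal_intervals v 0 1 k")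
      case False
      then obtain x where x: "x \<in> {0..1}" "\<bar>v x\<bar> \<le> K" "\<bar>w x\<bar> \<le> K"
        using start[OF s o] unfolding K_def by blast
      have "\<bar>v t\<bar> \<le> C" if t: "t \<in> {0..1}" for t
      proof (cases "x \<le> t")
        case True
        then show ?thesis using propagate[OF o _ x(2,3) True, of k] False x t by (auto simp: C_def)
      next
        case f: False
        have "\<bar>v (1 - (1 - t))\<bar> \<le> (growth ^^ Suc k) (growth K) \<or> nodal_intervals (\<lambda>t. v (1 - t)) 0 1 k"
          by (rule propagate[OF osc_reflect[OF o], of "1 - x" K "1 - t"]) (use x t f in auto)
        then show ?thesis using nodal_intervals_reflect[of v k] False by (auto simp: C_def)
      qed
      then show ?thesis by blast
    qed auto
  qed
qed

end

section \<open>Lower bounds for the Morse index\<close>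

text \<open>Neighbouring nodal intervals may share an end, where the derivatives on both sides are
  typically nonzero. Setting them to 0 there makes the products vanish at every point, as
  \<open>morse_index_lower\<close> asks.\<close>

lemma piecewise_test_drop_ends:
  assumes "piecewise_test a b \<phi> \<psi>"
  shows "piecewise_test a b \<phi> (\<lambda>x. if x \<in> {a<..<b} then \<psi> x else 0)"
proof -
  obtain S where S: "finite S" "\<forall>x. x \<notin> S \<longrightarrow> (\<phi> has_real_derivative \<psi> x) (at x)"
    using assms unfolding piecewise_test_def by blast
  have zero: "\<psi> x = 0" if "x \<notin> {a..b}" for x using assms that by (simp add: piecewise_test_def)
  have "(\<phi> has_real_derivative (if x \<in> {a<..<b} then \<psi> x else 0)) (at x)" if "x \<notin> S \<union> {a, b}" for x
    using S(2)[rule_format, of x] zero[of x] that by (cases "x \<in> {a<..<b}") auto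
  then have ex: "\<exists>S. finite S \<and> (\<forall>x. x \<notin> S \<longrightarrow> (\<phi> has_real_derivative (if x \<in> {a<..<b} then \<psi> x else 0)) (at x))"
    using S(1) by (intro exI[of _ "S \<union> {a, b}"]) blast
  obtain M where M: "\<And>x. \<bar>\<psi> x\<bar> \<le> M" using assms unfolding piecewise_test_def bounded_iff by auto
  have "norm (if x \<in> {a<..<b} then \<psi> x else 0) \<le> M" for x
    using M[of x] order_trans[OF abs_ge_zero M[of x]] by simp
  then have bd: "bounded (range (\<lambda>x. if x \<in> {a<..<b} then \<psi> x else 0))" unfolding bounded_iff by blast
  have m: "(\<lambda>x. if x \<in> {a<..<b} then \<psi> x else 0) \<in> borel_measurable borel"
    using assms unfolding piecewise_test_def by (intro measurable_If) auto
  show ?thesis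
    using assms ex bd m unfolding piecewise_test_def by simp
qed

lemma piecewise_test_times:
  assumes 1: "piecewise_test a b \<phi>1 \<psi>1" and 2: "piecewise_test a b \<phi>2 \<psi>2"
  shows "piecewise_test a b (\<lambda>x. \<phi>1 x * \<phi>2 x) (\<lambda>x. \<psi>1 x * \<phi>2 x + \<phi>1 x * \<psi>2 x)"
proof -
  obtain S where S: "finite S" "\<forall>x. x \<notin> S \<longrightarrow> (\<phi>1 has_real_derivative \<psi>1 x) (at x)"
    using 1 unfolding piecewise_test_def by blast
  obtain T where T: "finite T" "\<forall>x. x \<notin> T \<longrightarrow> (\<phi>2 has_real_derivative \<psi>2 x) (at x)"
    using 2 unfolding piecewise_test_def by blast
  have "((\<lambda>x. \<phi>1 x * \<phi>2 x) has_real_derivative \<psi>1 x * \<phi>2 x + \<phi>1 x * \<psi>2 x) (at x)" if "x \<notin> S \<union> T" for x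
  proof -
    have "(\<phi>1 has_real_derivative \<psi>1 x) (at x)" "(\<phi>2 has_real_derivative \<psi>2 x) (at x)"
      using S(2) T(2) that by auto
    from DERIV_mult[OF this] show ?thesis by (simp add: mult.commute)
  qed
  then have ex: "\<exists>S. finite S \<and> (\<forall>x. x \<notin> S \<longrightarrow> ((\<lambda>x. \<phi>1 x * \<phi>2 x) has_real_derivative \<psi>1 x * \<phi>2 x + \<phi>1 x * \<psi>2 x) (at x))"
    using S(1) T(1) by (intro exI[of _ "S \<union> T"]) blast
  obtain M1 where M1: "\<And>x. \<bar>\<psi>1 x\<bar> \<le> M1" using 1 unfolding piecewise_test_def bounded_iff by auto
  obtain M2 where M2: "\<And>x. \<bar>\<psi>2 x\<bar> \<le> M2" using 2 unfolding piecewise_test_def bounded_iff by auto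
  have c: "continuous_on UNIV \<phi>1" "continuous_on UNIV \<phi>2" using 1 2 by (simp_all add: piecewise_test_def)
  obtain N1 where N1: "\<And>x. x \<in> {a..b} \<Longrightarrow> \<bar>\<phi>1 x\<bar> \<le> N1"
    using continuous_bounded_on_interval[OF continuous_on_subset[OF c(1) subset_UNIV]] by blast
  obtain N2 where N2: "\<And>x. x \<in> {a..b} \<Longrightarrow> \<bar>\<phi>2 x\<bar> \<le> N2"
    using continuous_bounded_on_interval[OF continuous_on_subset[OF c(2) subset_UNIV]] by blast
  have "norm (\<psi>1 x * \<phi>2 x + \<phi>1 x * \<psi>2 x) \<le> \<bar>M1 * N2\<bar> + \<bar>N1 * M2\<bar>" for x
  proof (cases "x \<in> {a..b}")
    case True
    have "\<bar>\<psi>1 x * \<phi>2 x\<bar> \<le> M1 * N2" "\<bar>\<phi>1 x * \<psi>2 x\<bar> \<le> N1 * M2"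
      unfolding abs_mult using M1[of x] M2[of x] N1[OF True] N2[OF True] by (auto intro!: mult_mono)
    then show ?thesis unfolding real_norm_def by linarith
  next
    case False
    then have "\<phi>1 x = 0" "\<phi>2 x = 0" using 1 2 by (simp_all add: piecewise_test_def)
    then show ?thesis by simp
  qed
  then have bd: "bounded (range (\<lambda>x. \<psi>1 x * \<phi>2 x + \<phi>1 x * \<psi>2 x))" unfolding bounded_iff by blast
  have m: "(\<lambda>x. \<psi>1 x * \<phi>2 x + \<phi>1 x * \<psi>2 x) \<in> borel_measurable borel"
    using 1 2 c by (intro borel_measurable_add borel_measurable_times) (auto simp: piecewise_test_def intro: borel_measurable_continuous_onI)
  have co: "continuous_on UNIV (\<lambda>x. \<phi>1 x * \<phi>2 x)" using c by (rule continuous_on_mult)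
  have z: "\<forall>x. x \<notin> {a..b} \<longrightarrow> \<phi>1 x * \<phi>2 x = 0 \<and> \<psi>1 x * \<phi>2 x + \<phi>1 x * \<psi>2 x = 0"
    using 1 2 by (simp add: piecewise_test_def)
  show ?thesis
    unfolding piecewise_test_def using co m bd ex z by blast
qed

lemma sum_square_disjoint:
  fixes f :: "'i \<Rightarrow> real"
  assumes "finite A" "\<And>i j. i \<in> A \<Longrightarrow> j \<in> A \<Longrightarrow> i \<noteq> j \<Longrightarrow> f i * f j = 0"
  shows "(\<Sum>i\<in>A. f i)\<^sup>2 = (\<Sum>i\<in>A. (f i)\<^sup>2)"
proof -
  have "(\<Sum>i\<in>A. f i)\<^sup>2 = (\<Sum>i\<in>A. \<Sum>j\<in>A. f i * f j)"
    by (simp add: power2_eq_square sum_product)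
  also have "\<dots> = (\<Sum>i\<in>A. \<Sum>j\<in>A. if i = j then (f i)\<^sup>2 else 0)"
    using assms(2) by (intro sum.cong refl) (auto simp: power2_eq_square)
  also have "\<dots> = (\<Sum>i\<in>A. (f i)\<^sup>2)" using assms(1) by simp
  finally show ?thesis .
qed

lemma sum_fun_apply: "(\<Sum>i\<in>A. f i) x = (\<Sum>i\<in>A. f i x)"
  by (induction A rule: infinite_finite_induct) auto

context nls_graph
begin

text \<open>The zeroth-order coefficient of the linearisation at \<open>u\<close>: the Hessian at a
  bump is \<open>\<integral>\<phi>'^2 + potential * \<phi>^2\<close>.\<close>

definition potential :: "real \<Rightarrow> (('v, 'e) gpoint \<Rightarrow> real) \<Rightarrow> 'e \<Rightarrow> real \<Rightarrow> real" where
  "potential \<Lambda> u e x = on_edge G W e x + \<Lambda> - (p - 1) * on_edge G \<rho> e x * \<bar>on_edge G u e x\<bar> powr (p - 2)"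

lemma potential_measurable:
  assumes "u \<in> H1_graph G" "e \<in> edges G"
  shows "potential \<Lambda> u e \<in> borel_measurable (lebesgue_on (interval_of G e))"
proof -
  note [measurable] = W_meas[OF assms(2)] \<rho>_meas[OF assms(2)]
  have [measurable]: "on_edge G u e \<in> borel_measurable (lebesgue_on (interval_of G e))"
    using assms by (auto simp: H1_graph_def H1_fun_def L2_fun_def)
  show ?thesis unfolding potential_def[abs_def] by measurable
qed

lemma on_edge_bounded:
  assumes "u \<in> H1_graph G" "e \<in> edges G" "{a..b} \<subseteq> interval_of G e"
  obtains U where "\<And>x. x \<in> {a..b} \<Longrightarrow> \<bar>on_edge G u e x\<bar> \<le> U"
  using continuous_bounded_on_interval[OF continuous_on_subset[OF on_edge_continuous[OF assms(1,2)] assms(3)]] by blast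

lemma AE_sub:
  assumes "e \<in> edges G" "{a..b} \<subseteq> interval_of G e" "AE x in lebesgue_on (interval_of G e). P x"
  shows "AE x in lebesgue_on {a..b}. P x"
  by (rule AE_lebesgue_on_mono[OF assms(3,2)]) (auto simp: interval_of_facts(2)[OF fin assms(1)])

lemma AE_in_interval: "AE x in lebesgue_on {a..b}. x \<in> {a..b::real}"
  by (simp add: AE_lebesgue_on_iff)

lemma potential_bounded:
  assumes u: "u \<in> H1_graph G" and e: "e \<in> edges G" and ab: "{a..b} \<subseteq> interval_of G e"
  obtains M where "AE x in lebesgue_on {a..b}. \<bar>potential \<Lambda> u e x\<bar> \<le> M"
proof -
  obtain U where U: "\<And>x. x \<in> {a..b} \<Longrightarrow> \<bar>on_edge G u e x\<bar> \<le> U"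
    using on_edge_bounded[OF u e ab] by blast
  have "AE x in lebesgue_on {a..b}. \<bar>potential \<Lambda> u e x\<bar> \<le> B + \<bar>\<Lambda>\<bar> + (p - 1) * B * U powr (p - 2)"
    using AE_in_interval AE_sub[OF e ab W_bound[OF e]] AE_sub[OF e ab \<rho>_bound[OF e]]
  proof eventually_elim
    case (elim x)
    have "\<bar>(p - 1) * on_edge G \<rho> e x * \<bar>on_edge G u e x\<bar> powr (p - 2)\<bar> \<le> (p - 1) * B * U powr (p - 2)"
      unfolding abs_mult using elim B p U[OF elim(1)] by (intro mult_mono) (auto intro!: powr_mono2)
    then show ?case using elim(2) unfolding potential_def by linarith
  qed
  then show ?thesis using that by blast
qed

lemma potential_form_integrable:
  assumes u: "u \<in> H1_graph G" and e: "e \<in> edges G" and ab: "{a..b} \<subseteq> interval_of G e"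
    and pt: "piecewise_test a b \<phi> \<psi>"
  shows "integrable (lebesgue_on {a..b}) (\<lambda>x. (\<psi> x)\<^sup>2)" "integrable (lebesgue_on {a..b}) (\<lambda>x. potential \<Lambda> u e x * (\<phi> x)\<^sup>2)"
proof -
  obtain M where M: "\<And>x. \<bar>\<psi> x\<bar> \<le> M" using pt unfolding piecewise_test_def bounded_iff by auto
  have "integrable (lebesgue_on {a..b}) (\<lambda>x. \<psi> x * \<psi> x)"
    by (rule piecewise_test_integrable(1)[OF pt piecewise_test_measurable(2)[OF pt], where B = M]) (simp add: M)
  then show "integrable (lebesgue_on {a..b}) (\<lambda>x. (\<psi> x)\<^sup>2)" by (simp add: power2_eq_square)
  obtain V where V: "AE x in lebesgue_on {a..b}. \<bar>potential \<Lambda> u e x\<bar> \<le> V"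
    using potential_bounded[OF u e ab] by blast
  have "continuous_on {a..b} \<phi>" using pt continuous_on_subset[of UNIV \<phi>] by (simp add: piecewise_test_def)
  then obtain N where N: "\<And>x. x \<in> {a..b} \<Longrightarrow> \<bar>\<phi> x\<bar> \<le> N" using continuous_bounded_on_interval by blast
  have pm: "potential \<Lambda> u e \<in> borel_measurable (lebesgue_on {a..b})"
    by (rule measurable_on_subinterval[OF e ab potential_measurable[OF u e]])
  have "AE x in lebesgue_on {a..b}. \<bar>potential \<Lambda> u e x * \<phi> x\<bar> \<le> V * N"
    using V AE_in_interval by eventually_elim (unfold abs_mult, intro mult_mono N, auto)
  then have "integrable (lebesgue_on {a..b}) (\<lambda>x. (potential \<Lambda> u e x * \<phi> x) * \<phi> x)"
    by (intro piecewise_test_integrable(2)[OF pt] borel_measurable_times pm piecewise_test_measurable[OF pt]) auto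
  then show "integrable (lebesgue_on {a..b}) (\<lambda>x. potential \<Lambda> u e x * (\<phi> x)\<^sup>2)"
    by (simp add: power2_eq_square mult.assoc)
qed

lemma action_hessian_bump:
  assumes u: "u \<in> H1_graph G" and e: "e \<in> edges G"
    and pt: "piecewise_test a b \<phi> \<psi>" and ab: "a \<le> b" "{a..b} \<subseteq> open_edge G e"
  shows "action_hessian G p W \<rho> \<Lambda> u (edge_bump e \<phi>) = (LINT x|lebesgue_on {a..b}. (\<psi> x)\<^sup>2 + potential \<Lambda> u e x * (\<phi> x)\<^sup>2)"
proof -
  let ?I = "interval_of G e"
  have abI: "{a..b} \<subseteq> ?I" using ab(2) interval_of_facts(4)[OF fin e] by blast
  have zero: "\<And>x. x \<notin> {a..b} \<Longrightarrow> \<phi> x = 0" "\<And>x. x \<notin> {a..b} \<Longrightarrow> \<psi> x = 0"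
    using pt by (auto simp: piecewise_test_def)
  note oe = on_edge_bump[OF pt ab(2)]
  note gd = gderiv_edge_bump[OF fin e pt ab]
  note bump = edge_bump_in_spaces[OF fin e pt ab]
  have finE: "finite (edges G)" using fin by (simp add: fin_metric_graph_def)
  note [measurable] = potential_measurable[OF u e] piecewise_test_measurable[OF pt] W_meas[OF e] \<rho>_meas[OF e]
  have [measurable]: "gderiv G (edge_bump e \<phi>) e \<in> borel_measurable (lebesgue_on ?I)"
    using gderiv_L2[OF bump(1) e] by (auto simp: L2_fun_def)
  have [measurable]: "on_edge G u e \<in> borel_measurable (lebesgue_on ?I)"
    using u e by (auto simp: H1_graph_def H1_fun_def L2_fun_def)
  have "action_hessian G p W \<rho> \<Lambda> u (edge_bump e \<phi>) = (LINT x|lebesgue_on ?I. (gderiv G (edge_bump e \<phi>) e x)\<^sup>2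
       + (on_edge G W e x + \<Lambda>) * (on_edge G (edge_bump e \<phi>) e x)\<^sup>2
       - (p - 1) * on_edge G \<rho> e x * \<bar>on_edge G u e x\<bar> powr (p - 2) * (on_edge G (edge_bump e \<phi>) e x)\<^sup>2)"
    unfolding action_hessian_def
  proof (rule graph_integral_single[OF finE e])
    fix e' assume e': "e' \<in> edges G" "e' \<noteq> e"
    show "AE x in lebesgue_on (interval_of G e'). (gderiv G (edge_bump e \<phi>) e' x)\<^sup>2
       + (on_edge G W e' x + \<Lambda>) * (on_edge G (edge_bump e \<phi>) e' x)\<^sup>2
       - (p - 1) * on_edge G \<rho> e' x * \<bar>on_edge G u e' x\<bar> powr (p - 2) * (on_edge G (edge_bump e \<phi>) e' x)\<^sup>2 = 0"
      using gd[OF e'(1)] by eventually_elim (simp add: oe e'(2))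
  qed
  also have "\<dots> = (LINT x|lebesgue_on ?I. (\<psi> x)\<^sup>2 + potential \<Lambda> u e x * (\<phi> x)\<^sup>2)"
  proof (rule integral_cong_AE)
    show "AE x in lebesgue_on ?I. (gderiv G (edge_bump e \<phi>) e x)\<^sup>2
       + (on_edge G W e x + \<Lambda>) * (on_edge G (edge_bump e \<phi>) e x)\<^sup>2
       - (p - 1) * on_edge G \<rho> e x * \<bar>on_edge G u e x\<bar> powr (p - 2) * (on_edge G (edge_bump e \<phi>) e x)\<^sup>2
       = (\<psi> x)\<^sup>2 + potential \<Lambda> u e x * (\<phi> x)\<^sup>2"
      using gd[OF e] by eventually_elim (simp add: oe potential_def algebra_simps)
  qed (simp_all add: oe)
  also have "\<dots> = (LINT x|lebesgue_on {a..b}. (\<psi> x)\<^sup>2 + potential \<Lambda> u e x * (\<phi> x)\<^sup>2)"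
    by (rule integral_lebesgue_on_support[OF abI interval_of_facts(2)[OF fin e]]) (simp add: zero)
  finally show ?thesis .
qed

text \<open>Disjointness makes the Hessian diagonal on the span of the bumps, hence negative
  definite there. Negativity also excludes \<open>\<phi> i = 0\<close>; evaluating at a point where
  \<open>\<phi> i\<close> is nonzero, and all other bumps therefore vanish, gives linear
  independence.\<close>

lemma morse_index_lower:
  assumes u: "u \<in> H1_graph G" and e: "e \<in> edges G" and ab: "a \<le> b" "{a..b} \<subseteq> open_edge G e"
    and pt: "\<And>i. i < k \<Longrightarrow> piecewise_test a b (\<phi> i) (\<psi> i)"
    and disj: "\<And>i j x. i < k \<Longrightarrow> j < k \<Longrightarrow> i \<noteq> j \<Longrightarrow> \<phi> i x * \<phi> j x = 0"
      "\<And>i j x. i < k \<Longrightarrow> j < k \<Longrightarrow> i \<noteq> j \<Longrightarrow> \<psi> i x * \<psi> j x = 0"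
    and neg: "\<And>i. i < k \<Longrightarrow> (LINT x|lebesgue_on {a..b}. (\<psi> i x)\<^sup>2 + potential \<Lambda> u e x * (\<phi> i x)\<^sup>2) < 0"
  shows "enat k \<le> morse_index G p W \<rho> \<Lambda> u"
proof -
  have abI: "{a..b} \<subseteq> interval_of G e" using ab(2) interval_of_facts(4)[OF fin e] by blast
  define \<Phi> where "\<Phi> i = (edge_bump e (\<phi> i) :: ('v, 'e) gpoint \<Rightarrow> real)" for i
  define Q where "Q i = (LINT x|lebesgue_on {a..b}. (\<psi> i x)\<^sup>2 + potential \<Lambda> u e x * (\<phi> i x)\<^sup>2)" for i
  have "\<exists>x. \<phi> i x \<noteq> 0" if "i < k" for i
  proof (rule ccontr)
    assume "\<not> ?thesis"
    then have "0 \<le> (LINT x|lebesgue_on {a..b}. (\<psi> i x)\<^sup>2 + potential \<Lambda> u e x * (\<phi> i x)\<^sup>2)"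
      by (intro integral_nonneg_AE) simp
    then show False using neg[OF that] by simp
  qed
  then obtain t where t: "\<And>i. i < k \<Longrightarrow> \<phi> i (t i) \<noteq> 0" by metis
  have t0: "\<phi> j (t i) = 0" if "i < k" "j < k" "i \<noteq> j" for i j
    using disj(1)[OF that, of "t i"] t[OF that(1)] by simp
  have \<Phi>t: "\<Phi> j (Inner e x) = \<phi> j x" for j x by (simp add: \<Phi>_def edge_bump_def)
  have inj: "inj_on \<Phi> {..<k}"
  proof (rule inj_onI)
    fix i j assume ij: "i \<in> {..<k}" "j \<in> {..<k}" "\<Phi> i = \<Phi> j"
    then have "\<phi> i (t i) = \<phi> j (t i)" by (metis \<Phi>t)
    then show "i = j" using t[of i] t0[of i j] ij by auto
  qed
  define X where "X = fun_vs.span (\<Phi> ` {..<k})"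
  have elem: "\<exists>c. x = (\<Sum>i<k. (\<lambda>y. c i * \<Phi> i y))" if x: "x \<in> X" for x
  proof -
    have "fun_vs.span (\<Phi> ` {..<k}) = range (\<lambda>d. \<Sum>v\<in>\<Phi> ` {..<k}. (\<lambda>y. d v * v y))"
      by (rule fun_vs.span_finite) simp
    then obtain d where "x = (\<Sum>v\<in>\<Phi> ` {..<k}. (\<lambda>y. d v * v y))"
      using x unfolding X_def by auto
    also have "\<dots> = (\<Sum>i<k. (\<lambda>y. d (\<Phi> i) * \<Phi> i y))"
      by (simp add: sum.reindex[OF inj])
    finally show ?thesis by (rule exI[of _ "\<lambda>i. d (\<Phi> i)"])
  qed
  have indep: "fun_vs.independent (\<Phi> ` {..<k})"
  proof (rule fun_vs.independent_if_scalars_zero)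
    show "finite (\<Phi> ` {..<k})" by simp
    fix d :: "(('v, 'e) gpoint \<Rightarrow> real) \<Rightarrow> real" and v
    assume s: "(\<Sum>x\<in>\<Phi> ` {..<k}. (\<lambda>y. d x * x y)) = 0" and v: "v \<in> \<Phi> ` {..<k}"
    then obtain i where i: "i < k" "v = \<Phi> i" by auto
    have "0 = (\<Sum>x\<in>\<Phi> ` {..<k}. (\<lambda>y. d x * x y)) (Inner e (t i))" using s by simp
    also have "\<dots> = (\<Sum>j<k. d (\<Phi> j) * \<phi> j (t i))"
      by (simp add: sum_fun_apply sum.reindex[OF inj] \<Phi>t)
    also have "\<dots> = (\<Sum>j<k. if j = i then d (\<Phi> i) * \<phi> i (t i) else 0)"
      using t0[OF i(1)] by (intro sum.cong refl) auto
    also have "\<dots> = d (\<Phi> i) * \<phi> i (t i)" using i by simp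
    finally show "d v = 0" using t[OF i(1)] i by simp
  qed
  have "fun_vs.dim X = k"
    unfolding X_def using fun_vs.dim_span_eq_card_independent[OF indep] card_image[OF inj] by simp
  \<comment> \<open>This selects the finite branch of \<open>edim\<close>.\<close>
  moreover have "\<exists>B. finite B \<and> X \<subseteq> fun_vs.span B" unfolding X_def by blast
  ultimately have "edim X = enat k" unfolding edim_def by (simp only: if_True)
  moreover have "fun_vs.subspace X" unfolding X_def by (rule fun_vs.subspace_span)
  moreover have rep: "(\<Sum>i<k. (\<lambda>y. c i * \<Phi> i y)) = edge_bump e (\<lambda>x. \<Sum>i<k. c i * \<phi> i x)" for c
  proof
    fix y :: "('v, 'e) gpoint"
    show "(\<Sum>i<k. (\<lambda>y. c i * \<Phi> i y)) y = edge_bump e (\<lambda>x. \<Sum>i<k. c i * \<phi> i x) y"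
      by (cases y) (auto simp: sum_fun_apply \<Phi>_def edge_bump_def)
  qed
  have ptc: "piecewise_test a b (\<lambda>x. \<Sum>i<k. c i * \<phi> i x) (\<lambda>x. \<Sum>i<k. c i * \<psi> i x)" for c
    using pt by (intro piecewise_test_sum piecewise_test_scale) auto
  have "X \<subseteq> H1_graph G \<inter> Cc_graph G"
  proof
    fix x assume "x \<in> X"
    from elem[OF this] obtain c where c: "x = (\<Sum>i<k. (\<lambda>y. c i * \<Phi> i y))" by (rule exE)
    show "x \<in> H1_graph G \<inter> Cc_graph G" unfolding c rep using edge_bump_in_spaces[OF fin e ptc ab] by simp
  qed
  moreover have "action_hessian G p W \<rho> \<Lambda> u x < 0" if x: "x \<in> X - {0}" for x
  proof -
    have "x \<in> X" using x by simp
    from elem[OF this] obtain c where c: "x = (\<Sum>i<k. (\<lambda>y. c i * \<Phi> i y))" by (rule exE)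
    have "\<exists>i<k. c i \<noteq> 0"
    proof (rule ccontr)
      assume "\<not> ?thesis"
      then have "x = (\<Sum>i<k. (0 :: ('v, 'e) gpoint \<Rightarrow> real))" unfolding c by (intro sum.cong) (auto simp: fun_eq_iff)
      then show False using x by simp
    qed
    then obtain i where i: "i < k" "c i \<noteq> 0" by blast
    have pf: "integrable (lebesgue_on {a..b}) (\<lambda>x. (\<psi> i x)\<^sup>2 + potential \<Lambda> u e x * (\<phi> i x)\<^sup>2)" if "i < k" for i
      using potential_form_integrable[OF u e abI pt[OF that]] by simp
    have "action_hessian G p W \<rho> \<Lambda> u x = (LINT x|lebesgue_on {a..b}. (\<Sum>i<k. c i * \<psi> i x)\<^sup>2 + potential \<Lambda> u e x * (\<Sum>i<k. c i * \<phi> i x)\<^sup>2)"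
      unfolding c rep by (rule action_hessian_bump[OF u e ptc ab])
    also have "(\<lambda>x. (\<Sum>i<k. c i * \<psi> i x)\<^sup>2 + potential \<Lambda> u e x * (\<Sum>i<k. c i * \<phi> i x)\<^sup>2)
      = (\<lambda>x. \<Sum>i<k. (c i)\<^sup>2 * ((\<psi> i x)\<^sup>2 + potential \<Lambda> u e x * (\<phi> i x)\<^sup>2))"
    proof
      fix x
      have z: "c i * \<psi> i x * (c j * \<psi> j x) = 0" "c i * \<phi> i x * (c j * \<phi> j x) = 0"
        if "i < k" "j < k" "i \<noteq> j" for i j
        using disj(1)[OF that, of x] disj(2)[OF that, of x] by auto
      have "(\<Sum>i<k. c i * \<psi> i x)\<^sup>2 = (\<Sum>i<k. (c i * \<psi> i x)\<^sup>2)" "(\<Sum>i<k. c i * \<phi> i x)\<^sup>2 = (\<Sum>i<k. (c i * \<phi> i x)\<^sup>2)"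
        using z by (intro sum_square_disjoint; simp)+
      then show "(\<Sum>i<k. c i * \<psi> i x)\<^sup>2 + potential \<Lambda> u e x * (\<Sum>i<k. c i * \<phi> i x)\<^sup>2
        = (\<Sum>i<k. (c i)\<^sup>2 * ((\<psi> i x)\<^sup>2 + potential \<Lambda> u e x * (\<phi> i x)\<^sup>2))"
        by (simp add: sum.distrib sum_distrib_left algebra_simps power_mult_distrib)
    qed
    also have "(LINT x|lebesgue_on {a..b}. (\<Sum>i<k. (c i)\<^sup>2 * ((\<psi> i x)\<^sup>2 + potential \<Lambda> u e x * (\<phi> i x)\<^sup>2))) = (\<Sum>i<k. (c i)\<^sup>2 * Q i)"
      unfolding Q_def using pf by (subst Bochner_Integration.integral_sum) (auto simp del: integrable_add)
    also have "\<dots> < (\<Sum>i<k. 0)"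
    proof (rule sum_strict_mono_ex1)
      show "\<forall>i\<in>{..<k}. (c i)\<^sup>2 * Q i \<le> 0" unfolding Q_def by (intro ballI mult_nonneg_nonpos less_imp_le[OF neg]) auto
      show "\<exists>i\<in>{..<k}. (c i)\<^sup>2 * Q i < 0" using i neg[OF i(1)] by (intro bexI[of _ i]) (auto simp: Q_def intro!: mult_pos_neg)
    qed simp
    finally show ?thesis by simp
  qed
  ultimately show ?thesis
    unfolding morse_index_def by (intro Sup_upper CollectI exI[of _ X]) simp
qed


lemma continuous_integral_pos:
  fixes h :: "real \<Rightarrow> real"
  assumes h: "continuous_on {a..b} h" "\<And>x. x \<in> {a..b} \<Longrightarrow> 0 \<le> h x" and t: "t \<in> {a<..<b}" "h t \<noteq> 0"
  shows "0 < (LINT x|lebesgue_on {a..b}. h x)"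
proof -
  have i: "integrable (lebesgue_on {a..b}) h" by (rule continuous_imp_integrable_real[OF h(1)])
  have hi: "(h has_integral (LINT x|lebesgue_on {a..b}. h x)) {a..b}"
    using lebesgue_integral_eq_integral[OF i] integrable_on_lebesgue_on[OF i] by (simp add: has_integral_iff)
  have "0 \<le> (LINT x|lebesgue_on {a..b}. h x)"
    by (rule has_integral_nonneg[OF hi h(2)])
  moreover have "(LINT x|lebesgue_on {a..b}. h x) \<noteq> 0"
  proof
    assume "(LINT x|lebesgue_on {a..b}. h x) = 0"
    then have "(h has_integral 0) (cbox a b)" using hi by simp
    then have "h t = 0"
      by (rule has_integral_0_cbox_imp_0[rotated 2]) (use h t in auto)
    then show False using t by simp
  qed
  ultimately show ?thesis by simp
qed

text \<open>On a nodal interval the weak equation, tested with the solution itself, turns the Hessian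
  into \<open>-(p - 2) \<integral>\<rho>|u|\<^sup>p\<close>.\<close>

lemma nodal_hessian_negative:
  assumes s: "solves G p W \<rho> \<Lambda> u" and e: "e \<in> bounded_edges G"
    and z: "z < z'" "{z..z'} \<subseteq> open_edge G e" "on_edge G u e z = 0" "on_edge G u e z' = 0"
    and t: "t \<in> {z<..<z'}" "on_edge G u e t \<noteq> 0"
  defines "\<phi> \<equiv> \<lambda>x. if x \<in> {z..z'} then on_edge G u e x else 0"
    and "\<psi> \<equiv> \<lambda>x. if x \<in> {z<..<z'} then dedge u e x else 0"
  shows "piecewise_test z z' \<phi> \<psi>"
    "(LINT x|lebesgue_on {z..z'}. (\<psi> x)\<^sup>2 + potential \<Lambda> u e x * (\<phi> x)\<^sup>2) < 0"
proof -
  have eE: "e \<in> edges G" using e by (simp add: bounded_edges_def)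
  have u: "u \<in> H1_graph G" using s by (simp add: solves_def)
  have zI: "{z..z'} \<subseteq> interval_of G e" using z(2) interval_of_facts(4)[OF fin eE] by blast
  have "piecewise_test z z' \<phi> (\<lambda>x. if x \<in> {z..z'} then dedge u e x else 0)"
    unfolding \<phi>_def
    by (rule piecewise_test_nodal[OF z(1) solution_has_derivative[OF s eE] dedge_continuous[OF s eE z(2)] z(3,4)])
      (use z(2) in blast)
  from piecewise_test_drop_ends[OF this]
  have "piecewise_test z z' \<phi> (\<lambda>x. if x \<in> {z<..<z'} then (if x \<in> {z..z'} then dedge u e x else 0) else 0)" .
  moreover have "(\<lambda>x. if x \<in> {z<..<z'} then (if x \<in> {z..z'} then dedge u e x else 0) else 0) = \<psi>"
    by (auto simp: \<psi>_def)
  ultimately show pt: "piecewise_test z z' \<phi> \<psi>" by simp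
  note we = weak_equation_dedge[OF s eE pt less_imp_le[OF z(1)] z(2)]
  note pf = potential_form_integrable[OF u eE zI pt]
  define h where "h x = \<bar>on_edge G u e x\<bar> powr (p - 2) * (on_edge G u e x)\<^sup>2" for x
  have hc: "continuous_on {z..z'} h"
    unfolding h_def using continuous_on_subset[OF on_edge_continuous[OF u eE] zI] p
    by (intro continuous_on_mult continuous_on_powr' continuous_intros) auto
  have hpos: "0 < (LINT x|lebesgue_on {z..z'}. h x)"
    by (rule continuous_integral_pos[OF hc _ t(1)]) (use t in \<open>auto simp: h_def\<close>)
  have hi: "integrable (lebesgue_on {z..z'}) h" by (rule continuous_imp_integrable_real[OF hc])
  have "(LINT x|lebesgue_on {z..z'}. (\<psi> x)\<^sup>2) = (LINT x|lebesgue_on {z..z'}. dedge u e x * \<psi> x)"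
  proof (rule integral_cong_AE)
    have "negligible {z, z'}" by simp
    then have "AE x in lebesgue. x \<notin> {z, z'}" using AE_not_in negligible_iff_null_sets by blast
    then show "AE x in lebesgue_on {z..z'}. (\<psi> x)\<^sup>2 = dedge u e x * \<psi> x"
      unfolding AE_lebesgue_on_iff[OF lmeasurable_interval(1)[THEN fmeasurableD]]
      by eventually_elim (auto simp: \<psi>_def power2_eq_square)
  qed (use pf we in auto)
  then have "(LINT x|lebesgue_on {z..z'}. (\<psi> x)\<^sup>2 + potential \<Lambda> u e x * (\<phi> x)\<^sup>2)
    = (LINT x|lebesgue_on {z..z'}. potential \<Lambda> u e x * (\<phi> x)\<^sup>2 - source \<Lambda> u e x * \<phi> x)"
    using we pf by simp
  also have "\<dots> \<le> (LINT x|lebesgue_on {z..z'}. - ((p - 2) * \<rho>0) * h x)"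
  proof (rule integral_mono_AE)
    show "integrable (lebesgue_on {z..z'}) (\<lambda>x. potential \<Lambda> u e x * (\<phi> x)\<^sup>2 - source \<Lambda> u e x * \<phi> x)"
      using we pf by simp
    show "integrable (lebesgue_on {z..z'}) (\<lambda>x. - ((p - 2) * \<rho>0) * h x)" using hi by simp
    show "AE x in lebesgue_on {z..z'}. potential \<Lambda> u e x * (\<phi> x)\<^sup>2 - source \<Lambda> u e x * \<phi> x \<le> - ((p - 2) * \<rho>0) * h x"
      using AE_in_interval AE_sub[OF eE zI \<rho>_lower[OF e]]
    proof eventually_elim
      case (elim x)
      have "potential \<Lambda> u e x * (\<phi> x)\<^sup>2 - source \<Lambda> u e x * \<phi> x = - ((p - 2) * on_edge G \<rho> e x) * h x"
        using elim(1) by (simp add: \<phi>_def potential_def source_def h_def power2_eq_square algebra_simps)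
      moreover have "(p - 2) * \<rho>0 * h x \<le> (p - 2) * on_edge G \<rho> e x * h x"
        using elim(2) p by (intro mult_right_mono mult_left_mono) (auto simp: h_def)
      ultimately show ?case by simp
    qed
  qed
  also have "\<dots> = - ((p - 2) * \<rho>0 * (LINT x|lebesgue_on {z..z'}. h x))" by simp
  also have "\<dots> < 0" using hpos p \<rho>0 by simp
  finally show "(LINT x|lebesgue_on {z..z'}. (\<psi> x)\<^sup>2 + potential \<Lambda> u e x * (\<phi> x)\<^sup>2) < 0" .
qed

lemma nodal_intervals_morse_index:
  assumes s: "solves G p W \<rho> \<Lambda> u" and e: "e \<in> bounded_edges G" and ab: "a \<le> b" "{a..b} \<subseteq> open_edge G e"
    and n: "nodal_intervals (on_edge G u e) a b k"
  shows "enat k \<le> morse_index G p W \<rho> \<Lambda> u"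
proof -
  obtain z z' where z: "\<And>i. i < k \<Longrightarrow> a \<le> z i \<and> z i < z' i \<and> z' i \<le> b \<and> on_edge G u e (z i) = 0 \<and> on_edge G u e (z' i) = 0
      \<and> (\<exists>t\<in>{z i<..<z' i}. on_edge G u e t \<noteq> 0)"
    and d: "\<And>i j. i < k \<Longrightarrow> j < k \<Longrightarrow> i \<noteq> j \<Longrightarrow> z' i \<le> z j \<or> z' j \<le> z i"
    using n unfolding nodal_intervals_def by blast
  define \<phi> where "\<phi> i x = (if x \<in> {z i..z' i} then on_edge G u e x else 0)" for i x
  define \<psi> where "\<psi> i x = (if x \<in> {z i<..<z' i} then dedge u e x else 0)" for i x
  have eE: "e \<in> edges G" using e by (simp add: bounded_edges_def)
  have u: "u \<in> H1_graph G" using s by (simp add: solves_def)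
  have nh: "piecewise_test (z i) (z' i) (\<phi> i) (\<psi> i)"
    "(LINT x|lebesgue_on {z i..z' i}. (\<psi> i x)\<^sup>2 + potential \<Lambda> u e x * (\<phi> i x)\<^sup>2) < 0" if i: "i < k" for i
  proof -
    obtain t where t: "t \<in> {z i<..<z' i}" "on_edge G u e t \<noteq> 0" using z[OF i] by blast
    have "{z i..z' i} \<subseteq> {a..b}" using z[OF i] by auto
    then have sub: "{z i..z' i} \<subseteq> open_edge G e" using ab(2) by blast
    have zz: "z i < z' i" "on_edge G u e (z i) = 0" "on_edge G u e (z' i) = 0" using z[OF i] by auto
    show "piecewise_test (z i) (z' i) (\<phi> i) (\<psi> i)"
      "(LINT x|lebesgue_on {z i..z' i}. (\<psi> i x)\<^sup>2 + potential \<Lambda> u e x * (\<phi> i x)\<^sup>2) < 0"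
      using nodal_hessian_negative[OF s e zz(1) sub zz(2,3) t] unfolding \<phi>_def[abs_def] \<psi>_def[abs_def] by auto
  qed
  show ?thesis
  proof (rule morse_index_lower[OF u eE ab])
    fix i assume i: "i < k"
    show "piecewise_test a b (\<phi> i) (\<psi> i)" by (rule piecewise_test_mono[OF nh(1)[OF i]]) (use z[OF i] in auto)
    have "(LINT x|lebesgue_on {a..b}. (\<psi> i x)\<^sup>2 + potential \<Lambda> u e x * (\<phi> i x)\<^sup>2) =
      (LINT x|lebesgue_on {z i..z' i}. (\<psi> i x)\<^sup>2 + potential \<Lambda> u e x * (\<phi> i x)\<^sup>2)"
      by (rule integral_lebesgue_on_support) (use z[OF i] in \<open>auto simp: \<phi>_def \<psi>_def\<close>)
    then show "(LINT x|lebesgue_on {a..b}. (\<psi> i x)\<^sup>2 + potential \<Lambda> u e x * (\<phi> i x)\<^sup>2) < 0"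
      using nh(2)[OF i] by simp
    fix j x assume j: "j < k" "i \<noteq> j"
    show "\<phi> i x * \<phi> j x = 0"
    proof (cases "x \<in> {z i..z' i} \<and> x \<in> {z j..z' j}")
      case True
      \<comment> \<open>Two intervals can meet only in a common end, where \<open>u\<close>
        vanishes. The derivatives need no such argument because \<open>\<psi>\<close> is supported
        in the open intervals.\<close>
      then have "x = z i \<or> x = z' i" using d[OF i j] by auto
      then show ?thesis using z[OF i] by (auto simp: \<phi>_def)
    qed (auto simp: \<phi>_def)
    show "\<psi> i x * \<psi> j x = 0" using d[OF i j] by (auto simp: \<psi>_def)
  qed
qed

text \<open>With \<open>X = \<integral>u\<^sup>2\<eta>'\<^sup>2\<close>, \<open>Y = \<integral>\<rho>|u|\<^sup>p\<eta>\<^sup>2\<close> and \<open>Z = \<integral>(W + \<Lambda>)u\<^sup>2\<eta>\<^sup>2\<close>, testing the equation with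
  \<open>u\<eta>\<^sup>2\<close> gives \<open>\<integral>(u\<eta>)'\<^sup>2 = X - Z + Y\<close>, so the Hessian at \<open>u\<eta>\<close> is \<open>X - (p - 2) Y\<close>.\<close>

lemma cutoff_estimate:
  assumes s: "solves G p W \<rho> \<Lambda> u" and e: "e \<in> edges G" and ab: "a \<le> b" "{a..b} \<subseteq> open_edge G e"
    and eta: "piecewise_test a b \<eta> \<eta>'" and \<Lambda>: "2 * B \<le> \<Lambda>"
  defines "\<psi> \<equiv> \<lambda>x. if x \<in> {a..b} then dedge u e x * \<eta> x + on_edge G u e x * \<eta>' x else 0"
  shows "piecewise_test a b (\<lambda>x. on_edge G u e x * \<eta> x) \<psi>"
    "0 \<le> (LINT x|lebesgue_on {a..b}. (\<psi> x)\<^sup>2 + potential \<Lambda> u e x * (on_edge G u e x * \<eta> x)\<^sup>2) \<Longrightarrow>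
     \<Lambda> / 2 * (LINT x|lebesgue_on {a..b}. (on_edge G u e x * \<eta> x)\<^sup>2)
      \<le> (p - 1) / (p - 2) * (LINT x|lebesgue_on {a..b}. (on_edge G u e x * \<eta>' x)\<^sup>2)"
proof -
  have u: "u \<in> H1_graph G" using s by (simp add: solves_def)
  have abI: "{a..b} \<subseteq> interval_of G e" using ab(2) interval_of_facts(4)[OF fin e] by blast
  let ?v = "on_edge G u e"
  show pt: "piecewise_test a b (\<lambda>x. ?v x * \<eta> x) \<psi>"
    unfolding \<psi>_def
    by (rule piecewise_test_mult[OF eta solution_has_derivative[OF s e] dedge_continuous[OF s e ab(2)]]) (use ab(2) in blast)
  note pt2 = piecewise_test_times[OF pt eta]
  note we = weak_equation_dedge[OF s e pt2 ab]
  note pf = potential_form_integrable[OF u e abI pt]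
  have vc: "continuous_on {a..b} ?v" by (rule continuous_on_subset[OF on_edge_continuous[OF u e] abI])
  have ec: "continuous_on {a..b} \<eta>" using eta continuous_on_subset[of UNIV \<eta>] by (simp add: piecewise_test_def)
  obtain U where U: "\<And>x. x \<in> {a..b} \<Longrightarrow> \<bar>?v x\<bar> \<le> U" using on_edge_bounded[OF u e abI] by blast
  obtain E where E: "\<And>x. \<bar>\<eta>' x\<bar> \<le> E" using eta unfolding piecewise_test_def bounded_iff by auto
  have vm: "?v \<in> borel_measurable (lebesgue_on {a..b})" by (rule continuous_on_measurable_bounded(1)[OF vc])
  have Xi: "integrable (lebesgue_on {a..b}) (\<lambda>x. (?v x * \<eta>' x)\<^sup>2)"
  proof (rule integrable_lebesgue_on_bounded)
    show "(\<lambda>x. (?v x * \<eta>' x)\<^sup>2) \<in> borel_measurable (lebesgue_on {a..b})"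
      using vm piecewise_test_measurable[OF eta] by measurable
    show "AE x in lebesgue_on {a..b}. \<bar>(?v x * \<eta>' x)\<^sup>2\<bar> \<le> (U * E)\<^sup>2"
      using AE_in_interval
    proof eventually_elim
      case (elim x)
      have "\<bar>?v x * \<eta>' x\<bar> \<le> U * E" unfolding abs_mult using U[OF elim] E[of x] by (intro mult_mono) auto
      then have "(?v x * \<eta>' x)\<^sup>2 \<le> (U * E)\<^sup>2" by (metis abs_ge_zero power2_abs power_mono)
      then show ?case by simp
    qed
  qed
  define h where "h x = (?v x * \<eta> x)\<^sup>2" for x
  define k where "k x = on_edge G \<rho> e x * \<bar>?v x\<bar> powr (p - 2) * h x" for x
  have hc: "continuous_on {a..b} h" unfolding h_def using vc ec by (intro continuous_intros)
  have hi: "integrable (lebesgue_on {a..b}) h" by (rule continuous_imp_integrable_real[OF hc])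
  have h0: "0 \<le> h x" for x by (simp add: h_def)
  have ki: "integrable (lebesgue_on {a..b}) k"
  proof -
    have "integrable (lebesgue_on {a..b}) (\<lambda>x. h x * (on_edge G \<rho> e x * \<bar>?v x\<bar> powr (p - 2)))"
    proof (rule integrable_mult_bounded[OF hi])
      show "(\<lambda>x. on_edge G \<rho> e x * \<bar>?v x\<bar> powr (p - 2)) \<in> borel_measurable (lebesgue_on {a..b})"
        using vm measurable_on_subinterval[OF e abI \<rho>_meas[OF e]] by measurable
      show "AE x in lebesgue_on {a..b}. \<bar>on_edge G \<rho> e x * \<bar>?v x\<bar> powr (p - 2)\<bar> \<le> B * U powr (p - 2)"
        using AE_in_interval AE_sub[OF e abI \<rho>_bound[OF e]]
      proof eventually_elim
        case (elim x)
        show ?case unfolding abs_mult using elim B p U[OF elim(1)] by (intro mult_mono) (auto intro!: powr_mono2)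
      qed
    qed
    then show ?thesis by (simp add: k_def[abs_def] mult.commute)
  qed
  define X Y Z where "X = (LINT x|lebesgue_on {a..b}. (?v x * \<eta>' x)\<^sup>2)"
    and "Y = (LINT x|lebesgue_on {a..b}. k x)" and "Z = (LINT x|lebesgue_on {a..b}. (on_edge G W e x + \<Lambda>) * h x)"
  have pk: "potential \<Lambda> u e x * (?v x * \<eta> x)\<^sup>2 = (on_edge G W e x + \<Lambda>) * h x - (p - 1) * k x" for x
    by (simp add: potential_def h_def k_def algebra_simps)
  have zi: "integrable (lebesgue_on {a..b}) (\<lambda>x. (on_edge G W e x + \<Lambda>) * h x)"
  proof -
    have "integrable (lebesgue_on {a..b}) (\<lambda>x. potential \<Lambda> u e x * (?v x * \<eta> x)\<^sup>2 + (p - 1) * k x)"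
      using pf(2) ki by simp
    then show ?thesis by (simp add: pk)
  qed
  have sk: "source \<Lambda> u e x * (?v x * \<eta> x * \<eta> x) = (on_edge G W e x + \<Lambda>) * h x - k x" for x
    by (simp add: source_def h_def k_def power2_eq_square algebra_simps)
  \<comment> \<open>The identity
    \<open>u' (u \<eta>^2)' = ((u \<eta>)')^2 - (u \<eta>')^2\<close>.\<close>
  have dk: "dedge u e x * (\<psi> x * \<eta> x + ?v x * \<eta> x * \<eta>' x) = (\<psi> x)\<^sup>2 - (?v x * \<eta>' x)\<^sup>2" if "x \<in> {a..b}" for x
    using that by (simp add: \<psi>_def power2_eq_square algebra_simps)
  have "(LINT x|lebesgue_on {a..b}. dedge u e x * (\<psi> x * \<eta> x + ?v x * \<eta> x * \<eta>' x))
    = (LINT x|lebesgue_on {a..b}. (\<psi> x)\<^sup>2 - (?v x * \<eta>' x)\<^sup>2)"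
    by (rule Bochner_Integration.integral_cong) (auto simp: dk simp del: atLeastAtMost_iff)
  then have main: "(LINT x|lebesgue_on {a..b}. (\<psi> x)\<^sup>2) - X = - (Z - Y)"
    using we(1) unfolding sk X_def Y_def Z_def using pf(1) Xi zi ki by simp
  have Q: "(LINT x|lebesgue_on {a..b}. (\<psi> x)\<^sup>2 + potential \<Lambda> u e x * (?v x * \<eta> x)\<^sup>2)
    = (LINT x|lebesgue_on {a..b}. (\<psi> x)\<^sup>2) + (Z - (p - 1) * Y)"
    unfolding pk Y_def Z_def using pf(1) zi ki by simp
  have psi0: "0 \<le> (LINT x|lebesgue_on {a..b}. (\<psi> x)\<^sup>2)" by simp
  \<comment> \<open>Here \<open>2 * B \<le> \<Lambda>\<close> enters: it gives
    \<open>W + \<Lambda> \<ge> \<Lambda> / 2\<close>.\<close>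
  have Zlow: "\<Lambda> / 2 * (LINT x|lebesgue_on {a..b}. h x) \<le> Z"
  proof -
    have "(LINT x|lebesgue_on {a..b}. \<Lambda> / 2 * h x) \<le> Z"
      unfolding Z_def
    proof (rule integral_mono_AE)
      show "AE x in lebesgue_on {a..b}. \<Lambda> / 2 * h x \<le> (on_edge G W e x + \<Lambda>) * h x"
        using AE_sub[OF e abI W_bound[OF e]]
      proof eventually_elim
        case (elim x)
        then have "\<Lambda> / 2 \<le> on_edge G W e x + \<Lambda>" using \<Lambda> by linarith
        then show ?case using h0[of x] by (rule mult_right_mono)
      qed
    qed (use hi zi in auto)
    then show ?thesis by simp
  qed
  assume nn: "0 \<le> (LINT x|lebesgue_on {a..b}. (\<psi> x)\<^sup>2 + potential \<Lambda> u e x * (?v x * \<eta> x)\<^sup>2)"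
  \<comment> \<open>By \<open>main\<close> the Hessian equals \<open>X - (p - 2) * Y\<close>. Once
    \<open>Y\<close> is bounded by a multiple of \<open>X\<close>, dropping the square integral of
    \<open>\<psi>\<close> in \<open>main\<close> leaves \<open>Z \<le> X + Y\<close>.\<close>
  have "(p - 2) * Y \<le> X" using nn main unfolding Q by (simp add: algebra_simps)
  then have "Y \<le> X / (p - 2)" using p by (simp add: pos_le_divide_eq mult.commute)
  then have "Z \<le> X + X / (p - 2)" using main psi0 by linarith
  also have "\<dots> = (p - 1) / (p - 2) * X" using p by (simp add: field_simps)
  finally show "\<Lambda> / 2 * (LINT x|lebesgue_on {a..b}. (?v x * \<eta> x)\<^sup>2) \<le> (p - 1) / (p - 2) * (LINT x|lebesgue_on {a..b}. (?v x * \<eta>' x)\<^sup>2)"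
    using Zlow unfolding h_def X_def by linarith
qed

end

section \<open>The supremum bound on bounded edges\<close>

lemma integral_le_const:
  fixes f :: "real \<Rightarrow> real"
  assumes "integrable (lebesgue_on {x..y}) f" "AE t in lebesgue_on {x..y}. f t \<le> K" "x \<le> y"
  shows "integral {x..y} f \<le> K * (y - x)"
proof -
  have "(LINT t|lebesgue_on {x..y}. f t) \<le> (LINT t|lebesgue_on {x..y}. K)"
    using assms by (intro integral_mono_AE) auto
  also have "\<dots> = K * (y - x)"
    using assms(3) by (simp add: measure_restrict_space)
  finally show ?thesis using assms(1) by (simp add: lebesgue_integral_eq_integral)
qed

lemma nodal_intervals_scale:
  assumes "nodal_intervals (\<lambda>t. \<kappa> * f (\<alpha> + r * t)) 0 1 k" "0 < \<kappa>" "0 < r"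
  shows "nodal_intervals f \<alpha> (\<alpha> + r) k"
proof -
  obtain z z' where z: "\<And>i. i < k \<Longrightarrow> 0 \<le> z i \<and> z i < z' i \<and> z' i \<le> 1 \<and> \<kappa> * f (\<alpha> + r * z i) = 0 \<and> \<kappa> * f (\<alpha> + r * z' i) = 0
      \<and> (\<exists>t\<in>{z i<..<z' i}. \<kappa> * f (\<alpha> + r * t) \<noteq> 0)"
    and d: "\<And>i j. i < k \<Longrightarrow> j < k \<Longrightarrow> i \<noteq> j \<Longrightarrow> z' i \<le> z j \<or> z' j \<le> z i"
    using assms(1) unfolding nodal_intervals_def by blast
  have 1: "\<alpha> \<le> \<alpha> + r * z i \<and> \<alpha> + r * z i < \<alpha> + r * z' i \<and> \<alpha> + r * z' i \<le> \<alpha> + r \<and> f (\<alpha> + r * z i) = 0 \<and> f (\<alpha> + r * z' i) = 0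
      \<and> (\<exists>t\<in>{\<alpha> + r * z i<..<\<alpha> + r * z' i}. f t \<noteq> 0)" if i: "i < k" for i
  proof -
    obtain t where t: "t \<in> {z i<..<z' i}" "\<kappa> * f (\<alpha> + r * t) \<noteq> 0" using z[OF i] by blast
    then have "\<exists>t\<in>{\<alpha> + r * z i<..<\<alpha> + r * z' i}. f t \<noteq> 0"
      using assms(3) by (intro bexI[of _ "\<alpha> + r * t"]) auto
    then show ?thesis using z[OF i] assms(2,3) by (simp del: greaterThanLessThan_iff add: mult_left_le)
  qed
  have 2: "\<alpha> + r * z' i \<le> \<alpha> + r * z j \<or> \<alpha> + r * z' j \<le> \<alpha> + r * z i" if "i < k" "j < k" "i \<noteq> j" for i j
    using d[OF that] assms(3) by auto
  show ?thesis unfolding nodal_intervals_def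
    by (rule exI[of _ "\<lambda>i. \<alpha> + r * z i"], rule exI[of _ "\<lambda>i. \<alpha> + r * z' i"]) (use 1 2 in blast)
qed

section \<open>Rescaled windows on a bounded edge\<close>

context nls_graph
begin

lemma dedge_diff_le:
  assumes s: "solves G p W \<rho> \<Lambda> u" and e: "e \<in> edges G" and xy: "x \<le> y" "{x..y} \<subseteq> open_edge G e"
    and K: "AE t in lebesgue_on {x..y}. \<sigma> * source \<Lambda> u e t \<le> K"
  shows "\<sigma> * (dedge u e y - dedge u e x) \<le> K * (y - x)"
proof -
  have u: "u \<in> H1_graph G" using s by (simp add: solves_def)
  have I: "{x..y} \<subseteq> interval_of G e" using xy(2) interval_of_facts(4)[OF fin e] by blast
  have "integrable (lebesgue_on {x..y}) (\<lambda>t. \<sigma> * source \<Lambda> u e t)"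
    using source_integrable[OF u e I] by simp
  from integral_le_const[OF this K xy(1)]
  have "\<sigma> * integral {x..y} (source \<Lambda> u e) \<le> K * (y - x)" by simp
  moreover have "x \<in> open_edge G e" "y \<in> open_edge G e" using xy by auto
  ultimately show ?thesis using solution_derivative_diff[OF s e xy(1)] by simp
qed

text \<open>The scaling \<open>\<kappa>\<^sup>p\<^sup>-\<^sup>2 = r\<^sup>2\<close> leaves the nonlinear term unchanged.\<close>

lemma oscillator_rescaled:
  assumes s: "solves G p W \<rho> \<Lambda> u" and e: "e \<in> bounded_edges G" and \<Lambda>: "0 \<le> \<Lambda>"
    and r: "0 < r" "{\<alpha>..\<alpha>+r} \<subseteq> open_edge G e" "(B + \<Lambda>) * r\<^sup>2 \<le> 1"
    and \<kappa>: "0 < \<kappa>" "\<kappa> powr (p - 2) = r\<^sup>2"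
  shows "oscillator \<rho>0 B p (\<lambda>t. \<kappa> * on_edge G u e (\<alpha> + r * t)) (\<lambda>t. \<kappa> * r * dedge u e (\<alpha> + r * t))"
proof -
  have eE: "e \<in> edges G" using e by (simp add: bounded_edges_def)
  let ?v = "on_edge G u e"
  have A: "0 < B + \<Lambda>" using B \<Lambda> by simp
  have sub: "{\<alpha> + r * x..\<alpha> + r * y} \<subseteq> open_edge G e" if "0 \<le> x" "y \<le> 1" for x y
  proof -
    have "r * x \<ge> 0" "r * y \<le> r" using that r by (auto simp: mult_left_le)
    then have "{\<alpha> + r * x..\<alpha> + r * y} \<subseteq> {\<alpha>..\<alpha>+r}" by auto
    then show ?thesis using r(2) by blast
  qed
  have subI: "{\<alpha> + r * x..\<alpha> + r * y} \<subseteq> interval_of G e" if "0 \<le> x" "y \<le> 1" for x y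
    using sub[OF that] interval_of_facts(4)[OF fin eE] by blast
  have ae: "AE t in lebesgue_on {\<alpha> + r * x..\<alpha> + r * y}. t \<in> {\<alpha> + r * x..\<alpha> + r * y} \<and> (\<bar>on_edge G W e t\<bar> \<le> B
      \<and> (\<bar>on_edge G \<rho> e t\<bar> \<le> B \<and> \<rho>0 \<le> on_edge G \<rho> e t))" if "0 \<le> x" "y \<le> 1" for x y
    by (intro AE_conjI AE_in_interval AE_sub[OF eE subI[OF that]] W_bound[OF eE] \<rho>_bound[OF eE] \<rho>_lower[OF e])
  have unscale: "P t" if "t \<in> {\<alpha> + r * x..\<alpha> + r * y}" "\<forall>t\<in>{x..y}. P (\<alpha> + r * t)" for P t x y
  proof -
    have "(t - \<alpha>) / r \<in> {x..y}" using that(1) r by (auto simp: field_simps)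
    then have "P (\<alpha> + r * ((t - \<alpha>) / r))" using that(2) by blast
    then show ?thesis using r by simp
  qed
  \<comment> \<open>The rescaled derivative carries the factor \<open>\<kappa> * r\<close>, and the
    original interval has length \<open>r * (y - x)\<close>; together they give
    \<open>\<kappa> * r^2\<close>.\<close>
  have scaled: "\<sigma> * (\<kappa> * r * dedge u e (\<alpha> + r * y) - \<kappa> * r * dedge u e (\<alpha> + r * x)) \<le> \<kappa> * r\<^sup>2 * K * (y - x)"
    if xy: "0 \<le> x" "x \<le> y" "y \<le> 1" and K: "AE t in lebesgue_on {\<alpha> + r * x..\<alpha> + r * y}. \<sigma> * source \<Lambda> u e t \<le> K" for x y \<sigma> K
  proof -
    have "\<sigma> * (dedge u e (\<alpha> + r * y) - dedge u e (\<alpha> + r * x)) \<le> K * (\<alpha> + r * y - (\<alpha> + r * x))"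
      by (rule dedge_diff_le[OF s eE _ sub[OF xy(1,3)] K]) (use xy r in auto)
    then have "\<kappa> * r * (\<sigma> * (dedge u e (\<alpha> + r * y) - dedge u e (\<alpha> + r * x))) \<le> \<kappa> * r * (K * (\<alpha> + r * y - (\<alpha> + r * x)))"
      using \<kappa> r by (intro mult_left_mono) auto
    then show ?thesis by (simp add: algebra_simps power2_eq_square)
  qed
  have src: "\<sigma> * source \<Lambda> u e t = (on_edge G W e t + \<Lambda>) * (\<sigma> * ?v t) - on_edge G \<rho> e t * \<bar>?v t\<bar> powr (p - 2) * (\<sigma> * ?v t)" for \<sigma> t
    by (simp add: source_def algebra_simps)
  have absv: "\<bar>?v t\<bar> = \<sigma> * ?v t" if "\<sigma> \<in> {-1,1}" "0 \<le> \<sigma> * ?v t" for \<sigma> t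
    using that by auto
  have div_\<kappa>: "0 \<le> \<kappa> * X \<and> \<kappa> * X \<le> S \<Longrightarrow> 0 \<le> X \<and> X \<le> S / \<kappa>" "S \<le> \<kappa> * X \<Longrightarrow> S / \<kappa> \<le> X" for X S
    using \<kappa>(1) by (auto simp: zero_le_mult_iff pos_le_divide_eq pos_divide_le_eq mult.commute)
  show ?thesis
    unfolding oscillator_def
  proof (intro conjI ballI allI impI)
    fix t :: real assume t: "t \<in> {0..1}"
    have "\<alpha> + r * t \<in> {\<alpha> + r * t..\<alpha> + r * t}" by simp
    then have "\<alpha> + r * t \<in> open_edge G e" using sub[of t t] t by (meson atLeastAtMost_iff subsetD)
    from solution_has_derivative[OF s eE this]
    have d: "(?v has_real_derivative dedge u e (\<alpha> + r * t)) (at (\<alpha> + r * t))" .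
    have "((\<lambda>t. \<alpha> + r * t) has_real_derivative r) (at t)" by (auto intro!: derivative_eq_intros)
    from DERIV_cmult[OF DERIV_chain2[OF d this], of \<kappa>]
    show "((\<lambda>t. \<kappa> * ?v (\<alpha> + r * t)) has_real_derivative \<kappa> * r * dedge u e (\<alpha> + r * t)) (at t)"
      by (simp add: mult_ac)
  next
    fix \<sigma> x y S :: real assume \<sigma>: "\<sigma> \<in> {-1,1}"
      and h: "0 \<le> x \<and> x \<le> y \<and> y \<le> 1 \<and> (\<forall>t\<in>{x..y}. 0 \<le> \<sigma> * (\<kappa> * ?v (\<alpha> + r * t)) \<and> \<sigma> * (\<kappa> * ?v (\<alpha> + r * t)) \<le> S)"
    have b: "0 \<le> \<sigma> * ?v t \<and> \<sigma> * ?v t \<le> S / \<kappa>" if "t \<in> {\<alpha> + r * x..\<alpha> + r * y}" for t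
    proof -
      have "0 \<le> \<sigma> * (\<kappa> * ?v t) \<and> \<sigma> * (\<kappa> * ?v t) \<le> S"
        by (rule unscale[OF that]) (use h in blast)
      then show ?thesis using div_\<kappa>(1)[of "\<sigma> * ?v t" S] by (simp only: mult.left_commute[of \<sigma> \<kappa>])
    qed
    have S0: "0 \<le> S" using h by (metis atLeastAtMost_iff order_refl order_trans)
    have Sk: "0 \<le> S / \<kappa>" using S0 \<kappa> by simp
    have "\<sigma> * (\<kappa> * r * dedge u e (\<alpha> + r * y) - \<kappa> * r * dedge u e (\<alpha> + r * x)) \<le> \<kappa> * r\<^sup>2 * ((B + \<Lambda>) * (S / \<kappa>)) * (y - x)"
    proof (rule scaled)
      have "0 \<le> x" "y \<le> 1" using h by auto
      from ae[OF this] show "AE t in lebesgue_on {\<alpha> + r * x..\<alpha> + r * y}. \<sigma> * source \<Lambda> u e t \<le> (B + \<Lambda>) * (S / \<kappa>)"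
      proof eventually_elim
        case (elim t)
        have "(on_edge G W e t + \<Lambda>) * (\<sigma> * ?v t) \<le> (B + \<Lambda>) * (S / \<kappa>)"
          using b[of t] elim A by (intro mult_mono) auto
        moreover have "0 \<le> on_edge G \<rho> e t * \<bar>?v t\<bar> powr (p - 2) * (\<sigma> * ?v t)"
          by (rule mult_nonneg_nonneg[OF mult_nonneg_nonneg]) (use b[of t] elim \<rho>0 in auto)
        ultimately show ?case unfolding src by linarith
      qed
    qed (use h in auto)
    also have "\<kappa> * r\<^sup>2 * ((B + \<Lambda>) * (S / \<kappa>)) * (y - x) = ((B + \<Lambda>) * r\<^sup>2) * (S * (y - x))"
      using \<kappa> by (simp add: field_simps)
    also have "\<dots> \<le> 1 * (S * (y - x))" using r S0 h by (intro mult_right_mono) auto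
    finally show "\<sigma> * (\<kappa> * r * dedge u e (\<alpha> + r * y) - \<kappa> * r * dedge u e (\<alpha> + r * x)) \<le> S * (y - x)" by simp
    have "- \<sigma> * (\<kappa> * r * dedge u e (\<alpha> + r * y) - \<kappa> * r * dedge u e (\<alpha> + r * x))
        \<le> \<kappa> * r\<^sup>2 * ((B + \<Lambda>) * (S / \<kappa>) + B * (S / \<kappa>) powr (p - 2) * (S / \<kappa>)) * (y - x)"
    proof (rule scaled)
      have "0 \<le> x" "y \<le> 1" using h by auto
      from ae[OF this] show "AE t in lebesgue_on {\<alpha> + r * x..\<alpha> + r * y}. - \<sigma> * source \<Lambda> u e t
          \<le> (B + \<Lambda>) * (S / \<kappa>) + B * (S / \<kappa>) powr (p - 2) * (S / \<kappa>)"
      proof eventually_elim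
        case (elim t)
        have "- (on_edge G W e t + \<Lambda>) * (\<sigma> * ?v t) \<le> (B + \<Lambda>) * (S / \<kappa>)"
          using b[of t] elim A \<Lambda> by (intro mult_mono) auto
        moreover have "on_edge G \<rho> e t * \<bar>?v t\<bar> powr (p - 2) * (\<sigma> * ?v t) \<le> B * (S / \<kappa>) powr (p - 2) * (S / \<kappa>)"
          using b[of t] elim \<rho>0 B p absv[OF \<sigma>, of t] by (intro mult_mono) (auto intro!: powr_mono2)
        moreover have "- \<sigma> * source \<Lambda> u e t = - (\<sigma> * source \<Lambda> u e t)" by simp
        ultimately show ?case unfolding src by linarith
      qed
    qed (use h in auto)
    also have "\<kappa> * r\<^sup>2 * ((B + \<Lambda>) * (S / \<kappa>) + B * (S / \<kappa>) powr (p - 2) * (S / \<kappa>)) * (y - x)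
      = ((B + \<Lambda>) * r\<^sup>2) * (S * (y - x)) + B * S powr (p - 1) * (y - x)"
    proof -
      have 1: "(S / \<kappa>) powr (p - 2) = S powr (p - 2) / r\<^sup>2"
        using S0 \<kappa> by (simp add: powr_divide)
      have 2: "S powr (p - 1) = S powr (p - 2) * S"
      proof (cases "S = 0")
        case False
        then show ?thesis using S0 powr_add[of S "p - 2" 1] by simp
      qed (use p in simp)
      show ?thesis unfolding 1 2 using \<kappa> r(1) by (simp add: field_simps)
    qed
    also have "\<dots> \<le> 1 * (S * (y - x)) + B * S powr (p - 1) * (y - x)"
      using r S0 h by (intro add_right_mono mult_right_mono) auto
    finally have "- \<sigma> * (\<kappa> * r * dedge u e (\<alpha> + r * y) - \<kappa> * r * dedge u e (\<alpha> + r * x)) \<le> (S + B * S powr (p - 1)) * (y - x)"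
      by (simp add: algebra_simps)
    moreover have "- \<sigma> * (\<kappa> * r * dedge u e (\<alpha> + r * y) - \<kappa> * r * dedge u e (\<alpha> + r * x))
      = - (\<sigma> * (\<kappa> * r * dedge u e (\<alpha> + r * y) - \<kappa> * r * dedge u e (\<alpha> + r * x)))" by simp
    ultimately show "- ((S + B * S powr (p - 1)) * (y - x)) \<le> \<sigma> * (\<kappa> * r * dedge u e (\<alpha> + r * y) - \<kappa> * r * dedge u e (\<alpha> + r * x))"
      by linarith
  next
    fix \<sigma> x y c :: real assume \<sigma>: "\<sigma> \<in> {-1,1}"
      and h: "0 \<le> x \<and> x \<le> y \<and> y \<le> 1 \<and> 0 \<le> c \<and> 1 \<le> \<rho>0 * c powr (p - 2) \<and> (\<forall>t\<in>{x..y}. c \<le> \<sigma> * (\<kappa> * ?v (\<alpha> + r * t)))"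
    have b: "c / \<kappa> \<le> \<sigma> * ?v t" if "t \<in> {\<alpha> + r * x..\<alpha> + r * y}" for t
    proof -
      have "c \<le> \<sigma> * (\<kappa> * ?v t)"
        by (rule unscale[OF that]) (use h in blast)
      then show ?thesis using div_\<kappa>(2)[of c "\<sigma> * ?v t"] by (simp only: mult.left_commute[of \<sigma> \<kappa>])
    qed
    have ck: "0 \<le> c / \<kappa>" using h \<kappa> by simp
    have "\<sigma> * (\<kappa> * r * dedge u e (\<alpha> + r * y) - \<kappa> * r * dedge u e (\<alpha> + r * x)) \<le> \<kappa> * r\<^sup>2 * (- ((\<rho>0 * c powr (p - 2) - 1) / r\<^sup>2) * (c / \<kappa>)) * (y - x)"
    proof (rule scaled)
      have "0 \<le> x" "y \<le> 1" using h by auto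
      from ae[OF this] show "AE t in lebesgue_on {\<alpha> + r * x..\<alpha> + r * y}. \<sigma> * source \<Lambda> u e t
          \<le> - ((\<rho>0 * c powr (p - 2) - 1) / r\<^sup>2) * (c / \<kappa>)"
      proof eventually_elim
        case (elim t)
        have bt: "c / \<kappa> \<le> \<sigma> * ?v t" using b[of t] elim by blast
        then have v0: "0 \<le> \<sigma> * ?v t" using ck by linarith
        have "(c / \<kappa>) powr (p - 2) \<le> \<bar>?v t\<bar> powr (p - 2)"
          unfolding absv[OF \<sigma> v0] using bt ck p by (intro powr_mono2) auto
        moreover have "(c / \<kappa>) powr (p - 2) = c powr (p - 2) / r\<^sup>2" using h \<kappa> by (simp add: powr_divide)
        ultimately have "\<rho>0 * (c powr (p - 2) / r\<^sup>2) \<le> on_edge G \<rho> e t * \<bar>?v t\<bar> powr (p - 2)"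
          using elim \<rho>0 by (intro mult_mono) auto
        moreover have "on_edge G W e t + \<Lambda> \<le> 1 / r\<^sup>2"
        proof -
          have "B + \<Lambda> \<le> 1 / r\<^sup>2" using r by (simp add: pos_le_divide_eq)
          then show ?thesis using elim by linarith
        qed
        ultimately have co: "on_edge G W e t + \<Lambda> - on_edge G \<rho> e t * \<bar>?v t\<bar> powr (p - 2) \<le> - ((\<rho>0 * c powr (p - 2) - 1) / r\<^sup>2)"
          by (simp add: diff_divide_distrib)
        have "\<sigma> * source \<Lambda> u e t = (on_edge G W e t + \<Lambda> - on_edge G \<rho> e t * \<bar>?v t\<bar> powr (p - 2)) * (\<sigma> * ?v t)"
          unfolding src by (simp add: algebra_simps)
        also have "\<dots> \<le> - ((\<rho>0 * c powr (p - 2) - 1) / r\<^sup>2) * (\<sigma> * ?v t)"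
          using co v0 by (rule mult_right_mono)
        also have "\<dots> \<le> - ((\<rho>0 * c powr (p - 2) - 1) / r\<^sup>2) * (c / \<kappa>)"
          using bt h by (intro mult_left_mono_neg) auto
        finally show ?case .
      qed
    qed (use h in auto)
    also have "\<kappa> * r\<^sup>2 * (- ((\<rho>0 * c powr (p - 2) - 1) / r\<^sup>2) * (c / \<kappa>)) * (y - x) = - ((\<rho>0 * c powr (p - 2) - 1) * c * (y - x))"
      using \<kappa> r(1) by simp
    finally show "\<sigma> * (\<kappa> * r * dedge u e (\<alpha> + r * y) - \<kappa> * r * dedge u e (\<alpha> + r * x)) \<le> - ((\<rho>0 * c powr (p - 2) - 1) * c * (y - x))" .
  qed
qed

text \<open>With \<open>D = 4 / l^2 + B + \<Lambda>\<close> and \<open>r = 1 / sqrt D\<close>, the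
  first summand yields \<open>r < l / 2\<close>, so that a window fits into the open edge on one
  side of each point, and the other two yield \<open>(B + \<Lambda>) * r^2 \<le> 1\<close>. The
  rescaled solution is bounded by a constant, since \<open>Suc m\<close> nodal intervals would
  contradict the Morse index, and undoing the amplitude factor \<open>\<kappa>\<close> produces the
  power of \<open>D\<close>.\<close>

lemma sup_bound:
  fixes m :: nat
  obtains C where "0 \<le> C" "\<And>\<Lambda> u e l x. solves G p W \<rho> \<Lambda> u \<Longrightarrow> morse_index G p W \<rho> \<Lambda> u \<le> enat m \<Longrightarrow> 0 \<le> \<Lambda>
    \<Longrightarrow> e \<in> edges G \<Longrightarrow> edge_length G e = ereal l \<Longrightarrow> x \<in> {0..l} \<Longrightarrow>
    \<bar>on_edge G u e x\<bar> \<le> C * (4 / l\<^sup>2 + B + \<Lambda>) powr (1 / (p - 2))"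
proof -
  obtain C where C: "0 \<le> C" "\<And>v w. oscillator \<rho>0 B p v w \<Longrightarrow> (\<forall>t\<in>{0..1}. \<bar>v t\<bar> \<le> C) \<or> nodal_intervals v 0 1 (Suc m)"
    using oscillator_bound[OF \<rho>0 less_imp_le[OF B] p, of "Suc m"] by blast
  have "\<bar>on_edge G u e x\<bar> \<le> C * (4 / l\<^sup>2 + B + \<Lambda>) powr (1 / (p - 2))"
    if s: "solves G p W \<rho> \<Lambda> u" and m: "morse_index G p W \<rho> \<Lambda> u \<le> enat m" and \<Lambda>: "0 \<le> \<Lambda>"
      and e: "e \<in> edges G" and l: "edge_length G e = ereal l" and x: "x \<in> {0..l}" for \<Lambda> u e l x
  proof -
    have u: "u \<in> H1_graph G" using s by (simp add: solves_def)
    have be: "e \<in> bounded_edges G" using e l by (simp add: bounded_edges_def)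
    have l0: "0 < l" and I: "interval_of G e = {0..l}" "open_edge G e = {0<..<l}"
      using interval_of_cases[OF fin e] l by auto
    define D where "D = 4 / l\<^sup>2 + B + \<Lambda>"
    have "0 < 4 / l\<^sup>2" using l0 by simp
    then have D0: "0 < D" using B \<Lambda> unfolding D_def by linarith
    define r where "r = 1 / sqrt D"
    have r0: "0 < r" using D0 by (simp add: r_def)
    have r2: "r\<^sup>2 = 1 / D" using D0 by (simp add: r_def power_divide)
    have "(2 / l)\<^sup>2 < D" using B \<Lambda> by (simp add: D_def power_divide)
    then have "2 / l < sqrt D" using real_less_rsqrt by blast
    then have rl: "r < l / 2" using l0 D0 by (simp add: r_def field_simps)
    have Ar: "(B + \<Lambda>) * r\<^sup>2 \<le> 1" unfolding r2 using D0 l0 by (simp add: D_def)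
    define \<kappa> where "\<kappa> = D powr (- (1 / (p - 2)))"
    have \<kappa>0: "0 < \<kappa>" using D0 by (simp add: \<kappa>_def)
    have "\<kappa> powr (p - 2) = D powr (-1)" using p by (simp add: \<kappa>_def powr_powr)
    then have \<kappa>r: "\<kappa> powr (p - 2) = r\<^sup>2" using D0 unfolding r2 by (simp add: powr_minus_divide)
    have inner: "\<bar>on_edge G u e y\<bar> \<le> C * D powr (1 / (p - 2))" if y: "y \<in> {0<..<l}" for y
    proof -
      \<comment> \<open>The window extends from \<open>y\<close> towards the farther end of the
        edge, so it stays strictly inside.\<close>
      define \<alpha> where "\<alpha> = (if y \<le> l / 2 then y else y - r)"
      have \<alpha>: "0 < \<alpha>" "\<alpha> + r < l" "\<alpha> \<le> y" "y \<le> \<alpha> + r" using y rl r0 by (auto simp: \<alpha>_def)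
      have sub: "{\<alpha>..\<alpha>+r} \<subseteq> open_edge G e" unfolding I using \<alpha> by auto
      have "\<not> nodal_intervals (\<lambda>t. \<kappa> * on_edge G u e (\<alpha> + r * t)) 0 1 (Suc m)"
      proof
        assume "nodal_intervals (\<lambda>t. \<kappa> * on_edge G u e (\<alpha> + r * t)) 0 1 (Suc m)"
        from nodal_intervals_scale[OF this \<kappa>0 r0]
        have "enat (Suc m) \<le> morse_index G p W \<rho> \<Lambda> u"
          using r0 by (intro nodal_intervals_morse_index[OF s be _ sub]) auto
        then have "enat (Suc m) \<le> enat m" using m by (rule order_trans)
        then show False by simp
      qed
      then have "\<forall>t\<in>{0..1}. \<bar>\<kappa> * on_edge G u e (\<alpha> + r * t)\<bar> \<le> C"
        using C(2)[OF oscillator_rescaled[OF s be \<Lambda> r0 sub Ar \<kappa>0 \<kappa>r]] by blast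
      moreover have "(y - \<alpha>) / r \<in> {0..1}" using \<alpha> r0 by (auto simp: field_simps)
      ultimately have "\<bar>\<kappa> * on_edge G u e (\<alpha> + r * ((y - \<alpha>) / r))\<bar> \<le> C" by blast
      then have "\<kappa> * \<bar>on_edge G u e y\<bar> \<le> C" using r0 \<kappa>0 by (simp add: abs_mult)
      then have "\<bar>on_edge G u e y\<bar> \<le> C / \<kappa>" using \<kappa>0 by (simp add: pos_le_divide_eq mult.commute)
      then show ?thesis using D0 by (simp add: \<kappa>_def powr_minus_divide)
    qed
    have cl: "closure {0<..<l} = {0..l}" using l0 by simp
    have "\<bar>on_edge G u e x\<bar> \<le> C * D powr (1 / (p - 2))"
    proof (rule continuous_le_on_closure[of "{0<..<l}" "\<lambda>x. \<bar>on_edge G u e x\<bar>"])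
      show "continuous_on (closure {0<..<l}) (\<lambda>x. \<bar>on_edge G u e x\<bar>)"
        unfolding cl using on_edge_continuous[OF u e] I by (intro continuous_intros) auto
    qed (use cl x inner in auto)
    then show ?thesis by (simp add: D_def)
  qed
  with C(1) show thesis using that by blast
qed

end

section \<open>The mass of bounded edges\<close>

lemma integral_support_indicator:
  fixes f :: "real \<Rightarrow> real"
  assumes "{a..b} \<subseteq> {c..d}"
  shows "(LINT x|lebesgue_on {c..d}. indicator {a..b} x * f x) = (LINT x|lebesgue_on {a..b}. f x)"
proof -
  have "(LINT x|lebesgue_on {c..d}. indicator {a..b} x * f x) = (LINT x|lebesgue_on {a..b}. indicator {a..b} x * f x)"
    by (rule integral_lebesgue_on_support[OF assms]) auto
  also have "\<dots> = (LINT x|lebesgue_on {a..b}. f x)"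
    by (rule Bochner_Integration.integral_cong) auto
  finally show ?thesis .
qed

lemma not_integrable_if_bounded_below:
  fixes f :: "real \<Rightarrow> real"
  assumes f: "integrable (lebesgue_on {0..}) f" and K: "0 < K" "0 \<le> N" "\<And>x. x \<ge> N \<Longrightarrow> K \<le> f x"
  shows False
proof -
  have i: "integrable (lebesgue_on {N..N+M}) f" if "0 \<le> M" for M
    by (rule integrable_lebesgue_on_subset[OF f]) (use K in auto)
  have i0: "integrable (lebesgue_on {N..}) f"
    by (rule integrable_lebesgue_on_subset[OF f]) (use K in auto)
  define T where "T = (LINT x|lebesgue_on {N..}. f x)"
  have le: "K * M \<le> T" if M: "0 \<le> M" for M
  proof -
    have "K * M = (LINT x|lebesgue_on {N..N+M}. K)" using M by (simp add: measure_restrict_space)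
    also have "\<dots> \<le> (LINT x|lebesgue_on {N..N+M}. f x)"
      by (rule integral_mono) (use i[OF M] K(3) in auto)
    also have "\<dots> = integral {N..N+M} f" by (simp add: lebesgue_integral_eq_integral i[OF M])
    also have "\<dots> \<le> integral {N..} f"
      using integrable_on_lebesgue_on[OF i[OF M]] integrable_on_lebesgue_on[OF i0] K
      by (intro integral_subset_le) (auto intro: order_trans[OF less_imp_le])
    also have "\<dots> = T" unfolding T_def by (simp add: lebesgue_integral_eq_integral i0)
    finally show ?thesis .
  qed
  have "0 \<le> T" using le[of 0] by simp
  then have "K * ((T + 1) / K) \<le> T" using K by (intro le) auto
  then show False using K by simp
qed

context nls_graph
begin

text \<open>Cells whose indices agree modulo 3 have cutoffs with disjoint supports, so at most \<open>m\<close> of them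
  have a negative Hessian. For the other cells that are not near an end of the edge, the mass \<open>a i\<close> is
  at most a quarter of \<open>a (i - 1) + a (i + 1)\<close>.\<close>

lemma bounded_edge_L2:
  assumes s: "solves G p W \<rho> \<Lambda> u" and m: "morse_index G p W \<rho> \<Lambda> u \<le> enat m" and \<Lambda>: "2 * B \<le> \<Lambda>"
    and e: "e \<in> edges G" "edge_length G e = ereal l" and U: "\<And>x. x \<in> {0..l} \<Longrightarrow> \<bar>on_edge G u e x\<bar> \<le> U"
    and n: "0 < n" and d: "8 * ((p - 1) / (p - 2)) \<le> \<Lambda> * (l / real n)\<^sup>2"
  shows "(LINT x|lebesgue_on {0..l}. (on_edge G u e x)\<^sup>2) \<le> 2 * (3 * real m + 4) * (l / real n * U\<^sup>2)"
proof -
  let ?v = "on_edge G u e"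
  have u: "u \<in> H1_graph G" using s by (simp add: solves_def)
  have l0: "0 < l" and I: "interval_of G e = {0..l}" "open_edge G e = {0<..<l}"
    using interval_of_cases[OF fin e(1)] e(2) by auto
  define h where "h = l / real n"
  have h0: "0 < h" and nh: "real n * h = l" using l0 n by (auto simp: h_def)
  have \<Lambda>0: "0 < \<Lambda>" using \<Lambda> B by simp
  have vc: "continuous_on {0..l} ?v" using on_edge_continuous[OF u e(1)] I by simp
  have v2: "integrable (lebesgue_on {a..b}) (\<lambda>x. (?v x)\<^sup>2)" if "{a..b} \<subseteq> {0..l}" for a b
    by (intro continuous_imp_integrable_real continuous_intros continuous_on_subset[OF vc that])
  define a where "a i = (LINT x|lebesgue_on {real i * h..real (Suc i) * h}. (?v x)\<^sup>2)" for i
  have cell: "{real i * h..real (Suc i) * h} \<subseteq> {0..l}" if "i < n" for i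
  proof -
    have "real (Suc i) * h \<le> real n * h" using that h0 by (intro mult_right_mono) auto
    moreover have "0 \<le> real i * h" using h0 by simp
    ultimately show ?thesis using nh by auto
  qed
  have a0: "0 \<le> a i" for i unfolding a_def by simp
  have aU: "a i \<le> h * U\<^sup>2" if i: "i < n" for i
  proof -
    have "a i \<le> (LINT x|lebesgue_on {real i * h..real (Suc i) * h}. U\<^sup>2)"
      unfolding a_def
    proof (rule integral_mono)
      fix x assume "x \<in> space (lebesgue_on {real i * h..real (Suc i) * h})"
      then have "\<bar>?v x\<bar> \<le> U" using U cell[OF i] by auto
      then show "(?v x)\<^sup>2 \<le> U\<^sup>2" by (metis abs_ge_zero power2_abs power_mono)
    qed (use v2[OF cell[OF i]] in auto)
    also have "\<dots> = h * U\<^sup>2" using h0 by (simp add: measure_restrict_space algebra_simps)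
    finally show ?thesis .
  qed
  have total: "(LINT x|lebesgue_on {0..real k * h}. (?v x)\<^sup>2) = (\<Sum>i<k. a i)" if "k \<le> n" for k
    using that
  proof (induction k)
    case 0
    then show ?case using lebesgue_integral_eq_integral[OF v2[of 0 0]] l0 by simp
  next
    case (Suc k)
    have "real k * h \<le> real (Suc k) * h" "0 \<le> real k * h" using h0 by auto
    have sub: "{0..real (Suc k) * h} \<subseteq> {0..l}" "{0..real k * h} \<subseteq> {0..l}"
      using cell[of k] Suc.prems h0 by (auto simp: algebra_simps)
    have "integral {0..real k * h} (\<lambda>x. (?v x)\<^sup>2) + integral {real k * h..real (Suc k) * h} (\<lambda>x. (?v x)\<^sup>2)
      = integral {0..real (Suc k) * h} (\<lambda>x. (?v x)\<^sup>2)"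
      by (rule Henstock_Kurzweil_Integration.integral_combine) (use h0 integrable_on_lebesgue_on[OF v2[OF sub(1)]] in auto)
    then show ?case
      using Suc v2[OF sub(1)] v2[OF sub(2)] v2[OF cell[of k]] by (simp add: lebesgue_integral_eq_integral a_def)
  qed
  \<comment> \<open>The cutoff with index \<open>i\<close> equals 1 on cell \<open>i\<close> and
    falls to 0 across one neighbouring cell on each side. The subtraction is real, hence not
    truncated at \<open>i = 0\<close>.\<close>
  define A D where "A i = (real i - 1) * h" and "D i = (real i + 2) * h" for i
  define \<eta> where "\<eta> i = trapezoid (A i) (real i * h) (real (Suc i) * h) (D i)" for i
  define \<eta>' where "\<eta>' i = trapezoid_deriv (A i) (real i * h) (real (Suc i) * h) (D i)" for i
  define \<psi> where "\<psi> i x = (if x \<in> {A i..D i} then dedge u e x * \<eta> i x + ?v x * \<eta>' i x else 0)" for i x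
  define \<phi> where "\<phi> i x = ?v x * \<eta> i x" for i x
  have order: "A i < real i * h" "real i * h \<le> real (Suc i) * h" "real (Suc i) * h < D i" for i
    using h0 by (auto simp: A_def D_def algebra_simps)
  have ADlen: "real i * h - A i = h" "D i - real (Suc i) * h = h" for i by (auto simp: A_def D_def algebra_simps)
  have pe: "piecewise_test (A i) (D i) (\<eta> i) (\<eta>' i)" for i
    unfolding \<eta>_def \<eta>'_def by (rule piecewise_test_trapezoid[OF order])
  \<comment> \<open>For \<open>i = 1\<close> or \<open>i = n - 2\<close> the support would reach an
    end of the edge, whereas it has to be compact in the open edge. This accounts for the four cells
    set aside in \<open>rest\<close>.\<close>
  have sub: "{A i..D i} \<subseteq> open_edge G e" "A i \<le> D i" if "2 \<le> i" "i + 3 \<le> n" for i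
  proof -
    have "1 * h \<le> (real i - 1) * h" using that h0 by (intro mult_right_mono) auto
    moreover have "(real i + 2) * h \<le> (real n - 1) * h" using that h0 by (intro mult_right_mono) auto
    moreover have "(real n - 1) * h < l" using h0 nh by (simp add: algebra_simps)
    ultimately have "0 < A i" "D i < l" unfolding A_def D_def using h0 by linarith+
    then show "{A i..D i} \<subseteq> open_edge G e" by (auto simp: I)
    show "A i \<le> D i" using order[of i] by linarith
  qed
  define Q where "Q i = (LINT x|lebesgue_on {A i..D i}. (\<psi> i x)\<^sup>2 + potential \<Lambda> u e x * (\<phi> i x)\<^sup>2)" for i
  have pt: "piecewise_test (A i) (D i) (\<phi> i) (\<psi> i)" if "2 \<le> i" "i + 3 \<le> n" for i
    using cutoff_estimate(1)[OF s e(1) sub(2,1)[OF that] pe \<Lambda>] unfolding \<phi>_def[abs_def] \<psi>_def[abs_def] .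
  define c where "c = (p - 1) / (p - 2)"
  have c0: "0 < c" using p by (simp add: c_def)
  have good: "a i \<le> (a (i - 1) + a (Suc i)) / 4" if i: "2 \<le> i" "i + 3 \<le> n" and Q: "0 \<le> Q i" for i
  proof -
    have AD: "{A i..D i} \<subseteq> {0..l}" using sub(1)[OF i] I by auto
    have "\<Lambda> / 2 * (LINT x|lebesgue_on {A i..D i}. (?v x * \<eta> i x)\<^sup>2) \<le> c * (LINT x|lebesgue_on {A i..D i}. (?v x * \<eta>' i x)\<^sup>2)"
      unfolding c_def
      by (rule cutoff_estimate(2)[OF s e(1) sub(2,1)[OF i] pe \<Lambda>])
        (use Q in \<open>unfold Q_def \<psi>_def \<phi>_def\<close>)
    moreover have "a i \<le> (LINT x|lebesgue_on {A i..D i}. (?v x * \<eta> i x)\<^sup>2)"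
    proof -
      have "a i = (LINT x|lebesgue_on {A i..D i}. indicator {real i * h..real (Suc i) * h} x * (?v x)\<^sup>2)"
        unfolding a_def by (rule integral_support_indicator[symmetric]) (use order[of i] in auto)
      also have "\<dots> \<le> (LINT x|lebesgue_on {A i..D i}. (?v x * \<eta> i x)\<^sup>2)"
      proof (rule integral_mono)
        show "integrable (lebesgue_on {A i..D i}) (\<lambda>x. indicator {real i * h..real (Suc i) * h} x * (?v x)\<^sup>2)"
          using integrable_mult_bounded[OF v2[OF AD], of "indicator {real i * h..real (Suc i) * h}" 1]
          by (simp add: mult.commute borel_measurable_lebesgue_on indicator_def)
        have "continuous_on {A i..D i} (\<eta> i)"
          using pe[of i] continuous_on_subset[of UNIV "\<eta> i"] by (simp add: piecewise_test_def)
        then show "integrable (lebesgue_on {A i..D i}) (\<lambda>x. (?v x * \<eta> i x)\<^sup>2)"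
          by (intro continuous_imp_integrable_real continuous_intros continuous_on_subset[OF vc AD])
        fix x
        show "indicator {real i * h..real (Suc i) * h} x * (?v x)\<^sup>2 \<le> (?v x * \<eta> i x)\<^sup>2"
          using trapezoid_values(4)[OF order[of i], of x] by (auto simp: indicator_def \<eta>_def)
      qed
      finally show ?thesis .
    qed
    moreover have "(LINT x|lebesgue_on {A i..D i}. (?v x * \<eta>' i x)\<^sup>2) \<le> (1 / h\<^sup>2) * (a (i - 1) + a (Suc i))"
    proof -
      have J1: "{real (i - 1) * h..real (Suc (i - 1)) * h} \<subseteq> {A i..D i}"
        "{real (Suc i) * h..real (Suc (Suc i)) * h} \<subseteq> {A i..D i}"
        using i h0 order[of i] by (auto simp: A_def D_def of_nat_diff algebra_simps)
      let ?J = "\<lambda>i. {real i * h..real (Suc i) * h}"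
      have int: "integrable (lebesgue_on {A i..D i}) (\<lambda>x. indicator (?J j) x * (?v x)\<^sup>2)" for j
        using integrable_mult_bounded[OF v2[OF AD], of "indicator (?J j)" 1]
        by (simp add: mult.commute borel_measurable_lebesgue_on indicator_def)
      have pw: "(?v x * \<eta>' i x)\<^sup>2 \<le> (1 / h\<^sup>2) * (indicator (?J (i - 1)) x * (?v x)\<^sup>2 + indicator (?J (Suc i)) x * (?v x)\<^sup>2)" for x
      proof -
        have ends: "A i = real (i - 1) * h" "real (Suc (i - 1)) * h = real i * h" "D i = real (Suc (Suc i)) * h"
          using i by (auto simp: A_def D_def of_nat_diff algebra_simps)
        consider "x \<in> {A i<..<real i * h}" | "x \<notin> {A i<..<real i * h}" "x \<in> {real (Suc i) * h<..<D i}"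
          | "x \<notin> {A i<..<real i * h}" "x \<notin> {real (Suc i) * h<..<D i}" by blast
        then show ?thesis
        proof cases
          case 1
          then have "\<eta>' i x = 1 / h" unfolding \<eta>'_def trapezoid_deriv_def ADlen by simp
          then have "(?v x * \<eta>' i x)\<^sup>2 = (1 / h\<^sup>2) * (1 * (?v x)\<^sup>2 + 0)" by (simp add: power_divide)
          also have "\<dots> \<le> (1 / h\<^sup>2) * (indicator (?J (i - 1)) x * (?v x)\<^sup>2 + indicator (?J (Suc i)) x * (?v x)\<^sup>2)"
            using 1 unfolding ends by (intro mult_left_mono add_mono) auto
          finally show ?thesis .
        next
          case 2
          then have "\<eta>' i x = - 1 / h" unfolding \<eta>'_def trapezoid_deriv_def ADlen by (simp only: if_False if_True)
          then have "(?v x * \<eta>' i x)\<^sup>2 = (1 / h\<^sup>2) * (0 + 1 * (?v x)\<^sup>2)" by (simp add: power_divide)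
          also have "\<dots> \<le> (1 / h\<^sup>2) * (indicator (?J (i - 1)) x * (?v x)\<^sup>2 + indicator (?J (Suc i)) x * (?v x)\<^sup>2)"
            using 2 unfolding ends by (intro mult_left_mono add_mono) auto
          finally show ?thesis .
        next
          case 3
          then have "\<eta>' i x = 0" unfolding \<eta>'_def trapezoid_deriv_def by (simp only: if_False)
          then show ?thesis by simp
        qed
      qed
      have ie: "integrable (lebesgue_on {A i..D i}) (\<lambda>x. (1 / h\<^sup>2) * (indicator (?J (i - 1)) x * (?v x)\<^sup>2 + indicator (?J (Suc i)) x * (?v x)\<^sup>2))"
        by (intro integrable_mult_right Bochner_Integration.integrable_add int)
      have "(LINT x|lebesgue_on {A i..D i}. (?v x * \<eta>' i x)\<^sup>2)
        \<le> (LINT x|lebesgue_on {A i..D i}. (1 / h\<^sup>2) * (indicator (?J (i - 1)) x * (?v x)\<^sup>2 + indicator (?J (Suc i)) x * (?v x)\<^sup>2))"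
      proof (rule integral_mono'[OF ie])
      qed (use pw in auto)
      also have "\<dots> = (1 / h\<^sup>2) * (a (i - 1) + a (Suc i))"
        unfolding a_def integral_mult_right_zero Bochner_Integration.integral_add[OF int int]
          integral_support_indicator[OF J1(1)] integral_support_indicator[OF J1(2)] ..
      finally show ?thesis .
    qed
    \<comment> \<open>The hypothesis \<open>8 * c \<le> \<Lambda> * h^2\<close> is made for this
      point: it turns the factor \<open>2 * c / (\<Lambda> * h^2)\<close> into one quarter.\<close>
    ultimately have "\<Lambda> / 2 * a i \<le> c * ((1 / h\<^sup>2) * (a (i - 1) + a (Suc i)))"
      using \<Lambda>0 c0 by (meson divide_nonneg_pos less_imp_le mult_left_mono order_trans zero_less_numeral)
    then have "\<Lambda> * h\<^sup>2 * a i \<le> 2 * c * (a (i - 1) + a (Suc i))"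
      using h0 by (simp add: field_simps)
    moreover have "8 * c * a i \<le> \<Lambda> * h\<^sup>2 * a i"
      using d a0[of i] unfolding c_def h_def by (intro mult_right_mono) auto
    ultimately have "2 * c * (4 * a i) \<le> 2 * c * (a (i - 1) + a (Suc i))" by simp
    then show ?thesis using c0 by simp
  qed
  define Bd where "Bd = {i. 2 \<le> i \<and> i + 3 \<le> n \<and> Q i < 0}"
  have finBd: "finite Bd" by (rule finite_subset[of _ "{..n}"]) (auto simp: Bd_def)
  have res: "card {i \<in> Bd. i mod 3 = r} \<le> m" for r
  proof (rule ccontr)
    assume "\<not> ?thesis"
    then have "Suc m \<le> card {i \<in> Bd. i mod 3 = r}" by simp
    then obtain T where T: "T \<subseteq> {i \<in> Bd. i mod 3 = r}" "card T = Suc m" "finite T"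
      by (rule obtain_subset_with_card_n)
    obtain f where f: "bij_betw f {..<Suc m} T"
      using ex_bij_betw_nat_finite[OF T(3)] by (auto simp: T(2) atLeast0LessThan)
    have fT: "f j \<in> T" if "j < Suc m" for j using f that by (auto simp: bij_betw_def)
    have fB: "2 \<le> f j" "f j + 3 \<le> n" "Q (f j) < 0" "f j mod 3 = r" if "j < Suc m" for j
      using fT[OF that] T(1) by (auto simp: Bd_def)
    \<comment> \<open>Distinct indices with the same residue differ by at least 3, while a cutoff
      reaches from \<open>i - 1\<close> to \<open>i + 2\<close> in units of
      \<open>h\<close>.\<close>
    have apart: "D (f i) \<le> A (f j) \<or> D (f j) \<le> A (f i)" if ij: "i < Suc m" "j < Suc m" "i \<noteq> j" for i j
    proof -
      have ne: "f i \<noteq> f j" using f ij by (auto simp: bij_betw_def inj_on_def)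
      have "f i + 3 \<le> f j \<or> f j + 3 \<le> f i"
      proof -
        have eqs: "3 * (f i div 3) + r = f i" "3 * (f j div 3) + r = f j"
          using mult_div_mod_eq[of 3 "f i"] mult_div_mod_eq[of 3 "f j"] fB(4)[OF ij(1)] fB(4)[OF ij(2)] by simp_all
        then have "f i div 3 \<noteq> f j div 3" using ne by metis
        then have "f i div 3 + 1 \<le> f j div 3 \<or> f j div 3 + 1 \<le> f i div 3" by linarith
        then show ?thesis using eqs by linarith
      qed
      then show ?thesis
      proof
        assume "f i + 3 \<le> f j"
        then have "(real (f i) + 2) * h \<le> (real (f j) - 1) * h" using h0 by (intro mult_right_mono) auto
        then show ?thesis by (simp add: A_def D_def)
      next
        assume "f j + 3 \<le> f i"
        then have "(real (f j) + 2) * h \<le> (real (f i) - 1) * h" using h0 by (intro mult_right_mono) auto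
        then show ?thesis by (simp add: A_def D_def)
      qed
    qed
    have zero: "\<phi> i x = 0 \<and> \<psi> i x = 0" if "x \<notin> {A i<..<D i}" for i x
    proof -
      have "\<eta> i x = 0" using that trapezoid_values(1,2)[OF order[of i], of x] by (auto simp: \<eta>_def)
      moreover have "\<eta>' i x = 0" using that order[of i] by (auto simp: \<eta>'_def trapezoid_deriv_def)
      ultimately show ?thesis by (simp add: \<phi>_def \<psi>_def)
    qed
    define a1 b1 where "a1 = h" and "b1 = (real n - 1) * h"
    have i0: "0 < Suc m" by simp
    have ab1: "a1 \<le> A (f j)" "D (f j) \<le> b1" if "j < Suc m" for j
    proof -
      have "1 * h \<le> (real (f j) - 1) * h" using fB(1)[OF that] h0 by (intro mult_right_mono) auto
      then show "a1 \<le> A (f j)" by (simp add: A_def a1_def)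
      have "(real (f j) + 2) * h \<le> (real n - 1) * h" using fB(2)[OF that] h0 by (intro mult_right_mono) auto
      then show "D (f j) \<le> b1" by (simp add: D_def b1_def)
    qed
    have "b1 < l" using h0 nh by (simp add: b1_def algebra_simps)
    then have sub1: "{a1..b1} \<subseteq> open_edge G e" using h0 by (auto simp: I a1_def)
    have le1: "a1 \<le> b1" using ab1[OF i0] order[of "f 0"] by linarith
    have "enat (Suc m) \<le> morse_index G p W \<rho> \<Lambda> u"
    proof (rule morse_index_lower[OF u e(1) le1 sub1, of _ "\<lambda>j. \<phi> (f j)" "\<lambda>j. \<psi> (f j)"])
      fix i assume i: "i < Suc m"
      show "piecewise_test a1 b1 (\<phi> (f i)) (\<psi> (f i))"
        by (rule piecewise_test_mono[OF pt[OF fB(1,2)[OF i]] ab1[OF i]])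
      have "(LINT x|lebesgue_on {a1..b1}. (\<psi> (f i) x)\<^sup>2 + potential \<Lambda> u e x * (\<phi> (f i) x)\<^sup>2) = Q (f i)"
        unfolding Q_def
        by (rule integral_lebesgue_on_support) (use ab1[OF i] zero[of _ "f i"] in auto)
      then show "(LINT x|lebesgue_on {a1..b1}. (\<psi> (f i) x)\<^sup>2 + potential \<Lambda> u e x * (\<phi> (f i) x)\<^sup>2) < 0"
        using fB(3)[OF i] by simp
      fix j x assume j: "j < Suc m" "i \<noteq> j"
      have "x \<notin> {A (f i)<..<D (f i)} \<or> x \<notin> {A (f j)<..<D (f j)}"
        using apart[OF i j] by auto
      then show "\<phi> (f i) x * \<phi> (f j) x = 0" "\<psi> (f i) x * \<psi> (f j) x = 0"
        using zero by auto
    qed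
    then have "enat (Suc m) \<le> enat m" using m by (rule order_trans)
    then show False by simp
  qed
  have UN: "(\<Union>r<3. {i \<in> Bd. i mod 3 = r}) = Bd" by auto
  have "card (\<Union>r<3. {i \<in> Bd. i mod 3 = r}) \<le> (\<Sum>r<3. card {i \<in> Bd. i mod 3 = r})"
    by (rule card_UN_le) simp
  then have "card Bd \<le> (\<Sum>r<3. card {i \<in> Bd. i mod 3 = r})" by (simp only: UN)
  also have "\<dots> \<le> (\<Sum>r<(3::nat). m)" by (intro sum_mono res)
  finally have cBd: "card Bd \<le> 3 * m" by simp
  define Gd where "Gd = {i. 2 \<le> i \<and> i + 3 \<le> n \<and> 0 \<le> Q i}"
  have Gdn: "Gd \<subseteq> {..<n}" by (auto simp: Gd_def)
  \<comment> \<open>For \<open>n = 1\<close> the truncated \<open>n - 2\<close> is 0, which is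
    already listed.\<close>
  have rest: "{..<n} - Gd \<subseteq> Bd \<union> {0, 1, n - 2, n - 1}"
    by (auto simp: Gd_def Bd_def not_le)
  have crest: "card ({..<n} - Gd) \<le> 3 * m + 4"
  proof -
    have "card ({..<n} - Gd) \<le> card (Bd \<union> {0, 1, n - 2, n - 1})"
      using rest finBd by (intro card_mono) auto
    also have "\<dots> \<le> card Bd + card {0, 1, n - 2, n - 1}" by (rule card_Un_le)
    also have "card {0, 1, n - 2, n - 1} \<le> 4"
      using card_insert_le_m1[of 4 "{1, n - 2, n - 1}" 0] card_insert_le_m1[of 3 "{n - 2, n - 1}" 1]
        card_insert_le_m1[of 2 "{n - 1}" "n - 2"] by simp
    finally show ?thesis using cBd by simp
  qed
  define S where "S = (\<Sum>i<n. a i)"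
  have S1: "(\<Sum>i\<in>Gd. a (i - 1)) \<le> S"
  proof -
    have "(\<Sum>i\<in>Gd. a (i - 1)) = (\<Sum>i\<in>(\<lambda>i. i - 1) ` Gd. a i)"
      by (rule sum.reindex_cong[symmetric, of "\<lambda>i. i - 1"]) (auto simp: inj_on_def Gd_def)
    also have "\<dots> \<le> S" unfolding S_def by (rule sum_mono2) (auto simp: Gd_def a0)
    finally show ?thesis .
  qed
  have S2: "(\<Sum>i\<in>Gd. a (Suc i)) \<le> S"
  proof -
    have "(\<Sum>i\<in>Gd. a (Suc i)) = (\<Sum>i\<in>Suc ` Gd. a i)"
      by (rule sum.reindex_cong[symmetric, of Suc]) auto
    also have "\<dots> \<le> S" unfolding S_def by (rule sum_mono2) (auto simp: Gd_def a0)
    finally show ?thesis .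
  qed
  \<comment> \<open>Summing the quarters over the good cells counts each cell at most twice, once as
    a left and once as a right neighbour. So the good cells hold at most half of the total, and the
    total is at most twice the rest.\<close>
  have "(\<Sum>i\<in>Gd. a i) \<le> (\<Sum>i\<in>Gd. (a (i - 1) + a (Suc i)) / 4)"
    by (rule sum_mono, rule good) (simp_all add: Gd_def)
  also have "\<dots> = ((\<Sum>i\<in>Gd. a (i - 1)) + (\<Sum>i\<in>Gd. a (Suc i))) / 4"
    by (simp add: sum.distrib flip: sum_divide_distrib)
  also have "\<dots> \<le> S / 2" using S1 S2 by simp
  finally have SG: "(\<Sum>i\<in>Gd. a i) \<le> S / 2" .
  have "S = (\<Sum>i\<in>Gd. a i) + (\<Sum>i\<in>{..<n} - Gd. a i)"
    unfolding S_def using Gdn by (simp add: sum.subset_diff)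
  then have "S \<le> 2 * (\<Sum>i\<in>{..<n} - Gd. a i)" using SG by linarith
  also have "(\<Sum>i\<in>{..<n} - Gd. a i) \<le> (\<Sum>i\<in>{..<n} - Gd. h * U\<^sup>2)"
    by (rule sum_mono) (use aU in auto)
  also have "\<dots> = real (card ({..<n} - Gd)) * (h * U\<^sup>2)" by simp
  also have "\<dots> \<le> (3 * real m + 4) * (h * U\<^sup>2)"
    using crest h0 by (intro mult_right_mono) (auto simp flip: of_nat_le_iff)
  finally have "S \<le> 2 * ((3 * real m + 4) * (h * U\<^sup>2))" by simp
  moreover have "(LINT x|lebesgue_on {0..l}. (?v x)\<^sup>2) = S" using total[OF order_refl] unfolding nh S_def .
  ultimately show ?thesis unfolding h_def by (simp only: mult.assoc)
qed

end

section \<open>Half-lines\<close>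

context nls_graph
begin

lemma half_line_intervals:
  assumes "e \<in> half_lines G"
  shows "e \<in> edges G" "interval_of G e = {0..}" "open_edge G e = {0<..}"
proof -
  show e: "e \<in> edges G" using assms by (simp add: half_lines_def)
  show "interval_of G e = {0..}" "open_edge G e = {0<..}"
    using interval_of_cases[OF fin e] assms by (auto simp: half_lines_def)
qed

text \<open>Here the source is \<open>\<Lambda> * u\<close> almost everywhere, which is continuous,
  so the integrated equation can be differentiated once more.\<close>

lemma half_line_ode:
  assumes s: "solves G p W \<rho> \<Lambda> u" and e: "e \<in> half_lines G" and x: "0 < x"
  shows "(on_edge G u e has_real_derivative dedge u e x) (at x)"
    "(dedge u e has_real_derivative \<Lambda> * on_edge G u e x) (at x)"
proof -
  note H = half_line_intervals[OF e]
  have u: "u \<in> H1_graph G" using s by (simp add: solves_def)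
  show "(on_edge G u e has_real_derivative dedge u e x) (at x)"
    by (rule solution_has_derivative[OF s H(1)]) (use x H in simp)
  let ?v = "on_edge G u e"
  define a b where "a = x / 2" and "b = 2 * x"
  have ab: "0 < a" "a < x" "x < b" using x by (auto simp: a_def b_def)
  have vc: "continuous_on {a..b} ?v"
    by (rule continuous_on_subset[OF on_edge_continuous[OF u H(1)]]) (use ab H in auto)
  have eq: "integral {a..y} (source \<Lambda> u e) = integral {a..y} (\<lambda>t. \<Lambda> * ?v t)" if y: "a \<le> y" "y \<le> b" for y
  proof -
    have I: "{a..y} \<subseteq> interval_of G e" using ab H by auto
    have si: "integrable (lebesgue_on {a..y}) (source \<Lambda> u e)" by (rule source_integrable[OF u H(1) I])
    have vi: "integrable (lebesgue_on {a..y}) (\<lambda>t. \<Lambda> * ?v t)"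
      by (intro continuous_imp_integrable_real continuous_intros continuous_on_subset[OF vc]) (use y in auto)
    have "AE t in lebesgue_on {a..y}. source \<Lambda> u e t = \<Lambda> * ?v t"
      using AE_sub[OF H(1) I W_half[OF e]] AE_sub[OF H(1) I \<rho>_half[OF e]]
      by eventually_elim (simp add: source_def)
    then have "(LINT t|lebesgue_on {a..y}. source \<Lambda> u e t) = (LINT t|lebesgue_on {a..y}. \<Lambda> * ?v t)"
      using si vi by (intro integral_cong_AE) auto
    then show ?thesis using lebesgue_integral_eq_integral[OF si] lebesgue_integral_eq_integral[OF vi] by simp
  qed
  have "((\<lambda>y. integral {a..y} (\<lambda>t. \<Lambda> * ?v t)) has_real_derivative \<Lambda> * ?v x) (at x within {a..b})"
    by (rule integral_has_real_derivative) (use vc ab in \<open>auto intro!: continuous_intros\<close>)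
  then have "((\<lambda>y. dedge u e a + integral {a..y} (\<lambda>t. \<Lambda> * ?v t)) has_real_derivative \<Lambda> * ?v x) (at x within {a..b})"
    using DERIV_add[OF DERIV_const[of "dedge u e a"]] by (simp only: add_0_left)
  then have "(dedge u e has_real_derivative \<Lambda> * ?v x) (at x within {a..b})"
  proof (rule has_field_derivative_transform_within[of _ _ _ _ 1])
    fix y assume "y \<in> {a..b}"
    then show "dedge u e a + integral {a..y} (\<lambda>t. \<Lambda> * ?v t) = dedge u e y"
      using solution_derivative_diff[OF s H(1), of a y] eq[of y] ab H by auto
  qed (use ab in auto)
  moreover have "at x within {a..b} = at x" by (rule at_within_interior) (use ab in auto)
  ultimately show "(dedge u e has_real_derivative \<Lambda> * ?v x) (at x)" by simp
qed

lemma half_line_L2: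
  assumes "u \<in> H1_graph G" "e \<in> half_lines G"
  shows "integrable (lebesgue_on {0..}) (\<lambda>x. (on_edge G u e x)\<^sup>2)"
  using assms half_line_intervals[OF assms(2)] by (auto simp: H1_graph_def H1_fun_def L2_fun_def)

lemma constant_on_half_line:
  fixes f :: "real \<Rightarrow> real"
  assumes "\<And>x. 0 < x \<Longrightarrow> (f has_real_derivative 0) (at x)"
  obtains c where "\<And>x. 0 < x \<Longrightarrow> f x = c"
proof -
  have "\<exists>c. \<forall>x\<in>{0<..}. f x = c"
    by (rule has_field_derivative_zero_constant) (use assms in \<open>auto intro: has_field_derivative_at_within\<close>)
  then show ?thesis using that by auto
qed

text \<open>Explicit formulas are obtained on the open half-line only; continuity carries them to
  the vertex, where the value is compared with the core.\<close>

lemma half_line_limit: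
  assumes "u \<in> H1_graph G" "e \<in> half_lines G" "continuous_on {0..} g" "\<And>x. 0 < x \<Longrightarrow> on_edge G u e x = g x" "0 \<le> x"
  shows "on_edge G u e x = g x"
proof -
  note H = half_line_intervals[OF assms(2)]
  have cl: "closure {0<..} = {0::real..}" by simp
  have "continuous_on (closure {0<..}) (\<lambda>x. on_edge G u e x - g x)"
    unfolding cl using on_edge_continuous[OF assms(1) H(1)] H assms(3) by (intro continuous_intros) auto
  then have "on_edge G u e x - g x = 0"
    by (rule continuous_constant_on_closure) (use assms cl in auto)
  then show ?thesis by simp
qed

text \<open>For frequency 0 the solution is affine, and the only square integrable affine function
  on a half-line is 0. Beyond \<open>(1 + |d|) / |c|\<close> a nonconstant one exceeds 1 in
  modulus.\<close>

lemma half_line_zero: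
  assumes s: "solves G p W \<rho> 0 u" and e: "e \<in> half_lines G" and x: "x \<in> interval_of G e"
  shows "on_edge G u e x = 0"
proof -
  let ?v = "on_edge G u e"
  have u: "u \<in> H1_graph G" using s by (simp add: solves_def)
  note ode = half_line_ode[OF s e]
  obtain c where c: "\<And>x. 0 < x \<Longrightarrow> dedge u e x = c"
    using constant_on_half_line[of "dedge u e"] ode(2) by auto
  have "((\<lambda>x. ?v x - c * x) has_real_derivative 0) (at x)" if "0 < x" for x
    using ode(1)[OF that] c[OF that] by (auto intro!: derivative_eq_intros)
  from constant_on_half_line[OF this] obtain d where d: "\<And>x. 0 < x \<Longrightarrow> ?v x - c * x = d" by blast
  have v: "?v x = c * x + d" if "0 < x" for x using d[OF that] by simp
  have c0: "c = 0"
  proof (rule ccontr)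
    assume "c \<noteq> 0"
    have "1 \<le> (?v x)\<^sup>2" if x: "x \<ge> (1 + \<bar>d\<bar>) / \<bar>c\<bar>" for x
    proof -
      have "0 < (1 + \<bar>d\<bar>) / \<bar>c\<bar>" using \<open>c \<noteq> 0\<close> by (intro divide_pos_pos) auto
      then have x0: "0 < x" using x by linarith
      have "1 + \<bar>d\<bar> \<le> \<bar>c\<bar> * x" using x \<open>c \<noteq> 0\<close> by (simp add: pos_divide_le_eq mult.commute)
      also have "\<dots> = \<bar>c * x\<bar>" using x0 by (simp add: abs_mult)
      finally have "1 \<le> \<bar>?v x\<bar>" unfolding v[OF x0] by linarith
      then show ?thesis by (metis one_power2 power2_abs power_mono zero_le_one)
    qed
    then show False
      by (intro not_integrable_if_bounded_below[OF half_line_L2[OF u e], of 1 "(1 + \<bar>d\<bar>) / \<bar>c\<bar>"]) auto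
  qed
  have d0: "d = 0"
  proof (rule ccontr)
    assume "d \<noteq> 0"
    then show False
      by (intro not_integrable_if_bounded_below[OF half_line_L2[OF u e], of "d\<^sup>2" 1]) (auto simp: v c0)
  qed
  show ?thesis
    using half_line_limit[OF u e, of "\<lambda>x. 0" x] v c0 d0 x half_line_intervals[OF e] by auto
qed

text \<open>Two integrating factors solve the equation: with \<open>k = sqrt \<Lambda>\<close> the
  product \<open>(v' + k v) exp (- k x)\<close> is a constant \<open>c\<close>, and then
  \<open>v exp (k x) - c / (2 k) exp (2 k x)\<close> is a constant \<open>d\<close>. Square
  integrability excludes the growing exponential, so \<open>c = 0\<close>.\<close>

lemma half_line_exponential:
  assumes s: "solves G p W \<rho> \<Lambda> u" and e: "e \<in> half_lines G" and \<Lambda>: "0 < \<Lambda>" and x: "0 \<le> x"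
  shows "on_edge G u e x = on_edge G u e 0 * exp (- sqrt \<Lambda> * x)"
proof -
  let ?v = "on_edge G u e" and ?w = "dedge u e"
  define k where "k = sqrt \<Lambda>"
  have k: "0 < k" "k * k = \<Lambda>" using \<Lambda> by (auto simp: k_def)
  have u: "u \<in> H1_graph G" using s by (simp add: solves_def)
  note ode = half_line_ode[OF s e]
  have "((\<lambda>x. (?w x + k * ?v x) * exp (- k * x)) has_real_derivative 0) (at x)" if "0 < x" for x
    using ode[OF that] by (auto intro!: derivative_eq_intros simp: algebra_simps k(2)[symmetric])
  from constant_on_half_line[OF this] obtain c where c: "\<And>x. 0 < x \<Longrightarrow> (?w x + k * ?v x) * exp (- k * x) = c" by blast
  have w: "?w x + k * ?v x = c * exp (k * x)" if "0 < x" for x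
  proof -
    have "(?w x + k * ?v x) * exp (- k * x) * exp (k * x) = c * exp (k * x)" using c[OF that] by simp
    then show ?thesis by (simp add: mult.assoc mult_exp_exp)
  qed
  have "((\<lambda>x. ?v x * exp (k * x) - c / (2 * k) * exp (2 * k * x)) has_real_derivative 0) (at x)" if x: "0 < x" for x
  proof -
    have "((\<lambda>x. ?v x * exp (k * x) - c / (2 * k) * exp (2 * k * x)) has_real_derivative
      (?w x + k * ?v x) * exp (k * x) - c * exp (2 * k * x)) (at x)"
      using ode(1)[OF x] k(1) by (auto intro!: derivative_eq_intros simp: algebra_simps)
    moreover have "(?w x + k * ?v x) * exp (k * x) = c * exp (2 * k * x)"
      unfolding w[OF x] by (simp add: mult.assoc mult_exp_exp)
    ultimately show ?thesis by simp
  qed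
  from constant_on_half_line[OF this] obtain d where d: "\<And>x. 0 < x \<Longrightarrow> ?v x * exp (k * x) - c / (2 * k) * exp (2 * k * x) = d" by blast
  have v: "?v x = c / (2 * k) * exp (k * x) + d * exp (- k * x)" if "0 < x" for x
  proof -
    have "?v x * exp (k * x) * exp (- k * x) = (c / (2 * k) * exp (2 * k * x) + d) * exp (- k * x)"
      using d[OF that] by simp
    then show ?thesis by (simp add: mult.assoc mult_exp_exp distrib_right)
  qed
  have c0: "c = 0"
  proof (rule ccontr)
    assume c: "c \<noteq> 0"
    define K where "K = \<bar>c\<bar> / (2 * k)"
    have K: "0 < K" using c k by (simp add: K_def)
    have "1 \<le> (?v x)\<^sup>2" if x: "x \<ge> (1 + \<bar>d\<bar>) / (K * k)" for x
    proof -
      have "0 < (1 + \<bar>d\<bar>) / (K * k)" using K k by (intro divide_pos_pos) auto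
      then have x0: "0 < x" using x by linarith
      have "1 + \<bar>d\<bar> \<le> K * (k * x)" using x K k by (simp add: pos_divide_le_eq mult_ac)
      also have "\<dots> \<le> K * exp (k * x)"
      proof (rule mult_left_mono)
        show "k * x \<le> exp (k * x)" using exp_ge_add_one_self[of "k * x"] by linarith
      qed (use K in simp)
      also have "\<dots> = \<bar>c / (2 * k) * exp (k * x)\<bar>" using k by (simp add: K_def abs_mult)
      finally have 1: "1 + \<bar>d\<bar> \<le> \<bar>c / (2 * k) * exp (k * x)\<bar>" .
      have "\<bar>d * exp (- k * x)\<bar> \<le> \<bar>d\<bar>" using k x0 by (simp add: abs_mult mult_left_le)
      then have "1 \<le> \<bar>?v x\<bar>" using 1 unfolding v[OF x0] by linarith
      then show ?thesis by (metis one_power2 power2_abs power_mono zero_le_one)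
    qed
    moreover have "0 \<le> (1 + \<bar>d\<bar>) / (K * k)" using K k by simp
    ultimately show False
      by (intro not_integrable_if_bounded_below[OF half_line_L2[OF u e], of 1 "(1 + \<bar>d\<bar>) / (K * k)"]) auto
  qed
  have lim: "?v x = d * exp (- k * x)" if "0 \<le> x" for x
    by (rule half_line_limit[OF u e _ _ that]) (use v c0 in \<open>auto intro!: continuous_intros\<close>)
  show ?thesis using lim[of 0] lim[OF x] by (simp add: k_def)
qed

lemma half_line_mass:
  assumes s: "solves G p W \<rho> \<Lambda> u" and e: "e \<in> half_lines G" and \<Lambda>: "0 < \<Lambda>"
  shows "(LINT x|lebesgue_on {0..}. (on_edge G u e x)\<^sup>2) = (on_edge G u e 0)\<^sup>2 / (2 * sqrt \<Lambda>)"
proof -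
  have u: "u \<in> H1_graph G" using s by (simp add: solves_def)
  have "((\<lambda>x. (on_edge G u e 0)\<^sup>2 * exp (- (2 * sqrt \<Lambda>) * x)) has_integral
      (on_edge G u e 0)\<^sup>2 * (exp (- (2 * sqrt \<Lambda>) * 0) / (2 * sqrt \<Lambda>))) {0..}"
    by (intro has_integral_mult_right has_integral_exp_minus_to_infinity) (use \<Lambda> in auto)
  moreover have "(on_edge G u e 0)\<^sup>2 * exp (- (2 * sqrt \<Lambda>) * x) = (on_edge G u e x)\<^sup>2" if "x \<in> {0..}" for x
    using half_line_exponential[OF s e \<Lambda>, of x] that
    by (simp add: power_mult_distrib power2_eq_square mult_exp_exp)
  ultimately have "((\<lambda>x. (on_edge G u e x)\<^sup>2) has_integral (on_edge G u e 0)\<^sup>2 * (exp (- (2 * sqrt \<Lambda>) * 0) / (2 * sqrt \<Lambda>))) {0..}"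
    by (rule has_integral_eq[rotated])
  then show ?thesis
    using lebesgue_integral_eq_integral[OF half_line_L2[OF u e]] by (simp add: integral_unique)
qed

text \<open>On a half-line \<open>W\<close> and \<open>\<rho>\<close> vanish, so the Hessian at a
  bump is \<open>\<integral>\<phi>'^2 + \<Lambda> \<phi>^2\<close> whatever \<open>u\<close> is. A
  half-line has room for any number of disjoint hats as wide as needed.\<close>

lemma negative_frequency_morse_index:
  assumes u: "u \<in> H1_graph G" and e: "e \<in> half_lines G" and \<Lambda>: "\<Lambda> < 0"
  shows "enat k \<le> morse_index G p W \<rho> \<Lambda> u"
proof -
  note H = half_line_intervals[OF e]
  \<comment> \<open>A hat of half-width \<open>T\<close> has gradient energy \<open>2 / T\<close>
    and is at least \<open>1 / 2\<close> on the middle interval \<open>J\<close> of length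
    \<open>T\<close>. The form is therefore at most \<open>2 / T + \<Lambda> * T / 4\<close>, which
    is negative as soon as \<open>T^2 > 8 / (- \<Lambda>)\<close>; 9 is a convenient choice.\<close>
  define T where "T = 3 / sqrt (- \<Lambda>)"
  have T: "0 < T" "T\<^sup>2 = 9 / (- \<Lambda>)" using \<Lambda> by (auto simp: T_def power_divide)
  define a where "a i = 1 + 2 * T * real i" for i
  define \<phi> where "\<phi> i = trapezoid (a i) (a i + T) (a i + T) (a (Suc i))" for i
  define \<psi> where "\<psi> i = trapezoid_deriv (a i) (a i + T) (a i + T) (a (Suc i))" for i
  have order: "a i < a i + T" "a i + T \<le> a i + T" "a i + T < a (Suc i)" for i
    using T by (auto simp: a_def algebra_simps)
  have len: "a (Suc i) - (a i + T) = T" for i by (simp add: a_def algebra_simps)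
  have pt: "piecewise_test (a i) (a (Suc i)) (\<phi> i) (\<psi> i)" for i
    unfolding \<phi>_def \<psi>_def by (rule piecewise_test_trapezoid[OF order])
  have amono: "a i \<le> a j" if "i \<le> j" for i j using that T by (simp add: a_def)
  have a1: "1 \<le> a i" for i using T by (simp add: a_def)
  have zero: "\<phi> i x = 0 \<and> \<psi> i x = 0" if "x \<notin> {a i<..<a (Suc i)}" for i x
    using that trapezoid_values(1,2)[OF order[of i], of x] order[of i]
    by (auto simp: \<phi>_def \<psi>_def trapezoid_deriv_def)
  have sub: "{1..a k} \<subseteq> open_edge G e" unfolding H by auto
  show ?thesis
  proof (rule morse_index_lower[OF u H(1) a1 sub])
    fix i assume i: "i < k"
    have aik: "a (Suc i) \<le> a k" using i by (intro amono) auto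
    show "piecewise_test 1 (a k) (\<phi> i) (\<psi> i)"
      by (rule piecewise_test_mono[OF pt a1 aik])
    have I: "{a i..a (Suc i)} \<subseteq> interval_of G e" using a1[of i] unfolding H by auto
    have le: "a i \<le> a (Suc i)" using order[of i] by linarith
    define J where "J = {a i + T / 2..a i + 3 * T / 2}"
    have J: "J \<subseteq> {a i..a (Suc i)}" using T by (auto simp: J_def a_def algebra_simps)
    note pf = potential_form_integrable[OF u H(1) I pt]
    have Jm: "integrable (lebesgue_on {a i..a (Suc i)}) (\<lambda>x. indicator J x * (\<Lambda> / 4))"
    proof (rule integrable_lebesgue_on_bounded[where B = "\<bar>\<Lambda> / 4\<bar>"])
      show "(\<lambda>x. indicator J x * (\<Lambda> / 4)) \<in> borel_measurable (lebesgue_on {a i..a (Suc i)})"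
        by (rule borel_measurable_lebesgue_on) (simp add: J_def)
    qed (simp add: indicator_def)
    have "(LINT x|lebesgue_on {1..a k}. (\<psi> i x)\<^sup>2 + potential \<Lambda> u e x * (\<phi> i x)\<^sup>2) =
      (LINT x|lebesgue_on {a i..a (Suc i)}. (\<psi> i x)\<^sup>2 + potential \<Lambda> u e x * (\<phi> i x)\<^sup>2)"
      by (rule integral_lebesgue_on_support) (use a1[of i] aik zero[of _ i] in auto)
    also have "\<dots> \<le> (LINT x|lebesgue_on {a i..a (Suc i)}. 1 / T\<^sup>2 + indicator J x * (\<Lambda> / 4))"
    proof (rule integral_mono_AE)
      show "integrable (lebesgue_on {a i..a (Suc i)}) (\<lambda>x. (\<psi> i x)\<^sup>2 + potential \<Lambda> u e x * (\<phi> i x)\<^sup>2)"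
        using pf by simp
      show "integrable (lebesgue_on {a i..a (Suc i)}) (\<lambda>x. 1 / T\<^sup>2 + indicator J x * (\<Lambda> / 4))"
        by (rule Bochner_Integration.integrable_add[OF _ Jm]) simp
      show "AE x in lebesgue_on {a i..a (Suc i)}. (\<psi> i x)\<^sup>2 + potential \<Lambda> u e x * (\<phi> i x)\<^sup>2 \<le> 1 / T\<^sup>2 + indicator J x * (\<Lambda> / 4)"
        using AE_sub[OF H(1) I W_half[OF e]] AE_sub[OF H(1) I \<rho>_half[OF e]]
      proof eventually_elim
        case (elim x)
        have "\<psi> i x = 1 / T \<or> \<psi> i x = - 1 / T \<or> \<psi> i x = 0"
          unfolding \<psi>_def trapezoid_deriv_def len by auto
        then have "(\<psi> i x)\<^sup>2 \<le> 1 / T\<^sup>2" by (auto simp: power_divide)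
        moreover have "potential \<Lambda> u e x * (\<phi> i x)\<^sup>2 \<le> indicator J x * (\<Lambda> / 4)"
        proof (cases "x \<in> J")
          case True
          have "1 / 2 \<le> \<phi> i x"
          proof (cases "x \<le> a i + T")
            case t: True
            then have "\<phi> i x = (x - a i) / T"
              unfolding \<phi>_def using trapezoid_values(3)[OF order[of i], of x] True T by (auto simp: J_def)
            moreover have "T / 2 \<le> x - a i" using True by (simp add: J_def)
            then have "1 / 2 \<le> (x - a i) / T" using T by (simp add: pos_le_divide_eq)
            ultimately show ?thesis by simp
          next
            case f: False
            then have "\<phi> i x = (a (Suc i) - x) / T"
              unfolding \<phi>_def using trapezoid_values(5)[OF order[of i], of x] True T len[of i] J by auto
            moreover have "T / 2 \<le> a (Suc i) - x" using True len[of i] by (simp add: J_def)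
            then have "1 / 2 \<le> (a (Suc i) - x) / T" using T by (simp add: pos_le_divide_eq)
            ultimately show ?thesis by simp
          qed
          then have "(1 / 2)\<^sup>2 \<le> (\<phi> i x)\<^sup>2" by (intro power_mono) auto
          then have "\<Lambda> * (\<phi> i x)\<^sup>2 \<le> \<Lambda> * (1 / 4)" using \<Lambda> by (simp add: power_divide mult_left_mono_neg)
          then show ?thesis using True elim by (simp add: potential_def)
        next
          case False
          then show ?thesis using elim \<Lambda> by (simp add: potential_def mult_nonpos_nonneg)
        qed
        ultimately show ?case by linarith
      qed
    qed
    also have "\<dots> = 2 / T + \<Lambda> * T / 4"
    proof -
      have "(LINT x|lebesgue_on {a i..a (Suc i)}. indicator J x * (\<Lambda> / 4)) = (LINT x|lebesgue_on J. \<Lambda> / 4)"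
        unfolding J_def by (rule integral_support_indicator) (use J in \<open>simp add: J_def\<close>)
      also have "\<dots> = T * (\<Lambda> / 4)" using T by (simp add: J_def measure_restrict_space)
      finally have 1: "(LINT x|lebesgue_on {a i..a (Suc i)}. indicator J x * (\<Lambda> / 4)) = T * (\<Lambda> / 4)" .
      have 2: "(LINT x|lebesgue_on {a i..a (Suc i)}. 1 / T\<^sup>2) = 2 / T"
        using T(1) by (simp add: a_def measure_restrict_space power2_eq_square algebra_simps)
      show ?thesis by (subst Bochner_Integration.integral_add[OF _ Jm]) (simp, simp only: 1 2, simp)
    qed
    also have "\<dots> < 0"
    proof -
      have "T * (2 / T + \<Lambda> * T / 4) = 2 + \<Lambda> * T\<^sup>2 / 4" using T(1) by (simp add: power2_eq_square algebra_simps)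
      also have "\<dots> < 0" using T(2) \<Lambda> by simp
      finally show ?thesis using T(1) by (simp add: mult_less_0_iff)
    qed
    finally show "(LINT x|lebesgue_on {1..a k}. (\<psi> i x)\<^sup>2 + potential \<Lambda> u e x * (\<phi> i x)\<^sup>2) < 0" .
    fix j x assume j: "j < k" "i \<noteq> j"
    have "a (Suc i) \<le> a j \<or> a (Suc j) \<le> a i" using amono[of "Suc i" j] amono[of "Suc j" i] j by linarith
    then have "x \<notin> {a i<..<a (Suc i)} \<or> x \<notin> {a j<..<a (Suc j)}" by auto
    then show "\<phi> i x * \<phi> j x = 0" "\<psi> i x * \<psi> j x = 0" using zero by auto
  qed
qed

text \<open>Otherwise the star of half-lines at their common origin is open and closed.\<close>

lemma half_line_attached:
  assumes e: "e \<in> half_lines G" and be: "bounded_edges G \<noteq> {}"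
  obtains e' x where "e' \<in> bounded_edges G" "x \<in> interval_of G e'" "edge_pt G e' x = edge_pt G e 0"
proof -
  note attached = that
  define v where "v = origin G e"
  have eE: "e \<in> edges G" using e by (simp add: half_lines_def)
  show thesis
  proof (rule ccontr)
    assume no: "\<not> thesis"
    have not: "edge_pt G e' x \<noteq> Vertex v" if "e' \<in> bounded_edges G" "x \<in> interval_of G e'" for e' x
    proof
      assume "edge_pt G e' x = Vertex v"
      then have "edge_pt G e' x = edge_pt G e 0" by (simp add: edge_pt_def v_def)
      then show False using attached[OF that] no by blast
    qed
    define S where "S = {Vertex v} \<union> {Inner e' x | e' x. e' \<in> half_lines G \<and> origin G e' = v \<and> 0 < x}"
    have pts: "S \<subseteq> points G"
      using fin eE by (auto simp: S_def points_def fin_metric_graph_def v_def half_lines_def)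
    \<comment> \<open>Each closed edge lies either entirely in \<open>S\<close> or entirely outside
      it, and this makes both \<open>S\<close> and its complement open.\<close>
    have pre: "{x \<in> interval_of G e'. edge_pt G e' x \<in> S} = (if e' \<in> half_lines G \<and> origin G e' = v then interval_of G e' else {})"
      if e': "e' \<in> edges G" for e'
    proof (cases "e' \<in> half_lines G")
      case True
      then show ?thesis
        using half_line_intervals[OF True] by (auto simp: S_def edge_pt_def half_lines_def)
    next
      case False
      then have b: "e' \<in> bounded_edges G" using e' by (auto simp: half_lines_def bounded_edges_def)
      have "edge_pt G e' x \<notin> S" if "x \<in> interval_of G e'" for x
        using not[OF b that] False by (auto simp: S_def edge_pt_def split: if_splits)
      then show ?thesis using False by auto
    qed
    have opS: "openin (graph_topology G) S"
      unfolding openin_graph_topology using pts pre by auto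
    have inP: "edge_pt G e' x \<in> points G" if "e' \<in> edges G" "x \<in> interval_of G e'" for e' x
      using edge_pt_in_points[OF that(1) _ _ that(2)] fin that by (auto simp: fin_metric_graph_def bounded_edges_def)
    have "openin (graph_topology G) (points G - S)"
      unfolding openin_graph_topology
    proof (intro conjI ballI)
      fix e' assume e': "e' \<in> edges G"
      have "{x \<in> interval_of G e'. edge_pt G e' x \<in> points G - S} = interval_of G e' - {x \<in> interval_of G e'. edge_pt G e' x \<in> S}"
        using inP[OF e'] by auto
      then show "openin (top_of_set (interval_of G e')) {x \<in> interval_of G e'. edge_pt G e' x \<in> points G - S}"
        using pre[OF e'] by auto
    qed auto
    then have "closedin (graph_topology G) S"
      using pts by (simp add: closedin_def topspace_graph_topology[OF fin])
    moreover have "connected_space (graph_topology G)" using fin by (simp add: fin_metric_graph_def)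
    ultimately have "S = {} \<or> S = points G"
      using opS connected_space_clopen_in topspace_graph_topology[OF fin] by metis
    then have SP: "S = points G" by (auto simp: S_def)
    obtain e' where e': "e' \<in> bounded_edges G" using be by blast
    then have e'E: "e' \<in> edges G" "e' \<notin> half_lines G" by (auto simp: bounded_edges_def half_lines_def)
    have "0 \<in> interval_of G e'" by (rule interval_of_cases[OF fin e'E(1)]) auto
    then have "edge_pt G e' 0 \<in> S" using inP[OF e'E(1)] SP by blast
    then have "edge_pt G e' 0 = Vertex v" by (auto simp: S_def edge_pt_def)
    then show False using not[OF e' \<open>0 \<in> interval_of G e'\<close>] by simp
  qed
qed

end

section \<open>Bounds in terms of the Morse index\<close>

context nls_graph
begin

text \<open>With \<open>q = sqrt \<Lambda>\<close> and \<open>R^2 = 8 (p-1)/(p-2)\<close>, cells of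
  length between \<open>R / q\<close> and \<open>2 * R / q\<close> satisfy the requirement of
  \<open>bounded_edge_L2\<close> and produce the factor \<open>1 / q\<close>. If the edge is shorter
  than one such cell, or if \<open>\<Lambda> < 2 * B\<close>, then \<open>l * q\<close> is bounded
  by a constant and the trivial estimate \<open>l * U^2\<close> has the same form.\<close>

lemma bounded_edge_mass:
  assumes s: "solves G p W \<rho> \<Lambda> u" and m: "morse_index G p W \<rho> \<Lambda> u \<le> enat m" and \<Lambda>: "0 < \<Lambda>"
    and e: "e \<in> edges G" "edge_length G e = ereal l" and U: "\<And>x. x \<in> {0..l} \<Longrightarrow> \<bar>on_edge G u e x\<bar> \<le> U"
  shows "(LINT x|lebesgue_on {0..l}. (on_edge G u e x)\<^sup>2)
    \<le> (4 * (3 * real m + 4) * sqrt (8 * ((p - 1) / (p - 2))) + l * sqrt (2 * B)) * (U\<^sup>2 / sqrt \<Lambda>)"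
proof -
  let ?v = "on_edge G u e"
  have u: "u \<in> H1_graph G" using s by (simp add: solves_def)
  have l0: "0 < l" and I: "interval_of G e = {0..l}"
    using interval_of_cases[OF fin e(1)] e(2) by auto
  define q where "q = sqrt \<Lambda>"
  have q: "0 < q" "q\<^sup>2 = \<Lambda>" using \<Lambda> by (auto simp: q_def)
  define R where "R = sqrt (8 * ((p - 1) / (p - 2)))"
  have R: "0 < R" "R\<^sup>2 = 8 * ((p - 1) / (p - 2))" using p by (auto simp: R_def)
  define V where "V = U\<^sup>2 / q"
  have V: "0 \<le> V" using q by (simp add: V_def)
  have trivial: "(LINT x|lebesgue_on {0..l}. (?v x)\<^sup>2) \<le> (l * q) * V"
  proof -
    have vc: "continuous_on {0..l} ?v" using on_edge_continuous[OF u e(1)] I by simp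
    have "(LINT x|lebesgue_on {0..l}. (?v x)\<^sup>2) \<le> (LINT x|lebesgue_on {0..l}. U\<^sup>2)"
    proof (rule integral_mono)
      show "integrable (lebesgue_on {0..l}) (\<lambda>x. (?v x)\<^sup>2)"
        by (intro continuous_imp_integrable_real continuous_intros vc)
      fix x assume "x \<in> space (lebesgue_on {0..l})"
      then have "\<bar>?v x\<bar> \<le> U" using U by auto
      then show "(?v x)\<^sup>2 \<le> U\<^sup>2" by (metis abs_ge_zero power2_abs power_mono)
    qed simp
    also have "\<dots> = (l * q) * V" using l0 q by (simp add: measure_restrict_space V_def)
    finally show ?thesis .
  qed
  have pos: "0 \<le> 4 * (3 * real m + 4) * R" "0 \<le> l * sqrt (2 * B)" using R l0 B by auto
  consider "\<Lambda> < 2 * B" | "2 * B \<le> \<Lambda>" "l * q < R" | "2 * B \<le> \<Lambda>" "R \<le> l * q" by linarith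
  then have "(LINT x|lebesgue_on {0..l}. (?v x)\<^sup>2) \<le> (4 * (3 * real m + 4) * R + l * sqrt (2 * B)) * V"
  proof cases
    case 1
    then have "l * q \<le> l * sqrt (2 * B)" using l0 by (simp add: q_def)
    then have "l * q \<le> 4 * (3 * real m + 4) * R + l * sqrt (2 * B)" using pos by linarith
    then show ?thesis using trivial V by (meson mult_right_mono order_trans)
  next
    case 2
    have "R \<le> 4 * (3 * real m + 4) * R" using R by simp
    then have "l * q \<le> 4 * (3 * real m + 4) * R + l * sqrt (2 * B)" using pos 2 by linarith
    then show ?thesis using trivial V by (meson mult_right_mono order_trans)
  next
    case 3
    \<comment> \<open>Rounding down keeps the cells at least \<open>R / q\<close> long; since the
      quotient is at least 1, it loses at most a factor 2.\<close>
    define n where "n = nat \<lfloor>l * q / R\<rfloor>"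
    have ge1: "1 \<le> l * q / R" using 3 R by simp
    then have n1: "1 \<le> \<lfloor>l * q / R\<rfloor>" by (simp add: le_floor_iff)
    then have n: "0 < n" and rn: "real n = of_int \<lfloor>l * q / R\<rfloor>" by (auto simp: n_def)
    have nle: "real n \<le> l * q / R" unfolding rn by (rule of_int_floor_le)
    have "l * q / R < real n + 1" unfolding rn by linarith
    also have "\<dots> \<le> 2 * real n" using n by simp
    finally have nge: "l * q \<le> 2 * real n * R" using R by (simp add: pos_divide_less_eq)
    have d1: "8 * ((p - 1) / (p - 2)) \<le> \<Lambda> * (l / real n)\<^sup>2"
    proof -
      have "R \<le> l * q / real n" using nle n R by (simp add: field_simps)
      then have "R\<^sup>2 \<le> (l * q / real n)\<^sup>2" using R by (intro power_mono) auto
      also have "\<dots> = \<Lambda> * (l / real n)\<^sup>2" by (simp add: power_divide power_mult_distrib q)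
      finally show ?thesis using R by simp
    qed
    have "(LINT x|lebesgue_on {0..l}. (?v x)\<^sup>2) \<le> 2 * (3 * real m + 4) * (l / real n * U\<^sup>2)"
      by (rule bounded_edge_L2[OF s m 3(1) e U n d1])
    also have "l / real n * U\<^sup>2 = (l * q / real n) * V" using q by (simp add: V_def)
    also have "2 * (3 * real m + 4) * ((l * q / real n) * V) \<le> 2 * (3 * real m + 4) * ((2 * R) * V)"
      using nge n V by (intro mult_left_mono mult_right_mono) (auto simp: pos_divide_le_eq mult_ac)
    also have "\<dots> = 4 * (3 * real m + 4) * R * V" by (simp add: algebra_simps)
    also have "\<dots> \<le> (4 * (3 * real m + 4) * R + l * sqrt (2 * B)) * V"
      using pos V by (intro mult_right_mono) auto
    finally show ?thesis .
  qed
  then show ?thesis by (simp add: R_def V_def q_def)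
qed

section \<open>Constants for the whole graph\<close>

lemma edge_cases: "edges G = bounded_edges G \<union> half_lines G" "bounded_edges G \<inter> half_lines G = {}"
  by (auto simp: bounded_edges_def half_lines_def)

lemma finite_edges: "finite (edges G)" "finite (bounded_edges G)"
  using fin edge_cases(1) by (auto simp: fin_metric_graph_def)

lemma bounded_edge_length:
  assumes "e \<in> bounded_edges G"
  shows "edge_length G e = ereal (real_of_ereal (edge_length G e))" "0 < real_of_ereal (edge_length G e)"
    "interval_of G e = {0..real_of_ereal (edge_length G e)}"
proof -
  have e: "e \<in> edges G" using assms by (simp add: bounded_edges_def)
  have "edge_length G e \<noteq> \<infinity>" using assms by (auto simp: bounded_edges_def)
  then obtain l where "edge_length G e = ereal l" "0 < l" "interval_of G e = {0..l}"
    by (rule_tac interval_of_cases[OF fin e]) auto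
  then show "edge_length G e = ereal (real_of_ereal (edge_length G e))" "0 < real_of_ereal (edge_length G e)"
    "interval_of G e = {0..real_of_ereal (edge_length G e)}"
    by simp_all
qed

lemma solution_bound:
  fixes m :: nat
  assumes be: "bounded_edges G \<noteq> {}"
  obtains C L where "0 \<le> C" "0 \<le> L" "\<And>\<Lambda> u e x. solves G p W \<rho> \<Lambda> u \<Longrightarrow> morse_index G p W \<rho> \<Lambda> u \<le> enat m \<Longrightarrow> 0 \<le> \<Lambda>
    \<Longrightarrow> e \<in> edges G \<Longrightarrow> x \<in> interval_of G e \<Longrightarrow> \<bar>on_edge G u e x\<bar> \<le> C * (L + \<Lambda>) powr (1 / (p - 2))"
proof -
  obtain C where C: "0 \<le> C" "\<And>\<Lambda> u e l x. solves G p W \<rho> \<Lambda> u \<Longrightarrow> morse_index G p W \<rho> \<Lambda> u \<le> enat m \<Longrightarrow> 0 \<le> \<Lambda>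
    \<Longrightarrow> e \<in> edges G \<Longrightarrow> edge_length G e = ereal l \<Longrightarrow> x \<in> {0..l} \<Longrightarrow>
    \<bar>on_edge G u e x\<bar> \<le> C * (4 / l\<^sup>2 + B + \<Lambda>) powr (1 / (p - 2))"
    using sup_bound by blast
  \<comment> \<open>The sum over all bounded edges dominates each single \<open>4 / l^2\<close>, so
    one constant serves every edge.\<close>
  define L where "L = (\<Sum>e\<in>bounded_edges G. 4 / (real_of_ereal (edge_length G e))\<^sup>2) + B"
  have L0: "0 \<le> L" using B by (auto simp: L_def intro!: add_nonneg_nonneg sum_nonneg)
  have bounded: "\<bar>on_edge G u e x\<bar> \<le> C * (L + \<Lambda>) powr (1 / (p - 2))"
    if s: "solves G p W \<rho> \<Lambda> u" and m: "morse_index G p W \<rho> \<Lambda> u \<le> enat m" and \<Lambda>: "0 \<le> \<Lambda>"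
      and e: "e \<in> bounded_edges G" and x: "x \<in> interval_of G e" for \<Lambda> u e x
  proof -
    note le = bounded_edge_length[OF e]
    have eE: "e \<in> edges G" using e by (simp add: bounded_edges_def)
    have "\<bar>on_edge G u e x\<bar> \<le> C * (4 / (real_of_ereal (edge_length G e))\<^sup>2 + B + \<Lambda>) powr (1 / (p - 2))"
      by (rule C(2)[OF s m \<Lambda> eE le(1)]) (use x le(3) in simp)
    also have "\<dots> \<le> C * (L + \<Lambda>) powr (1 / (p - 2))"
    proof (intro mult_left_mono powr_mono2)
      show "4 / (real_of_ereal (edge_length G e))\<^sup>2 + B + \<Lambda> \<le> L + \<Lambda>"
        unfolding L_def using finite_edges(2) e
        by (auto intro!: member_le_sum[of e _ "\<lambda>e. 4 / (real_of_ereal (edge_length G e))\<^sup>2"])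
    qed (use C \<Lambda> B p in auto)
    finally show ?thesis .
  qed
  have "\<bar>on_edge G u e x\<bar> \<le> C * (L + \<Lambda>) powr (1 / (p - 2))"
    if s: "solves G p W \<rho> \<Lambda> u" and m: "morse_index G p W \<rho> \<Lambda> u \<le> enat m" and \<Lambda>: "0 \<le> \<Lambda>"
      and e: "e \<in> edges G" and x: "x \<in> interval_of G e" for \<Lambda> u e x
  proof (cases "e \<in> bounded_edges G")
    case True
    then show ?thesis by (rule bounded[OF s m \<Lambda> _ x])
  next
    case False
    then have h: "e \<in> half_lines G" using e edge_cases by auto
    \<comment> \<open>The origin of the half-line also lies on a bounded edge, where the bound is
      known, and \<open>|u|\<close> does not increase along the half-line.\<close>
    obtain e' x' where e': "e' \<in> bounded_edges G" "x' \<in> interval_of G e'" "edge_pt G e' x' = edge_pt G e 0"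
      using half_line_attached[OF h be] by blast
    have 0: "\<bar>on_edge G u e 0\<bar> \<le> C * (L + \<Lambda>) powr (1 / (p - 2))"
      using bounded[OF s m \<Lambda> e'(1,2)] e'(3) by (simp add: on_edge_def)
    have x0: "0 \<le> x" using x half_line_intervals[OF h] by simp
    have "\<bar>on_edge G u e x\<bar> \<le> \<bar>on_edge G u e 0\<bar>"
    proof (cases "\<Lambda> = 0")
      case True
      then show ?thesis using half_line_zero[of u e x] s h x by simp
    next
      case False
      then have "on_edge G u e x = on_edge G u e 0 * exp (- sqrt \<Lambda> * x)"
        using \<Lambda> by (intro half_line_exponential[OF s h _ x0]) auto
      then show ?thesis using \<Lambda> x0 by (simp add: abs_mult mult_left_le)
    qed
    then show ?thesis using 0 by linarith
  qed
  with C(1) L0 show thesis using that by blast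
qed

text \<open>For positive frequency, bounded edges and half-lines alike contribute a multiple of
  \<open>M^2 / sqrt \<Lambda>\<close>. At frequency 0 the half-lines contribute nothing and a
  bounded edge at most its length times \<open>M^2\<close>. The case distinction is made because
  \<open>0 powr (- 1 / 4)\<close> is 0.\<close>

lemma solution_mass:
  fixes m :: nat
  obtains K where "0 \<le> K" "\<And>\<Lambda> u M. solves G p W \<rho> \<Lambda> u \<Longrightarrow> morse_index G p W \<rho> \<Lambda> u \<le> enat m \<Longrightarrow> 0 \<le> \<Lambda> \<Longrightarrow> 0 \<le> M \<Longrightarrow>
    (\<And>e x. e \<in> edges G \<Longrightarrow> x \<in> interval_of G e \<Longrightarrow> \<bar>on_edge G u e x\<bar> \<le> M) \<Longrightarrow>
    L2_norm_graph G u \<le> K * M * (if \<Lambda> = 0 then 1 else \<Lambda> powr (- 1 / 4))"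
proof -
  define len where "len e = real_of_ereal (edge_length G e)" for e
  \<comment> \<open>The first two summands come from \<open>bounded_edge_mass\<close>; the last
    \<open>len e\<close> serves the frequency 0.\<close>
  define k where "k e = (if e \<in> bounded_edges G then 4 * (3 * real m + 4) * sqrt (8 * ((p - 1) / (p - 2))) + len e * sqrt (2 * B) + len e else 1)" for e
  have len0: "0 < len e" if "e \<in> bounded_edges G" for e using bounded_edge_length(2)[OF that] by (simp add: len_def)
  have k0: "0 \<le> k e" for e
    using len0[of e] B p by (auto simp: k_def intro!: add_nonneg_nonneg mult_nonneg_nonneg)
  define K where "K = sqrt (\<Sum>e\<in>edges G. k e)"
  have K0: "0 \<le> K" by (auto simp: K_def intro!: sum_nonneg k0)
  have "L2_norm_graph G u \<le> K * M * (if \<Lambda> = 0 then 1 else \<Lambda> powr (- 1 / 4))"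
    if s: "solves G p W \<rho> \<Lambda> u" and m: "morse_index G p W \<rho> \<Lambda> u \<le> enat m" and \<Lambda>: "0 \<le> \<Lambda>" and M: "0 \<le> M"
      "\<And>e x. e \<in> edges G \<Longrightarrow> x \<in> interval_of G e \<Longrightarrow> \<bar>on_edge G u e x\<bar> \<le> M" for \<Lambda> u M
  proof -
    have u: "u \<in> H1_graph G" using s by (simp add: solves_def)
    define t where "t = (if \<Lambda> = 0 then 1 else \<Lambda> powr (- 1 / 4))"
    have t0: "0 \<le> t" by (simp add: t_def)
    have t2: "t\<^sup>2 = (if \<Lambda> = 0 then 1 else 1 / sqrt \<Lambda>)"
    proof (cases "\<Lambda> = 0")
      case False
      then have "t\<^sup>2 = \<Lambda> powr (- 1 / 4) * \<Lambda> powr (- 1 / 4)" by (simp add: t_def power2_eq_square)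
      also have "\<dots> = \<Lambda> powr (- (1 / 2))" by (simp flip: powr_add)
      also have "\<dots> = 1 / sqrt \<Lambda>" using \<Lambda> False by (simp add: powr_minus_divide powr_half_sqrt)
      finally show ?thesis using False by simp
    qed (simp add: t_def)
    have edge: "(LINT x|lebesgue_on (interval_of G e). (on_edge G u e x)\<^sup>2) \<le> k e * (M\<^sup>2 * t\<^sup>2)" if e: "e \<in> edges G" for e
    proof (cases "e \<in> bounded_edges G")
      case True
      note le = bounded_edge_length[OF True, folded len_def]
      have UM: "\<bar>on_edge G u e x\<bar> \<le> M" if "x \<in> {0..len e}" for x using M(2)[OF e] le(3) that by simp
      show ?thesis
      proof (cases "\<Lambda> = 0")
        case z: True
        have vc: "continuous_on {0..len e} (on_edge G u e)" using on_edge_continuous[OF u e] le by simp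
        have "(LINT x|lebesgue_on {0..len e}. (on_edge G u e x)\<^sup>2) \<le> (LINT x|lebesgue_on {0..len e}. M\<^sup>2)"
        proof (rule integral_mono)
          show "integrable (lebesgue_on {0..len e}) (\<lambda>x. (on_edge G u e x)\<^sup>2)"
            by (intro continuous_imp_integrable_real continuous_intros vc)
          fix x assume "x \<in> space (lebesgue_on {0..len e})"
          then have "\<bar>on_edge G u e x\<bar> \<le> M" using UM by auto
          then show "(on_edge G u e x)\<^sup>2 \<le> M\<^sup>2" by (metis abs_ge_zero power2_abs power_mono)
        qed simp
        also have "\<dots> = len e * M\<^sup>2" using le by (simp add: measure_restrict_space)
        also have "\<dots> \<le> k e * M\<^sup>2"
          using True len0[OF True] B p by (intro mult_right_mono) (auto simp: k_def intro!: add_nonneg_nonneg mult_nonneg_nonneg)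
        finally show ?thesis using z t2 le(3) by simp
      next
        case nz: False
        then have \<Lambda>': "0 < \<Lambda>" using \<Lambda> by simp
        have "(LINT x|lebesgue_on {0..len e}. (on_edge G u e x)\<^sup>2)
          \<le> (4 * (3 * real m + 4) * sqrt (8 * ((p - 1) / (p - 2))) + len e * sqrt (2 * B)) * (M\<^sup>2 / sqrt \<Lambda>)"
          by (rule bounded_edge_mass[OF s m \<Lambda>' e le(1) UM])
        also have "\<dots> \<le> k e * (M\<^sup>2 / sqrt \<Lambda>)"
          using True len0[OF True] \<Lambda>' by (intro mult_right_mono) (auto simp: k_def)
        finally show ?thesis using nz t2 le(3) by simp
      qed
    next
      case False
      then have h: "e \<in> half_lines G" using e edge_cases by auto
      note H = half_line_intervals[OF h]
      show ?thesis
      proof (cases "\<Lambda> = 0")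
        case True
        have "(LINT x|lebesgue_on (interval_of G e). (on_edge G u e x)\<^sup>2) = (LINT x|lebesgue_on (interval_of G e). 0)"
          using half_line_zero[of u e] s h True H by (intro Bochner_Integration.integral_cong) auto
        then show ?thesis using k0[of e] by (simp add: mult_nonneg_nonneg)
      next
        case nz: False
        then have \<Lambda>': "0 < \<Lambda>" using \<Lambda> by simp
        have "(LINT x|lebesgue_on (interval_of G e). (on_edge G u e x)\<^sup>2) = (on_edge G u e 0)\<^sup>2 / (2 * sqrt \<Lambda>)"
          using half_line_mass[OF s h \<Lambda>'] H by simp
        also have "\<dots> \<le> M\<^sup>2 / (2 * sqrt \<Lambda>)"
        proof (rule divide_right_mono)
          have "\<bar>on_edge G u e 0\<bar> \<le> M" using M(2)[OF e, of 0] H by simp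
          then show "(on_edge G u e 0)\<^sup>2 \<le> M\<^sup>2" by (metis abs_ge_zero power2_abs power_mono)
        qed (use \<Lambda>' in simp)
        also have "\<dots> \<le> M\<^sup>2 / sqrt \<Lambda>" using \<Lambda>' by (simp add: divide_left_mono)
        finally show ?thesis using nz False t2 by (simp add: k_def)
      qed
    qed
    have "graph_integral G (\<lambda>e x. (on_edge G u e x)\<^sup>2) \<le> (\<Sum>e\<in>edges G. k e * (M\<^sup>2 * t\<^sup>2))"
      unfolding graph_integral_def by (rule sum_mono) (rule edge)
    also have "\<dots> = (\<Sum>e\<in>edges G. k e) * (M * t)\<^sup>2" by (simp add: sum_distrib_right power_mult_distrib)
    finally have "L2_norm_graph G u \<le> sqrt ((\<Sum>e\<in>edges G. k e) * (M * t)\<^sup>2)"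
      unfolding L2_norm_graph_def by (rule real_sqrt_le_mono)
    also have "\<dots> = K * M * t" using M(1) t0 by (simp add: real_sqrt_mult K_def)
    finally show ?thesis by (simp add: t_def)
  qed
  with K0 show thesis using that by blast
qed

end

section \<open>From the extended-real hypotheses to real constants\<close>

lemma q_max_le:
  assumes "\<And>u. solves G p W \<rho> \<Lambda> u \<Longrightarrow> morse_index G p W \<rho> \<Lambda> u \<le> enat m \<Longrightarrow> L2_norm_graph G u \<le> c" "0 \<le> c"
  shows "q_max G p W \<rho> m \<Lambda> \<le> ereal c"
proof -
  have "Sup (mass_set G p W \<rho> m \<Lambda>) \<le> ereal c"
    using assms(1) by (intro Sup_least) (auto simp: mass_set_def)
  \<comment> \<open>\<open>0 \<le> c\<close> takes care of the empty set of masses, where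
    \<open>q_max\<close> is 0 by convention.\<close>
  then show ?thesis using assms(2) by (simp add: q_max_def)
qed

lemma Linf_graph_bound:
  assumes f: "f \<in> Linf_graph G"
  obtains b where "\<And>e. e \<in> edges G \<Longrightarrow> AE x in lebesgue_on (interval_of G e). \<bar>on_edge G f e x\<bar> \<le> b"
proof -
  have "Linf_norm_graph G f < \<infinity>" using f by (simp add: Linf_graph_def)
  then obtain b where b: "Linf_norm_graph G f \<le> ereal b"
    by (cases "Linf_norm_graph G f") auto
  have "AE x in lebesgue_on (interval_of G e). \<bar>on_edge G f e x\<bar> \<le> b" if e: "e \<in> edges G" for e
  proof -
    have le: "esssup (lebesgue_on (interval_of G e)) (\<lambda>x. ereal \<bar>on_edge G f e x\<bar>) \<le> ereal b"
      using b e unfolding Linf_norm_graph_def by (meson SUP_upper order_trans)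
    show ?thesis
      using esssup_AE[of "\<lambda>x. ereal \<bar>on_edge G f e x\<bar>" "lebesgue_on (interval_of G e)"]
    proof eventually_elim
      case (elim x)
      then have "ereal \<bar>on_edge G f e x\<bar> \<le> ereal b" using le by (rule order_trans)
      then show ?case by simp
    qed
  qed
  then show thesis using that by blast
qed

lemma essinf_core_bound:
  assumes "0 < essinf_core G f"
  obtains c where "0 < c" "\<And>e. e \<in> bounded_edges G \<Longrightarrow> AE x in lebesgue_on (interval_of G e). c \<le> on_edge G f e x"
proof -
  \<comment> \<open>The essential infimum is an extended real; any real number strictly between 0
    and it will do.\<close>
  obtain c where c: "0 < ereal c" "ereal c < essinf_core G f"
    using ereal_dense2[OF assms] by blast
  have "AE x in lebesgue_on (interval_of G e). c \<le> on_edge G f e x" if e: "e \<in> bounded_edges G" for e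
  proof -
    have "essinf_core G f \<le> - esssup (lebesgue_on (interval_of G e)) (\<lambda>x. - ereal (on_edge G f e x))"
      unfolding essinf_core_def by (rule INF_lower[OF e])
    then have "ereal c \<le> - esssup (lebesgue_on (interval_of G e)) (\<lambda>x. - ereal (on_edge G f e x))"
      using c(2) by (simp add: less_imp_le order_trans)
    then have le: "esssup (lebesgue_on (interval_of G e)) (\<lambda>x. - ereal (on_edge G f e x)) \<le> - ereal c"
      using ereal_uminus_le_reorder ereal_minus_le_minus by (metis ereal_uminus_uminus)
    show ?thesis
      using esssup_AE[of "\<lambda>x. - ereal (on_edge G f e x)" "lebesgue_on (interval_of G e)"]
    proof eventually_elim
      case (elim x)
      then have "- ereal (on_edge G f e x) \<le> - ereal c" using le by (rule order_trans)
      then show ?case by simp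
    qed
  qed
  moreover have "0 < c" using c(1) by simp
  ultimately show thesis using that by blast
qed

lemma Linf_norm_graph_le:
  assumes G: "fin_metric_graph G" and u: "u \<in> H1_graph G"
    and le: "\<And>e x. e \<in> edges G \<Longrightarrow> x \<in> interval_of G e \<Longrightarrow> \<bar>on_edge G u e x\<bar> \<le> c"
  shows "Linf_norm_graph G u \<le> ereal c"
  unfolding Linf_norm_graph_def
proof (rule SUP_least)
  fix e assume e: "e \<in> edges G"
  have [measurable]: "on_edge G u e \<in> borel_measurable (lebesgue_on (interval_of G e))"
    using u e by (auto simp: H1_graph_def H1_fun_def L2_fun_def)
  show "esssup (lebesgue_on (interval_of G e)) (\<lambda>x. ereal \<bar>on_edge G u e x\<bar>) \<le> ereal c"
  proof (rule esssup_I)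
    show "AE x in lebesgue_on (interval_of G e). ereal \<bar>on_edge G u e x\<bar> \<le> ereal c"
      using le[OF e] by (auto simp: AE_lebesgue_on_iff[OF interval_of_facts(2)[OF G e]])
  qed measurable
qed

theorem theorem4p23:
  fixes G :: "('v, 'e) metric_graph"
    and p \<Lambda>0 :: real
    and m :: nat
    and W \<rho> :: "('v, 'e) gpoint \<Rightarrow> real"
  assumes "fin_metric_graph G"
    and "half_lines G \<noteq> {}"
    and "bounded_edges G \<noteq> {}"
    and "p > 2"
    and "m > 0"
    and "W \<in> Linf_graph G"
    and "\<rho> \<in> Linf_graph G"
    and "essinf_core G \<rho> > 0"
    and "zero_on_half_lines G W"
    and "zero_on_half_lines G \<rho>"
    and "\<Lambda>0 > 0"
  shows "\<exists>C::real. C > 0 \<and> (\<forall>\<Lambda>::real.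
    (\<Lambda> < 0 \<longrightarrow> q_max G p W \<rho> m \<Lambda> = 0) \<and>
    (\<forall>u \<in> H1_graph G. 0 \<le> \<Lambda> \<and> \<Lambda> \<le> \<Lambda>0 \<and> solves G p W \<rho> \<Lambda> u \<and>
        morse_index G p W \<rho> \<Lambda> u \<le> enat m \<longrightarrow> Linf_norm_graph G u \<le> ereal C) \<and>
    (q_max G p W \<rho> m 0 \<le> ereal C \<and>
     (\<forall>u \<in> H1_graph G. solves G p W \<rho> 0 u \<and> morse_index G p W \<rho> 0 u \<le> enat m \<longrightarrow>
        (\<forall>e \<in> half_lines G. \<forall>x \<in> interval_of G e. on_edge G u e x = 0))) \<and>
    (0 < \<Lambda> \<and> \<Lambda> \<le> \<Lambda>0 \<longrightarrow> q_max G p W \<rho> m \<Lambda> \<le> ereal (C * \<Lambda> powr (- 1 / 4))) \<and>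
    (\<Lambda> \<ge> \<Lambda>0 \<longrightarrow>
       q_max G p W \<rho> m \<Lambda> \<le> ereal (C * \<Lambda> powr ((6 - p) / (4 * (p - 2))))))"
proof -
  obtain b1 where b1: "\<And>e. e \<in> edges G \<Longrightarrow> AE x in lebesgue_on (interval_of G e). \<bar>on_edge G W e x\<bar> \<le> b1"
    using Linf_graph_bound[OF \<open>W \<in> Linf_graph G\<close>] by blast
  obtain b2 where b2: "\<And>e. e \<in> edges G \<Longrightarrow> AE x in lebesgue_on (interval_of G e). \<bar>on_edge G \<rho> e x\<bar> \<le> b2"
    using Linf_graph_bound[OF \<open>\<rho> \<in> Linf_graph G\<close>] by blast
  obtain \<rho>0 where \<rho>0: "0 < \<rho>0" "\<And>e. e \<in> bounded_edges G \<Longrightarrow> AE x in lebesgue_on (interval_of G e). \<rho>0 \<le> on_edge G \<rho> e x"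
    using essinf_core_bound[OF \<open>essinf_core G \<rho> > 0\<close>] by blast
  \<comment> \<open>The absolute values and the summand 1 make \<open>B\<close> positive and at
    least as large as both bounds, whatever their signs.\<close>
  define B where "B = 1 + \<bar>b1\<bar> + \<bar>b2\<bar>"
  interpret nls_graph G p B \<rho>0 W \<rho>
  proof
    show "AE x in lebesgue_on (interval_of G e). \<bar>on_edge G W e x\<bar> \<le> B" if "e \<in> edges G" for e
      using b1[OF that] by eventually_elim (simp add: B_def)
    show "AE x in lebesgue_on (interval_of G e). \<bar>on_edge G \<rho> e x\<bar> \<le> B" if "e \<in> edges G" for e
      using b2[OF that] by eventually_elim (simp add: B_def)
    show "AE x in lebesgue_on (interval_of G e). \<rho>0 \<le> on_edge G \<rho> e x" if "e \<in> bounded_edges G" for e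
      by (rule \<rho>0(2)[OF that])
  qed (use assms \<rho>0 in \<open>auto simp: B_def Linf_graph_def zero_on_half_lines_def\<close>)
  obtain C0 L where C0: "0 \<le> C0" and L: "0 \<le> L"
    and bound: "\<And>\<Lambda> u e x. solves G p W \<rho> \<Lambda> u \<Longrightarrow> morse_index G p W \<rho> \<Lambda> u \<le> enat m \<Longrightarrow> 0 \<le> \<Lambda>
    \<Longrightarrow> e \<in> edges G \<Longrightarrow> x \<in> interval_of G e \<Longrightarrow> \<bar>on_edge G u e x\<bar> \<le> C0 * (L + \<Lambda>) powr (1 / (p - 2))"
    using solution_bound[OF assms(3)] by blast
  obtain K where K: "0 \<le> K"
    and mass: "\<And>\<Lambda> u M. solves G p W \<rho> \<Lambda> u \<Longrightarrow> morse_index G p W \<rho> \<Lambda> u \<le> enat m \<Longrightarrow> 0 \<le> \<Lambda> \<Longrightarrow> 0 \<le> M \<Longrightarrow>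
    (\<And>e x. e \<in> edges G \<Longrightarrow> x \<in> interval_of G e \<Longrightarrow> \<bar>on_edge G u e x\<bar> \<le> M) \<Longrightarrow>
    L2_norm_graph G u \<le> K * M * (if \<Lambda> = 0 then 1 else \<Lambda> powr (- 1 / 4))"
    using solution_mass by blast
  define M0 where "M0 = C0 * (L + \<Lambda>0) powr (1 / (p - 2))"
  have M0: "0 \<le> M0" using C0 by (simp add: M0_def)
  have bound0: "\<bar>on_edge G u e x\<bar> \<le> M0"
    if "solves G p W \<rho> \<Lambda> u" "morse_index G p W \<rho> \<Lambda> u \<le> enat m" "0 \<le> \<Lambda>" "\<Lambda> \<le> \<Lambda>0" "e \<in> edges G" "x \<in> interval_of G e" for \<Lambda> u e x
  proof -
    have "C0 * (L + \<Lambda>) powr (1 / (p - 2)) \<le> M0"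
      unfolding M0_def using that L C0 p by (intro mult_left_mono powr_mono2) auto
    then show ?thesis using bound[OF that(1,2,3,5,6)] by linarith
  qed
  \<comment> \<open>For \<open>\<Lambda> \<ge> \<Lambda>0\<close> one has
    \<open>L + \<Lambda> \<le> (L / \<Lambda>0 + 1) * \<Lambda>\<close>, so the additive constant
    \<open>L\<close> becomes a multiplicative one. This is where the dependence on
    \<open>\<Lambda>0\<close> enters for large frequencies.\<close>
  define M1 where "M1 = C0 * (L / \<Lambda>0 + 1) powr (1 / (p - 2))"
  have M1: "0 \<le> M1" using C0 by (simp add: M1_def)
  \<comment> \<open>The sum dominates the constants of all the claims at once: \<open>M0\<close> for
    the supremum, \<open>K * M0\<close> for frequencies up to \<open>\<Lambda>0\<close>, and
    \<open>K * M1\<close> beyond.\<close>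
  define C where "C = 1 + M0 + K * M0 + K * M1"
  have C: "0 < C" "M0 \<le> C" "K * M0 \<le> C" "K * M1 \<le> C"
    using M0 M1 K mult_nonneg_nonneg[OF K M0] mult_nonneg_nonneg[OF K M1] unfolding C_def by linarith+
  show ?thesis
  proof (intro exI[of _ C] conjI allI impI ballI C(1))
    fix \<Lambda> :: real assume neg: "\<Lambda> < 0"
    obtain e where e: "e \<in> half_lines G" using assms(2) by blast
    have "\<not> morse_index G p W \<rho> \<Lambda> u \<le> enat m" if "u \<in> H1_graph G" for u
    proof
      assume "morse_index G p W \<rho> \<Lambda> u \<le> enat m"
      with negative_frequency_morse_index[OF that e neg, of "Suc m"]
      have "enat (Suc m) \<le> enat m" by (rule order_trans)
      then show False by simp
    qed
    then have "mass_set G p W \<rho> m \<Lambda> = {}" by (auto simp: mass_set_def)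
    then show "q_max G p W \<rho> m \<Lambda> = 0" by (simp add: q_max_def)
  next
    fix \<Lambda> u assume u: "u \<in> H1_graph G"
      and "0 \<le> \<Lambda> \<and> \<Lambda> \<le> \<Lambda>0 \<and> solves G p W \<rho> \<Lambda> u \<and> morse_index G p W \<rho> \<Lambda> u \<le> enat m"
    then have "Linf_norm_graph G u \<le> ereal M0"
      by (intro Linf_norm_graph_le[OF fin u] bound0) auto
    also have "\<dots> \<le> ereal C" using C by simp
    finally show "Linf_norm_graph G u \<le> ereal C" .
  next
    show "q_max G p W \<rho> m 0 \<le> ereal C"
    proof (rule q_max_le)
      fix u assume u: "solves G p W \<rho> 0 u" "morse_index G p W \<rho> 0 u \<le> enat m"
      have "L2_norm_graph G u \<le> K * M0 * (if (0::real) = 0 then 1 else 0 powr (- 1 / 4))"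
        by (rule mass[OF u order_refl M0]) (use bound0[OF u] assms(11) in auto)
      then show "L2_norm_graph G u \<le> C" using C by simp
    qed (use C in simp)
  next
    fix u e x assume "solves G p W \<rho> 0 u \<and> morse_index G p W \<rho> 0 u \<le> enat m" "e \<in> half_lines G" "x \<in> interval_of G e"
    then show "on_edge G u e x = 0" using half_line_zero by blast
  next
    fix \<Lambda> :: real assume \<Lambda>: "0 < \<Lambda> \<and> \<Lambda> \<le> \<Lambda>0"
    show "q_max G p W \<rho> m \<Lambda> \<le> ereal (C * \<Lambda> powr (- 1 / 4))"
    proof (rule q_max_le)
      fix u assume u: "solves G p W \<rho> \<Lambda> u" "morse_index G p W \<rho> \<Lambda> u \<le> enat m"
      have "L2_norm_graph G u \<le> K * M0 * (if \<Lambda> = 0 then 1 else \<Lambda> powr (- 1 / 4))"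
        by (rule mass[OF u _ M0]) (use bound0[OF u] \<Lambda> in auto)
      also have "\<dots> = K * M0 * \<Lambda> powr (- 1 / 4)" using \<Lambda> by simp
      also have "\<dots> \<le> C * \<Lambda> powr (- 1 / 4)" using C by (intro mult_right_mono) auto
      finally show "L2_norm_graph G u \<le> C * \<Lambda> powr (- 1 / 4)" .
    qed (use C in simp)
  next
    fix \<Lambda> :: real assume le: "\<Lambda>0 \<le> \<Lambda>"
    then have \<Lambda>: "0 < \<Lambda>" using assms(11) by simp
    show "q_max G p W \<rho> m \<Lambda> \<le> ereal (C * \<Lambda> powr ((6 - p) / (4 * (p - 2))))"
    proof (rule q_max_le)
      fix u assume u: "solves G p W \<rho> \<Lambda> u" "morse_index G p W \<rho> \<Lambda> u \<le> enat m"
      have "C0 * (L + \<Lambda>) powr (1 / (p - 2)) \<le> C0 * ((L / \<Lambda>0 + 1) * \<Lambda>) powr (1 / (p - 2))"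
      proof (intro mult_left_mono powr_mono2)
        have "L \<le> L / \<Lambda>0 * \<Lambda>" using L le assms(11) by (simp add: field_simps mult_left_mono)
        then show "L + \<Lambda> \<le> (L / \<Lambda>0 + 1) * \<Lambda>" by (simp add: distrib_right)
      qed (use C0 L \<Lambda> p in auto)
      also have "\<dots> = M1 * \<Lambda> powr (1 / (p - 2))"
        using L assms(11) \<Lambda> by (simp add: M1_def powr_mult)
      finally have le1: "C0 * (L + \<Lambda>) powr (1 / (p - 2)) \<le> M1 * \<Lambda> powr (1 / (p - 2))" .
      have "L2_norm_graph G u \<le> K * (M1 * \<Lambda> powr (1 / (p - 2))) * (if \<Lambda> = 0 then 1 else \<Lambda> powr (- 1 / 4))"
        by (rule mass[OF u]) (use \<Lambda> M1 bound[OF u] le1 in \<open>auto intro: order_trans\<close>)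
      also have "\<dots> = K * M1 * (\<Lambda> powr (1 / (p - 2)) * \<Lambda> powr (- 1 / 4))" using \<Lambda> by simp
      also have "\<Lambda> powr (1 / (p - 2)) * \<Lambda> powr (- 1 / 4) = \<Lambda> powr (1 / (p - 2) + (- 1 / 4))" by (simp only: powr_add)
      also have "1 / (p - 2) + (- 1 / 4) = (6 - p) / (4 * (p - 2))" using p by (simp add: field_simps)
      also have "K * M1 * \<Lambda> powr ((6 - p) / (4 * (p - 2))) \<le> C * \<Lambda> powr ((6 - p) / (4 * (p - 2)))"
        using C by (intro mult_right_mono) auto
      finally show "L2_norm_graph G u \<le> C * \<Lambda> powr ((6 - p) / (4 * (p - 2)))" .
    qed (use C in simp)
  qed
qed

end
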